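(* Let $\vec{\mathcal{M}}=(\mathcal{M}_1,\mathcal{M}_2,\mathcal{M}_3)^T$ be a vector-valued distribution on $\mathbb{R}^3$ with compact support $Q\subset\mathbb{R}^3$, and let $h>0$ be fixed (with the coordinate origin chosen so that $Q$ lies below the plane $x_3=h$, i.e. $t_3<h$ for $\vec t\in Q$). For $\mathbf{x}=(x_1,x_2)\in\mathbb{R}^2$ let $$B_3(\mathbf{x},h)=\iiint_{Q}\frac{3(h-t_3)\left[\mathcal{M}_1(\mathbf{t},t_3)(x_1-t_1)+\mathcal{M}_2(\mathbf{t},t_3)(x_2-t_2)\right]+\mathcal{M}_3(\mathbf{t},t_3)\left(2(h-t_3)^2-|\mathbf{x}-\mathbf{t}|^2\right)}{4\pi\left(|\mathbf{x}-\mathbf{t}|^2+(h-t_3)^2\right)^{5/2}}\,d^3t,$$ where $\mathbf{t}=(t_1,t_2)$ and the integral is understood as the distributional pairing of $\vec{\mathcal{M}}$ with the given smooth kernels. Let $\vec m=(m_1,m_2,m_3)^T:=\iiint_Q\vec{\mathcal{M}}(\vec x)\,d^3x$ be the net moment, and for $A>0$ let $D_A=\{\mathbf{x}\in\mathbb{R}^2:|\mathbf{x}|<A\}$. Suppose $A$ is sufficiently large that $$\sup_{\vec t\in Q,\ \mathbf{x}\in\mathbb{R}^2\setminus D_A}\left|\frac{t_1^2+t_2^2+(h-t_3)^2}{x_1^2+x_2^2}-2\frac{x_1t_1+x_2t_2}{x_1^2+x_2^2}\right|<1.$$ Then, as $A\to\infty$ (with $\vec{\mathcal M}$ and $h$ fixed),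 the following hold, for each $j\in\{1,2\}$: First order: $m_j=2\iint_{D_A}x_jB_3(\mathbf{x},h)\,d^2x+\mathcal{O}(1/A)$. Second order: $m_j=2\iint_{D_A}\left(1+\frac{4x_j^2}{3A^2}\right)x_jB_3(\mathbf{x},h)\,d^2x+\mathcal{O}(1/A^2)$, and $m_3=2A\iint_{D_A}B_3(\mathbf{x},h)\,d^2x+\mathcal{O}(1/A^2)$. Third order: $m_j=\frac{2}{5}\iint_{D_A}\left[5+24\left(\frac{x_j}{A}\right)^4\right]x_jB_3(\mathbf{x},h)\,d^2x+\mathcal{O}(1/A^3)$, and $m_3=\frac{A}{4}\iint_{D_A}\left[5+40\left(\frac{x_j}{A}\right)^4-128\left(\frac{x_j}{A}\right)^6\right]B_3(\mathbf{x},h)\,d^2x+\mathcal{O}(1/A^3)$. Fourth order: $m_j=\frac{2}{105}\iint_{D_A}\left[105-2016\left(\frac{x_j}{A}\right)^4+19200\left(\frac{x_j}{A}\right)^6-22400\left(\frac{x_j}{A}\right)^8\right]x_jB_3(\mathbf{x},h)\,d^2x+\mathcal{O}(1/A^4)$, and $m_3=\frac{A}{24}\iint_{D_A}\left[35+1792\left(\frac{x_j}{A}\right)^6-3200\left(\frac{x_j}{A}\right)^8\right]B_3(\mathbf{x},h)\,d^2x+\mathcal{O}(1/A^4)$. Fifth order: $m_j=\frac{2}{693}\iint_{D_A}\left[693-158400\left(\frac{x_j}{A}\right)^6+739200\left(\frac{x_j}{A}\right)^8-677376\left(\frac{x_j}{A}\right)^{10}\right]x_jB_3(\mathbf{x}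,h)\,d^2x+\mathcal{O}(1/A^5)$.
   Context: Physical units are chosen so that the vacuum magnetic permeability $\mu_0$ equals $1$. $B_3(\cdot,h)$ is the vertical component of the magnetic field $\vec B=-\nabla\Phi$ generated by the magnetisation $\vec{\mathcal M}$, measured on the horizontal plane $x_3=h$; $\Delta\Phi=\nabla\cdot\vec{\mathcal M}$ in the distributional sense. Coordinates are chosen so that $\mathbf{x}=\mathbf{0}$ is the horizontal centre of the smallest rectangular box containing $Q$ and $x_3=0$ is the lowest point of $Q$. The constants implicit in the $\mathcal{O}(\cdot)$ terms may depend on $\vec{\mathcal M}$ and $h$ but not on $A$. *)

theory Defs
  imports "HOL-Analysis.Analysis" "HOL-Library.Landau_Symbols"
begin

definition pderiv3 :: "3 \<Rightarrow> (real^3 \<Rightarrow> real) \<Rightarrow> real^3 \<Rightarrow> real" where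
  "pderiv3 i f x = deriv (\<lambda>s. f (x + s *\<^sub>R axis i 1)) 0"

primrec pderivs :: "3 list \<Rightarrow> (real^3 \<Rightarrow> real) \<Rightarrow> real^3 \<Rightarrow> real" where
  "pderivs [] f = f"
| "pderivs (i # is) f = pderiv3 i (pderivs is f)"

definition smooth3_on :: "(real^3) set \<Rightarrow> (real^3 \<Rightarrow> real) \<Rightarrow> bool" where
  "smooth3_on U f \<longleftrightarrow> (\<forall>is. \<forall>x\<in>U. pderivs is f differentiable (at x))"

text \<open>A distribution with compact support: a linear functional on C-infinity(R^3)
  that is continuous, i.e. bounded by finitely many derivative seminorms over a compact set.\<close>
definition cdistr :: "((real^3 \<Rightarrow> real) \<Rightarrow> real) \<Rightarrow> bool" where
  "cdistr T \<longleftrightarrow>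
     (\<forall>f g a b. smooth3_on UNIV f \<longrightarrow> smooth3_on UNIV g \<longrightarrow>
        T (\<lambda>x. a * f x + b * g x) = a * T f + b * T g) \<and>
     (\<exists>K C N. compact K \<and> K \<noteq> {} \<and>
        (\<forall>\<phi>. smooth3_on UNIV \<phi> \<longrightarrow>
           \<bar>T \<phi>\<bar> \<le> C * (\<Sum>is\<in>{is :: 3 list. length is \<le> N}. SUP x\<in>K. \<bar>pderivs is \<phi> x\<bar>)))"

definition dsupp :: "((real^3 \<Rightarrow> real) \<Rightarrow> real) \<Rightarrow> (real^3) set" where
  "dsupp T = - \<Union>{U. open U \<and>
      (\<forall>\<phi>. smooth3_on UNIV \<phi> \<and> compact (closure {x. \<phi> x \<noteq> 0}) \<and>
            closure {x. \<phi> x \<noteq> 0} \<subseteq> U \<longrightarrow> T \<phi> = 0)}"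

text \<open>Pairing of a compactly supported distribution with a function that is smooth
  on a neighbourhood of its support: apply it to any global smooth function agreeing
  with f near the support (well defined by the support property).\<close>
definition dpair :: "((real^3 \<Rightarrow> real) \<Rightarrow> real) \<Rightarrow> (real^3 \<Rightarrow> real) \<Rightarrow> real" where
  "dpair T f = T (SOME g. smooth3_on UNIV g \<and>
      (\<exists>U. open U \<and> dsupp T \<subseteq> U \<and> (\<forall>x\<in>U. g x = f x)))"

definition hdist2 :: "real^2 \<Rightarrow> real^3 \<Rightarrow> real" where
  "hdist2 x t = (x$1 - t$1)^2 + (x$2 - t$2)^2"

definition kerB :: "real \<Rightarrow> real^2 \<Rightarrow> 3 \<Rightarrow> real^3 \<Rightarrow> real" where
  "kerB h x i t =
     (if i = 3 then 2 * (h - t$3)^2 - hdist2 x t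
      else if i = 1 then 3 * (h - t$3) * (x$1 - t$1)
      else 3 * (h - t$3) * (x$2 - t$2))
     / (4 * pi * (hdist2 x t + (h - t$3)^2) powr (5/2))"

definition B3 :: "(3 \<Rightarrow> (real^3 \<Rightarrow> real) \<Rightarrow> real) \<Rightarrow> real \<Rightarrow> real^2 \<Rightarrow> real" where
  "B3 M h x = dpair (M 1) (kerB h x 1) + dpair (M 2) (kerB h x 2) + dpair (M 3) (kerB h x 3)"

definition moment :: "(3 \<Rightarrow> (real^3 \<Rightarrow> real) \<Rightarrow> real) \<Rightarrow> 3 \<Rightarrow> real" where
  "moment M i = M i (\<lambda>_. 1)"

definition large_enough :: "(real^3) set \<Rightarrow> real \<Rightarrow> real \<Rightarrow> bool" where
  "large_enough Q h A \<longleftrightarrow>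
     (SUP p \<in> Q \<times> (UNIV - ball (0::real^2) A).
        \<bar>((fst p)$1^2 + (fst p)$2^2 + (h - (fst p)$3)^2) / ((snd p)$1^2 + (snd p)$2^2)
          - 2 * ((snd p)$1 * (fst p)$1 + (snd p)$2 * (fst p)$2) / ((snd p)$1^2 + (snd p)$2^2)\<bar>) < 1"

end

(*
Near the support the kernel of B3 is the i-th t-derivative of the Poisson kernel w / R^3 / (4 pi) with
w = h - t3, so 4 pi B3(x) is the pairing of the scalar distribution S = - div M with w / R^3.

Inserting x = r omega and expanding w / R^3 in powers of 1/r, with all t-derivatives of the remainder
bounded near the support, expands B3 in powers of 1/r with trigonometric polynomials in omega as
coefficients.  In polar coordinates the integral of x_j^q B3 over D_A becomes a constant plus powers
of A, whose coefficients involve only the integrals of powers of the cosine; the weights of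
the theorem are chosen such that the unwanted powers cancel.

The constant matters only for q = 0 and q = 1.  There w / R^3, respectively its product with x_j - t_j, is
a divergence in x, so that the integral over D_A is a boundary integral whose limit is read off at
infinity: it is S(1) = 0 for q = 0 and S(t_j) / 2 = m_j / 2 for q = 1.
*)

theory Submission
  imports Defs
begin

section \<open>Smooth families of functions\<close>

text \<open>Two obstacles shape the proof. A distribution acts here on globally smooth functions,
  while the kernel is singular at the measuring point and enters \<open>B3\<close> through an
  arbitrary smooth extension. So the height \<open>w\<close> is bent to stay positive off the
  support, and a pairing is shown to depend only on values near the support. Limits, derivatives and
  integrals in r and \<theta> must also pass through the pairing; this is why functions of t are
  handled as families whose t-derivatives of every order are jointly continuous. With \<rho> = 1/r,
  infinity is the ordinary parameter value \<rho> = 0. A power 1/r would integrate to a logarithm;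
  parity in \<theta> removes it. The constant of integration is unknown for q > 1. In an estimate of
  order N it is harmless only for q > N, after scaling by A, so the weights combine q = 1 (or q = 0)
  with the next exponents of the same parity above N. Their coefficients meet one normalisation and
  the vanishing of the lower order terms, with as many coefficients as conditions: one for m_j at
  order 1, two at orders 2 and 3, four at orders 4 and 5; for m_3 one at order 2, three at orders 3
  and 4.\<close>

definition smooth_family :: "'y::topological_space set \<Rightarrow> ('y \<Rightarrow> real^3 \<Rightarrow> real) \<Rightarrow> bool" where
  "smooth_family Y f \<longleftrightarrow> (\<forall>is. (\<forall>y\<in>Y. \<forall>t. pderivs is (f y) differentiable (at t)) \<and>
     continuous_on (Y \<times> UNIV) (\<lambda>(y, t). pderivs is (f y) t))"

lemma pderiv3_eq:
  assumes "(f has_derivative f') (at x)"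
  shows "pderiv3 i f x = f' (axis i 1)"
proof -
  have "((\<lambda>s. f (x + s *\<^sub>R axis i 1)) has_derivative (\<lambda>s. f' (s *\<^sub>R axis i 1))) (at 0)"
    by (rule has_derivative_compose[where g = f and f = "\<lambda>s. x + s *\<^sub>R axis i 1"])
       (auto intro!: derivative_eq_intros assms)
  moreover have "f' (s *\<^sub>R axis i 1) = f' (axis i 1) * s" for s
    using linear_scale[OF has_derivative_linear[OF assms], of s "axis i 1"] by simp
  ultimately have "((\<lambda>s. f (x + s *\<^sub>R axis i 1)) has_field_derivative f' (axis i 1)) (at 0)"
    by (simp add: has_field_derivative_def)
  then show ?thesis
    unfolding pderiv3_def by (rule DERIV_imp_deriv)
qed

lemma pderiv3_has_derivative:
  assumes "f differentiable (at x)"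
  shows "(f has_derivative (\<lambda>h. \<Sum>i\<in>UNIV. h $ i * pderiv3 i f x)) (at x)"
proof -
  obtain f' where f': "(f has_derivative f') (at x)"
    using assms by (auto simp: differentiable_def)
  have "f' h = (\<Sum>i\<in>UNIV. h $ i * pderiv3 i f x)" for h
  proof -
    have "f' h = f' (\<Sum>i\<in>UNIV. h $ i *s axis i 1)"
      by (simp add: basis_expansion)
    also have "\<dots> = (\<Sum>i\<in>UNIV. h $ i * f' (axis i 1))"
      using has_derivative_linear[OF f']
      by (simp add: linear_sum linear_scale flip: scalar_mult_eq_scaleR)
         (simp add: linear_sum linear_scale scalar_mult_eq_scaleR)
    finally show ?thesis by (simp add: pderiv3_eq[OF f'])
  qed
  then show ?thesis using f' by presburger
qed

lemma pderiv3_line: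
  assumes "f differentiable (at (x + s *\<^sub>R axis i 1))"
  shows "((\<lambda>s. f (x + s *\<^sub>R axis i 1)) has_field_derivative pderiv3 i f (x + s *\<^sub>R axis i 1)) (at s)"
proof -
  obtain f' where f': "(f has_derivative f') (at (x + s *\<^sub>R axis i 1))"
    using assms by (auto simp: differentiable_def)
  have "((\<lambda>s. f (x + s *\<^sub>R axis i 1)) has_derivative (\<lambda>s. f' (s *\<^sub>R axis i 1))) (at s)"
    by (rule has_derivative_compose[where g = f and f = "\<lambda>s. x + s *\<^sub>R axis i 1"])
       (auto intro!: derivative_eq_intros f')
  moreover have "f' (s' *\<^sub>R axis i 1) = pderiv3 i f (x + s *\<^sub>R axis i 1) * s'" for s'
    using linear_scale[OF has_derivative_linear[OF f'], of s' "axis i 1"] pderiv3_eq[OF f', of i] by simp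
  ultimately show ?thesis
    by (simp add: has_field_derivative_def)
qed

text \<open>The power in the denominator makes the family over \<open>k\<close> closed under
  differentiation; \<open>flat 0\<close> alone, the usual smooth function that is flat at 0, is not.
  No formula for higher derivatives is then needed.\<close>

definition flat :: "nat \<Rightarrow> real \<Rightarrow> real" where
  "flat k v = (if v > 0 then exp (- 1 / v) / v ^ k else 0)"

lemma flat_nonneg: "flat k v \<ge> 0"
  by (simp add: flat_def)

lemma flat_0_pos_iff [simp]: "flat 0 v > 0 \<longleftrightarrow> v > 0"
  by (simp add: flat_def)

lemma flat_derivative:
  "(flat k has_real_derivative (flat (k + 2) v - k * flat (k + 1) v)) (at v)"
proof (cases "v > 0")
  case True
  have "((\<lambda>v. exp (- 1 / v) / v ^ k) has_real_derivative (flat (k + 2) v - k * flat (k + 1) v)) (at v)"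
    using True
    by (auto intro!: derivative_eq_intros simp: flat_def field_simps power2_eq_square power_diff
             split: nat_diff_split)
  moreover have "\<forall>\<^sub>F u in nhds v. exp (- 1 / u) / u ^ k = flat k u"
    using eventually_nhds_in_open[of "{0<..}" v] True
    by (auto elim!: eventually_mono simp: flat_def)
  ultimately show ?thesis
    using DERIV_cong_ev[of v v "\<lambda>v. exp (- 1 / v) / v ^ k" "flat k"] by auto
next
  case False
  show ?thesis
  proof (cases "v = 0")
    case True
    \<comment> \<open>The difference quotient of \<open>flat k\<close> at 0 is
      \<open>flat (Suc k)\<close>, whose one-sided limits are therefore needed. On the right, with z
      = 1/u, the exponential beats the power of z.\<close>
    have "((\<lambda>u::real. exp (- 1 / u) / u ^ (Suc k)) \<longlongrightarrow> 0) (at_right 0)"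
    proof -
      have "((\<lambda>z::real. z ^ Suc k / exp z) \<longlongrightarrow> 0) at_top"
        by (rule tendsto_power_div_exp_0)
      then have "((\<lambda>z::real. inverse z ^ Suc k / exp (inverse z)) \<longlongrightarrow> 0) (at_right 0)"
        by (simp add: filterlim_at_top_to_right del: power_Suc)
      then show ?thesis
        by (simp add: exp_minus field_simps power_inverse del: power_Suc)
    qed
    then have "((\<lambda>u. flat (Suc k) u) \<longlongrightarrow> 0) (at_right 0)"
      by (rule Lim_transform_eventually) (auto simp: flat_def eventually_at_right_less intro!: eventually_at_rightI[of 0 1])
    moreover have "((\<lambda>u. flat (Suc k) u) \<longlongrightarrow> 0) (at_left 0)"
      by (rule Lim_transform_eventually[of "\<lambda>_. 0"]) (auto simp: flat_def intro!: eventually_at_leftI[of "-1" 0])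
    ultimately have "((\<lambda>u. flat (Suc k) u) \<longlongrightarrow> 0) (at 0)"
      by (simp add: filterlim_split_at)
    then have "(flat k has_real_derivative 0) (at 0)"
      unfolding has_field_derivative_iff
      by (rule Lim_transform_eventually) (auto simp: flat_def eventually_at_filter)
    then show ?thesis using True by (simp add: flat_def)
  next
    case v: False
    have "((\<lambda>v. 0) has_real_derivative (flat (k + 2) v - k * flat (k + 1) v)) (at v)"
      using False by (simp add: flat_def)
    moreover have "\<forall>\<^sub>F u in nhds v. 0 = flat k u"
      using eventually_nhds_in_open[of "{..<0}" v] v False
      by (auto elim!: eventually_mono simp: flat_def)
    ultimately show ?thesis
      using DERIV_cong_ev[of v v "\<lambda>v. 0" "flat k"] by auto
  qed
qed

lemma continuous_on_flat [continuous_intros]: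
  "continuous_on S f \<Longrightarrow> continuous_on S (\<lambda>x. flat k (f x))"
  by (rule continuous_on_compose2[of UNIV])
     (auto intro!: DERIV_continuous_on[OF flat_derivative[THEN DERIV_subset]])

lemma smooth_familyD:
  assumes "smooth_family Y f"
  shows "y \<in> Y \<Longrightarrow> pderivs is (f y) differentiable (at t)"
    and "continuous_on (Y \<times> UNIV) (\<lambda>(y, t). pderivs is (f y) t)"
    and "y \<in> Y \<Longrightarrow> smooth3_on UNIV (f y)"
  using assms by (auto simp: smooth_family_def smooth3_on_def)

lemma pderivs_append: "pderivs (is @ js) f = pderivs is (pderivs js f)"
  by (induction "is") auto

lemma smooth_family_pderivs:
  assumes "smooth_family Y f"
  shows "smooth_family Y (\<lambda>y. pderivs js (f y))"
  using assms unfolding smooth_family_def pderivs_append[symmetric] by auto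

lemma smooth_family_pderiv3:
  assumes "smooth_family Y f"
  shows "smooth_family Y (\<lambda>y. pderiv3 i (f y))"
  using smooth_family_pderivs[OF assms, of "[i]"] by simp

lemma smooth_family_reindex:
  assumes "smooth_family Y f" "continuous_on X g" "g ` X \<subseteq> Y"
  shows "smooth_family X (\<lambda>x. f (g x))"
  unfolding smooth_family_def
proof (intro allI conjI ballI)
  fix "is" x t assume "x \<in> X"
  then show "pderivs is (f (g x)) differentiable (at t)"
    using assms by (auto intro: smooth_familyD(1))
next
  fix "is"
  have "continuous_on (X \<times> UNIV) (\<lambda>p. (\<lambda>(y, t). pderivs is (f y) t) (g (fst p), snd p))"
    by (rule continuous_on_compose2[OF smooth_familyD(2)[OF assms(1)]])
       (use assms in \<open>auto intro!: continuous_intros continuous_on_compose2[OF assms(2)]\<close>)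
  then show "continuous_on (X \<times> UNIV) (\<lambda>(x, t). pderivs is (f (g x)) t)"
    by (simp add: case_prod_beta)
qed

text \<open>The closure of the smooth families under the operations below is closed under
  partial derivatives; hence all its members are smooth families themselves.\<close>

inductive family_closure :: "'y::topological_space set \<Rightarrow> ('y \<Rightarrow> real^3 \<Rightarrow> real) \<Rightarrow> bool" for Y where
  base: "smooth_family Y f \<Longrightarrow> family_closure Y f"
| const: "continuous_on Y c \<Longrightarrow> family_closure Y (\<lambda>y t. c y)"
| coord: "family_closure Y (\<lambda>y t. t $ i)"
| add: "family_closure Y f \<Longrightarrow> family_closure Y g \<Longrightarrow> family_closure Y (\<lambda>y t. f y t + g y t)"
| mult: "family_closure Y f \<Longrightarrow> family_closure Y g \<Longrightarrow> family_closure Y (\<lambda>y t. f y t * g y t)"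
| inv: "family_closure Y f \<Longrightarrow> (\<And>y t. y \<in> Y \<Longrightarrow> f y t \<noteq> 0) \<Longrightarrow> family_closure Y (\<lambda>y t. inverse (f y t))"
| sqrt: "family_closure Y f \<Longrightarrow> (\<And>y t. y \<in> Y \<Longrightarrow> f y t > 0) \<Longrightarrow> family_closure Y (\<lambda>y t. sqrt (f y t))"
| flat: "family_closure Y f \<Longrightarrow> family_closure Y (\<lambda>y t. flat k (f y t))"

lemma family_closure_continuous:
  assumes "family_closure Y f"
  shows "continuous_on (Y \<times> UNIV) (\<lambda>(y, t). f y t)"
  using assms
proof induction
  case (base f)
  then show ?case using smooth_familyD(2)[of Y f "[]"] by simp
next
  case (const c)
  then show ?case
    by (auto simp: case_prod_beta intro!: continuous_on_compose2[OF const] continuous_intros)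
qed (auto simp: case_prod_beta intro!: continuous_intros order_less_imp_not_eq2)

text \<open>A total derivative with coefficients again in the closure gives differentiability and
  the next partial derivatives at once, so that it can be iterated. Only parameters in
  \<open>Y\<close> are constrained, hence the existential \<open>f'\<close> in place of
  \<open>pderiv3\<close>.\<close>

lemma family_closure_derivative:
  assumes "family_closure Y f"
  shows "\<exists>f'. (\<forall>i. family_closure Y (f' i)) \<and>
    (\<forall>y\<in>Y. \<forall>t. (f y has_derivative (\<lambda>h. \<Sum>i\<in>UNIV. h $ i * f' i y t)) (at t))"
  using assms
proof induction
  case (base f)
  then show ?case
    using smooth_family_pderiv3[OF base] smooth_familyD(1)[of Y f _ "[]"]
    by (intro exI[of _ "\<lambda>i y. pderiv3 i (f y)"]) (auto intro: family_closure.base pderiv3_has_derivative)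
next
  case (const c)
  then show ?case
    by (intro exI[of _ "\<lambda>i y t. 0"]) (auto intro: family_closure.const)
next
  case (coord i)
  have "(\<lambda>h::real^3. \<Sum>j\<in>UNIV. h $ j * (if j = i then 1 else 0)) = (\<lambda>h. h $ i)"
    by (auto simp: if_distrib[of "\<lambda>x. _ * x"] cong: if_cong)
  then show ?case
    by (intro exI[of _ "\<lambda>j y t. if j = i then 1 else 0"])
       (auto intro: family_closure.const bounded_linear_imp_has_derivative bounded_linear_vec_nth)
next
  case (add f g)
  obtain f' where f': "\<forall>i. family_closure Y (f' i)"
    "\<forall>y\<in>Y. \<forall>t. (f y has_derivative (\<lambda>h. \<Sum>i\<in>UNIV. h $ i * f' i y t)) (at t)"
    using add.IH(1) by (elim exE conjE)
  obtain g' where g': "\<forall>i. family_closure Y (g' i)"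
    "\<forall>y\<in>Y. \<forall>t. (g y has_derivative (\<lambda>h. \<Sum>i\<in>UNIV. h $ i * g' i y t)) (at t)"
    using add.IH(2) by (elim exE conjE)
  note * = f'(1)[rule_format] g'(1)[rule_format] f'(2)[rule_format] g'(2)[rule_format]
  show ?case
    by (rule exI[of _ "\<lambda>i y t. f' i y t + g' i y t"], intro conjI allI ballI)
       (auto intro!: family_closure.const family_closure.add family_closure.mult family_closure.inv family_closure.sqrt family_closure.flat * has_derivative_eq_rhs[OF has_derivative_add[OF *(3,4)]]
         simp: algebra_simps sum.distrib)
next
  case (mult f g)
  obtain f' where f': "\<forall>i. family_closure Y (f' i)"
    "\<forall>y\<in>Y. \<forall>t. (f y has_derivative (\<lambda>h. \<Sum>i\<in>UNIV. h $ i * f' i y t)) (at t)"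
    using mult.IH(1) by (elim exE conjE)
  obtain g' where g': "\<forall>i. family_closure Y (g' i)"
    "\<forall>y\<in>Y. \<forall>t. (g y has_derivative (\<lambda>h. \<Sum>i\<in>UNIV. h $ i * g' i y t)) (at t)"
    using mult.IH(2) by (elim exE conjE)
  note * = f'(1)[rule_format] g'(1)[rule_format] f'(2)[rule_format] g'(2)[rule_format]
  show ?case
    by (rule exI[of _ "\<lambda>i y t. f y t * g' i y t + f' i y t * g y t"], intro conjI allI ballI)
       (auto intro!: family_closure.const family_closure.add family_closure.mult family_closure.inv family_closure.sqrt family_closure.flat mult * has_derivative_eq_rhs[OF has_derivative_mult[OF *(3,4)]]
         simp: algebra_simps sum.distrib sum_distrib_left)
next
  case (inv f)
  obtain f' where f': "\<forall>i. family_closure Y (f' i)"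
    "\<forall>y\<in>Y. \<forall>t. (f y has_derivative (\<lambda>h. \<Sum>i\<in>UNIV. h $ i * f' i y t)) (at t)"
    using inv.IH by (elim exE conjE)
  note * = f'(1)[rule_format] f'(2)[rule_format]
  show ?case
  \<comment> \<open>The factor \<open>- 1\<close> and the repeated inverse are there to fit the
    rules of the closure, which has products and inverses but neither negation nor powers.\<close>
  proof (rule exI[of _ "\<lambda>i y t. - 1 * (f' i y t * (inverse (f y t) * inverse (f y t)))"], intro conjI allI ballI)
    fix i
    show "family_closure Y (\<lambda>y t. - 1 * (f' i y t * (inverse (f y t) * inverse (f y t))))"
      by (intro family_closure.const family_closure.mult family_closure.inv inv * continuous_on_const)
  next
    fix y t assume "y \<in> Y"
    then show "((\<lambda>t. inverse (f y t)) has_derivative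
      (\<lambda>h. \<Sum>i\<in>UNIV. h $ i * (- 1 * (f' i y t * (inverse (f y t) * inverse (f y t)))))) (at t)"
      by (intro has_derivative_eq_rhs[OF Deriv.has_derivative_inverse[OF inv(2) *(2)]])
         (auto simp: fun_eq_iff algebra_simps sum_distrib_left sum_negf)
  qed
next
  case (sqrt f)
  obtain f' where f': "\<forall>i. family_closure Y (f' i)"
    "\<forall>y\<in>Y. \<forall>t. (f y has_derivative (\<lambda>h. \<Sum>i\<in>UNIV. h $ i * f' i y t)) (at t)"
    using sqrt.IH by (elim exE conjE)
  note * = f'(1)[rule_format] f'(2)[rule_format]
  show ?case
  proof (rule exI[of _ "\<lambda>i y t. 1 / 2 * (f' i y t * inverse (sqrt (f y t)))"], intro conjI allI ballI)
    fix i
    show "family_closure Y (\<lambda>y t. 1 / 2 * (f' i y t * inverse (sqrt (f y t))))"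
      by (intro family_closure.const family_closure.add family_closure.mult family_closure.inv family_closure.sqrt family_closure.flat sqrt * continuous_on_const)
         (use sqrt(2) in \<open>auto simp: order_less_imp_not_eq2\<close>)
  next
    fix y t assume "y \<in> Y"
    then show "((\<lambda>t. sqrt (f y t)) has_derivative
      (\<lambda>h. \<Sum>i\<in>UNIV. h $ i * (1 / 2 * (f' i y t * inverse (sqrt (f y t)))))) (at t)"
      by (intro has_derivative_eq_rhs[OF has_derivative_real_sqrt[OF sqrt(2) *(2)]])
         (auto simp: fun_eq_iff sum_distrib_right sum_divide_distrib field_simps)
  qed
next
  case (flat f k)
  obtain f' where f': "\<forall>i. family_closure Y (f' i)"
    "\<forall>y\<in>Y. \<forall>t. (f y has_derivative (\<lambda>h. \<Sum>i\<in>UNIV. h $ i * f' i y t)) (at t)"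
    using flat.IH by (elim exE conjE)
  note * = f'(1)[rule_format] f'(2)[rule_format]
  show ?case
  proof (rule exI[of _ "\<lambda>i y t. f' i y t * (flat (k + 2) (f y t) + (- real k) * flat (k + 1) (f y t))"], intro conjI allI ballI)
    fix i
    show "family_closure Y (\<lambda>y t. f' i y t * (flat (k + 2) (f y t) + (- real k) * flat (k + 1) (f y t)))"
      by (intro family_closure.const family_closure.add family_closure.mult family_closure.inv family_closure.sqrt family_closure.flat flat * continuous_on_const)
  next
    fix y t assume "y \<in> Y"
    have "(flat k has_derivative (\<lambda>u. (flat (k + 2) (f y t) - k * flat (k + 1) (f y t)) * u)) (at (f y t))"
      using flat_derivative[of k "f y t"] by (simp add: has_field_derivative_def)
    from has_derivative_compose[OF *(2)[OF \<open>y \<in> Y\<close>] this]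
    show "((\<lambda>t. flat k (f y t)) has_derivative (\<lambda>h. \<Sum>i\<in>UNIV. h $ i *
       (f' i y t * (flat (k + 2) (f y t) + (- real k) * flat (k + 1) (f y t))))) (at t)"
      by (rule has_derivative_eq_rhs) (auto simp: fun_eq_iff sum_distrib_left sum_subtractf algebra_simps)
  qed
qed

lemma family_closure_pderivs:
  assumes "family_closure Y f"
  shows "\<exists>g. family_closure Y g \<and> (\<forall>y\<in>Y. pderivs is (f y) = g y)"
proof (induction "is")
  case Nil
  then show ?case using assms by auto
next
  case (Cons i "is")
  then obtain g where g: "family_closure Y g" "\<And>y. y \<in> Y \<Longrightarrow> pderivs is (f y) = g y" by auto
  obtain g' where g': "\<And>i. family_closure Y (g' i)"
    "\<And>y t. y \<in> Y \<Longrightarrow> (g y has_derivative (\<lambda>h. \<Sum>i\<in>UNIV. h $ i * g' i y t)) (at t)"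
    using family_closure_derivative[OF g(1)] by auto
  have "pderiv3 i (g y) = g' i y" if "y \<in> Y" for y
    using pderiv3_eq[OF g'(2)[OF that], where i = i]
    by (simp add: fun_eq_iff axis_def if_distrib[of "\<lambda>x. x * _"] cong: if_cong)
  then show ?case
    using g(2) g'(1) by (intro exI[of _ "g' i"]) auto
qed

lemma family_closure_smooth: "family_closure Y f \<Longrightarrow> smooth_family Y f"
  unfolding smooth_family_def
proof (intro allI conjI ballI)
  fix "is" assume "family_closure Y f"
  then obtain g where g: "family_closure Y g" "\<And>y. y \<in> Y \<Longrightarrow> pderivs is (f y) = g y"
    using family_closure_pderivs by blast
  show "pderivs is (f y) differentiable (at t)" if "y \<in> Y" for y t
    using family_closure_derivative[OF g(1)] that by (auto simp: g differentiable_def)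
  show "continuous_on (Y \<times> UNIV) (\<lambda>(y, t). pderivs is (f y) t)"
    using family_closure_continuous[OF g(1)] by (rule continuous_on_eq) (auto simp: g)
qed

section \<open>Calculus rules for smooth families\<close>

named_theorems smooth_family_intros

lemma smooth_family_const [smooth_family_intros]:
  "continuous_on Y c \<Longrightarrow> smooth_family Y (\<lambda>y t. c y)"
  by (intro family_closure_smooth family_closure.const)

lemma smooth_family_coord [smooth_family_intros]: "smooth_family Y (\<lambda>y t. t $ i)"
  by (intro family_closure_smooth family_closure.coord)

lemma smooth_family_add [smooth_family_intros]:
  "smooth_family Y f \<Longrightarrow> smooth_family Y g \<Longrightarrow> smooth_family Y (\<lambda>y t. f y t + g y t)"
  by (rule family_closure_smooth[OF family_closure.add[OF family_closure.base family_closure.base]])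

lemma smooth_family_mult [smooth_family_intros]:
  "smooth_family Y f \<Longrightarrow> smooth_family Y g \<Longrightarrow> smooth_family Y (\<lambda>y t. f y t * g y t)"
  by (rule family_closure_smooth[OF family_closure.mult[OF family_closure.base family_closure.base]])

lemma smooth_family_minus [smooth_family_intros]:
  "smooth_family Y f \<Longrightarrow> smooth_family Y (\<lambda>y t. - f y t)"
  using smooth_family_mult[OF smooth_family_const[OF continuous_on_const[of Y "-1"]]] by simp

lemma smooth_family_diff [smooth_family_intros]:
  "smooth_family Y f \<Longrightarrow> smooth_family Y g \<Longrightarrow> smooth_family Y (\<lambda>y t. f y t - g y t)"
  using smooth_family_add[OF _ smooth_family_minus] by fastforce

lemma smooth_family_inverse [smooth_family_intros]:
  "smooth_family Y f \<Longrightarrow> (\<And>y t. y \<in> Y \<Longrightarrow> f y t \<noteq> 0) \<Longrightarrow> smooth_family Y (\<lambda>y t. inverse (f y t))"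
  by (rule family_closure_smooth[OF family_closure.inv[OF family_closure.base]])

lemma smooth_family_divide [smooth_family_intros]:
  "smooth_family Y f \<Longrightarrow> smooth_family Y g \<Longrightarrow> (\<And>y t. y \<in> Y \<Longrightarrow> g y t \<noteq> 0) \<Longrightarrow>
    smooth_family Y (\<lambda>y t. f y t / g y t)"
  unfolding divide_inverse by (intro smooth_family_mult smooth_family_inverse)

lemma smooth_family_power [smooth_family_intros]:
  "smooth_family Y f \<Longrightarrow> smooth_family Y (\<lambda>y t. f y t ^ n)"
  by (induction n) (auto intro!: smooth_family_intros continuous_on_const)

lemma smooth_family_sqrt [smooth_family_intros]:
  "smooth_family Y f \<Longrightarrow> (\<And>y t. y \<in> Y \<Longrightarrow> f y t > 0) \<Longrightarrow> smooth_family Y (\<lambda>y t. sqrt (f y t))"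
  by (rule family_closure_smooth[OF family_closure.sqrt[OF family_closure.base]])

lemma smooth_family_flat [smooth_family_intros]:
  "smooth_family Y f \<Longrightarrow> smooth_family Y (\<lambda>y t. flat k (f y t))"
  by (rule family_closure_smooth[OF family_closure.flat[OF family_closure.base]])

lemma smooth_family_sum [smooth_family_intros]:
  "(\<And>i. i \<in> I \<Longrightarrow> smooth_family Y (f i)) \<Longrightarrow> smooth_family Y (\<lambda>y t. \<Sum>i\<in>I. f i y t)"
  by (induction I rule: infinite_finite_induct) (auto intro!: smooth_family_intros continuous_on_const)

lemma smooth3_continuous: "smooth3_on UNIV f \<Longrightarrow> continuous_on UNIV (pderivs is f)"
  by (auto simp: smooth3_on_def intro!: differentiable_imp_continuous_on differentiable_at_withinI
      simp: differentiable_on_def)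

lemma smooth_family_smooth3:
  assumes "smooth3_on UNIV f" shows "smooth_family Y (\<lambda>y. f)"
  using assms smooth3_continuous[OF assms]
  by (auto simp: smooth_family_def smooth3_on_def case_prod_beta
      intro!: continuous_on_compose2[where f = snd] continuous_intros)

text \<open>A single function is a constant family over a one-point parameter set, so the rules for
  families also prove smoothness of single functions.\<close>

lemma smooth3_iff: "smooth3_on UNIV f \<longleftrightarrow> smooth_family {0::real} (\<lambda>_. f)"
  using smooth_family_smooth3 smooth_familyD(3)[of "{0::real}" "\<lambda>_. f"] by auto

lemma pderivs_cong_open:
  assumes "open W" "\<And>x. x \<in> W \<Longrightarrow> f x = g x"
  shows "x \<in> W \<Longrightarrow> pderivs is f x = pderivs is g x"
proof (induction "is" arbitrary: x)
  case Nil
  then show ?case using assms by simp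
next
  case (Cons i "is")
  have "\<forall>\<^sub>F s in nhds 0. x + s *\<^sub>R axis i 1 \<in> W"
  proof (rule topological_tendstoD[OF _ assms(1)])
    show "((\<lambda>s::real. x + s *\<^sub>R axis i 1) \<longlongrightarrow> x + 0 *\<^sub>R axis i 1) (nhds 0)"
      by (intro tendsto_intros filterlim_ident)
  qed (use Cons in auto)
  then have "\<forall>\<^sub>F s in nhds 0. pderivs is f (x + s *\<^sub>R axis i 1) = pderivs is g (x + s *\<^sub>R axis i 1)"
    by (rule eventually_mono) (use Cons in auto)
  then show ?case
    by (auto simp: pderiv3_def intro!: deriv_cong_ev)
qed

section \<open>Distributions with compact support\<close>

text \<open>A sum of suprema is awkward in limit arguments; this form asks only for one number
  \<open>e\<close> dominating finitely many derivatives on a compact set.\<close>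

lemma cdistr_bound:
  assumes "cdistr T"
  obtains K C N where "compact K" "C \<ge> 0"
    "\<And>\<phi> e. smooth3_on UNIV \<phi> \<Longrightarrow> (\<And>is t. length is \<le> N \<Longrightarrow> t \<in> K \<Longrightarrow> \<bar>pderivs is \<phi> t\<bar> \<le> e) \<Longrightarrow> \<bar>T \<phi>\<bar> \<le> C * e"
proof -
  obtain K C N where K: "compact K" "K \<noteq> {}"
    and C: "\<And>\<phi>. smooth3_on UNIV \<phi> \<Longrightarrow>
      \<bar>T \<phi>\<bar> \<le> C * (\<Sum>is\<in>{is :: 3 list. length is \<le> N}. SUP x\<in>K. \<bar>pderivs is \<phi> x\<bar>)"
    using assms unfolding cdistr_def by blast
  define L where "L = {is :: 3 list. length is \<le> N}"
  show ?thesis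
  proof (rule that[of K "\<bar>C\<bar> * card L" N])
    fix \<phi> e
    assume \<phi>: "smooth3_on UNIV \<phi>" and e: "\<And>is t. length is \<le> N \<Longrightarrow> t \<in> K \<Longrightarrow> \<bar>pderivs is \<phi> t\<bar> \<le> e"
    have "0 \<le> (SUP x\<in>K. \<bar>pderivs is \<phi> x\<bar>) \<and> (SUP x\<in>K. \<bar>pderivs is \<phi> x\<bar>) \<le> e" if "is \<in> L" for "is"
    proof
      obtain x where "x \<in> K" using K by auto
      \<comment> \<open>The bound \<open>e\<close> also supplies the boundedness without which the
        supremum would have an unspecified value.\<close>
      moreover have "bdd_above ((\<lambda>x. \<bar>pderivs is \<phi> x\<bar>) ` K)"
        using e that by (auto simp: L_def intro!: bdd_aboveI2)
      ultimately show "0 \<le> (SUP x\<in>K. \<bar>pderivs is \<phi> x\<bar>)"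
        using cSUP_upper[of x K "\<lambda>x. \<bar>pderivs is \<phi> x\<bar>"] order_trans[OF abs_ge_zero] by blast
      show "(SUP x\<in>K. \<bar>pderivs is \<phi> x\<bar>) \<le> e"
        using K e that by (intro cSUP_least) (auto simp: L_def)
    qed
    then have "0 \<le> (\<Sum>is\<in>L. SUP x\<in>K. \<bar>pderivs is \<phi> x\<bar>)"
      "(\<Sum>is\<in>L. SUP x\<in>K. \<bar>pderivs is \<phi> x\<bar>) \<le> card L * e"
      by (auto intro: sum_nonneg sum_bounded_above)
    \<comment> \<open>The constant in \<open>cdistr\<close> may be negative; passing to its absolute
      value is sound because the sum of suprema is nonnegative.\<close>
    then have "C * (\<Sum>is\<in>L. SUP x\<in>K. \<bar>pderivs is \<phi> x\<bar>) \<le> \<bar>C\<bar> * (card L * e)"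
      by (intro mult_mono) auto
    then show "\<bar>T \<phi>\<bar> \<le> \<bar>C\<bar> * card L * e"
      using C[OF \<phi>] by (simp add: L_def)
  qed (use K in auto)
qed

lemma cdistr_lincomb:
  "cdistr T \<Longrightarrow> smooth3_on UNIV f \<Longrightarrow> smooth3_on UNIV g \<Longrightarrow>
    T (\<lambda>x. a * f x + b * g x) = a * T f + b * T g"
  by (simp add: cdistr_def)

lemma cdistr_scale: "cdistr T \<Longrightarrow> smooth3_on UNIV f \<Longrightarrow> T (\<lambda>x. a * f x) = a * T f"
  using cdistr_lincomb[of T f f a 0] by simp

lemma cdistr_add:
  "cdistr T \<Longrightarrow> smooth3_on UNIV f \<Longrightarrow> smooth3_on UNIV g \<Longrightarrow> T (\<lambda>x. f x + g x) = T f + T g"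
  using cdistr_lincomb[of T f g 1 1] by simp

lemma cdistr_diff:
  "cdistr T \<Longrightarrow> smooth3_on UNIV f \<Longrightarrow> smooth3_on UNIV g \<Longrightarrow> T (\<lambda>x. f x - g x) = T f - T g"
  using cdistr_lincomb[of T f g 1 "-1"] by simp

lemma smooth3_const: "smooth3_on UNIV (\<lambda>_. c)"
  by (simp add: smooth3_iff smooth_family_const continuous_on_const)

lemma cdistr_zero: "cdistr T \<Longrightarrow> T (\<lambda>_. 0) = 0"
  using cdistr_scale[of T "\<lambda>_. 0" 0] by (simp add: smooth3_const)

lemma cdistr_sum:
  assumes "cdistr T" "\<And>i. i \<in> I \<Longrightarrow> smooth3_on UNIV (f i)"
  shows "T (\<lambda>x. \<Sum>i\<in>I. f i x) = (\<Sum>i\<in>I. T (f i))"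
  using assms(2)
proof (induction I rule: infinite_finite_induct)
  case (insert i I)
  have "smooth3_on UNIV (\<lambda>x. \<Sum>i\<in>I. f i x)"
    using insert by (auto simp: smooth3_iff intro!: smooth_family_intros)
  then show ?case using insert by (simp add: cdistr_add[OF assms(1)])
qed (simp_all add: cdistr_zero[OF assms(1)])

lemma pderivs_diff:
  assumes "smooth3_on UNIV f" "smooth3_on UNIV g"
  shows "pderivs is (\<lambda>x. f x - c * g x) = (\<lambda>x. pderivs is f x - c * pderivs is g x)"
proof (induction "is")
  case (Cons i "is")
  have "pderiv3 i (\<lambda>x. pderivs is f x - c * pderivs is g x) x = pderiv3 i (pderivs is f) x - c * pderiv3 i (pderivs is g) x" for x
  proof -
    have *: "(pderivs is f has_derivative (\<lambda>h. \<Sum>i\<in>UNIV. h $ i * pderiv3 i (pderivs is f) x)) (at x)"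
      "(pderivs is g has_derivative (\<lambda>h. \<Sum>i\<in>UNIV. h $ i * pderiv3 i (pderivs is g) x)) (at x)"
      using assms by (auto simp: smooth3_on_def intro!: pderiv3_has_derivative)
    have "pderiv3 i (\<lambda>x. pderivs is f x - c * pderivs is g x) x =
       (\<Sum>j\<in>UNIV. axis i 1 $ j * pderiv3 j (pderivs is f) x) - c * (\<Sum>j\<in>UNIV. axis i 1 $ j * pderiv3 j (pderivs is g) x)"
      by (rule pderiv3_eq) (intro derivative_intros *)
    then show ?thesis
      by (simp add: axis_def if_distrib[of "\<lambda>x. x * _"] cong: if_cong)
  qed
  then show ?case using Cons by auto
qed simp

text \<open>Tube lemma: joint continuity on \<open>Y\<close> times the compact \<open>K\<close>
  gives convergence that is uniform on \<open>K\<close>, and there are only finitely many index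
  lists of length at most \<open>N\<close>. This is exactly the smallness that
  \<open>cdistr_bound\<close> consumes.\<close>

lemma smooth_family_uniform:
  assumes "smooth_family Y f" "compact K" "y0 \<in> Y" "e > 0"
  shows "\<forall>\<^sub>F y in at y0 within Y. \<forall>is t. length is \<le> N \<longrightarrow> t \<in> K \<longrightarrow> \<bar>pderivs is (f y) t - pderivs is (f y0) t\<bar> \<le> e"
proof -
  have "\<forall>\<^sub>F y in at y0 within Y. \<forall>t\<in>K. \<bar>pderivs is (f y) t - pderivs is (f y0) t\<bar> \<le> e" for "is"
  proof -
    have "continuous_on (Y \<times> K) (\<lambda>(y, t). pderivs is (f y) t)"
      using smooth_familyD(2)[OF assms(1)] by (rule continuous_on_subset) auto
    then obtain X where "y0 \<in> X" "open X" "\<forall>x\<in>X \<inter> Y. \<forall>t\<in>K.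
        dist ((\<lambda>(y, t). pderivs is (f y) t) (x, t)) ((\<lambda>(y, t). pderivs is (f y) t) (y0, t)) \<le> e"
      by (rule continuous_on_prod_compactE[OF _ assms(2-4)])
    then show ?thesis
      by (auto simp: eventually_at_topological dist_real_def intro!: exI[of _ X])
  qed
  then have "\<forall>\<^sub>F y in at y0 within Y. \<forall>is\<in>{is :: 3 list. length is \<le> N}. \<forall>t\<in>K. \<bar>pderivs is (f y) t - pderivs is (f y0) t\<bar> \<le> e"
    using finite_lists_length_le[of "UNIV :: 3 set" N] by (intro eventually_ball_finite) auto
  then show ?thesis by (rule eventually_mono) auto
qed

lemma cdistr_family_continuous:
  assumes T: "cdistr T" and f: "smooth_family Y f"
  shows "continuous_on Y (\<lambda>y. T (f y))"
  unfolding continuous_on_def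
proof (intro ballI tendstoI)
  fix y0 and e :: real assume y0: "y0 \<in> Y" and e: "e > 0"
  obtain K C N where K: "compact K" "C \<ge> 0"
    "\<And>\<phi> e. smooth3_on UNIV \<phi> \<Longrightarrow> (\<And>is t. length is \<le> N \<Longrightarrow> t \<in> K \<Longrightarrow> \<bar>pderivs is \<phi> t\<bar> \<le> e) \<Longrightarrow> \<bar>T \<phi>\<bar> \<le> C * e"
    using cdistr_bound[OF T] by metis
  have s: "smooth3_on UNIV (f y)" if "y \<in> Y" for y using smooth_familyD(3)[OF f that] .
  \<comment> \<open>\<open>C\<close> may be 0, so the tolerance is divided by \<open>C + 1\<close>,
    which also makes the final inequality strict.\<close>
  have e': "e / (C + 1) > 0" using e K by simp
  have "\<forall>\<^sub>F y in at y0 within Y. y \<in> Y" by (simp add: eventually_at_filter)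
  with smooth_family_uniform[OF f K(1) y0 e', of N]
  show "\<forall>\<^sub>F y in at y0 within Y. dist (T (f y)) (T (f y0)) < e"
  proof eventually_elim
    case (elim y)
    have "smooth3_on UNIV (\<lambda>t. f y t - f y0 t)"
      using s[OF elim(2)] s[OF y0] by (auto simp: smooth3_iff intro!: smooth_family_intros)
    then have "\<bar>T (\<lambda>t. f y t - f y0 t)\<bar> \<le> C * (e / (C + 1))"
      using elim pderivs_diff[OF s[OF elim(2)] s[OF y0], of _ 1] by (intro K(3)) auto
    also have "\<dots> < e" using e K by (simp add: field_simps)
    finally show ?case
      by (simp add: cdistr_diff[OF T] s elim y0 dist_real_def)
  qed
qed

text \<open>The two differentiations are exchanged by way of an integral: \<open>F r - F a\<close>
  is the integral of \<open>f\<close> over the parameter, the Leibniz rule differentiates under it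
  in t, and the fundamental theorem differentiates the result in \<open>r\<close>. Nothing about
  mixed derivatives of \<open>F\<close> has to be known beforehand.\<close>

lemma smooth_family_pderiv3_parameter_derivative:
  fixes F f :: "real \<Rightarrow> real^3 \<Rightarrow> real"
  assumes F: "smooth_family {a..b} F" and f: "smooth_family {a..b} f"
    and deriv: "\<And>r t. r \<in> {a..b} \<Longrightarrow> ((\<lambda>r. F r t) has_real_derivative f r t) (at r within {a..b})"
    and r: "r \<in> {a..b}"
  shows "((\<lambda>r. pderiv3 i (F r) t) has_real_derivative pderiv3 i (f r) t) (at r within {a..b})"
proof -
  have cont: "continuous_on {a..b} (\<lambda>q. f q t)" for t
    using smooth_familyD(2)[OF f, of "[]"]
    by (auto intro!: continuous_on_compose2[of _ _ _ "\<lambda>q. (q, t)", where g = "\<lambda>(y, t). f y t", simplified] continuous_intros)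
  have cont1: "continuous_on ({a..b} \<times> UNIV) (\<lambda>(q, t). pderiv3 i (f q) t)"
    using smooth_familyD(2)[OF f, of "[i]"] by simp
  have *: "pderiv3 i (F r) t - pderiv3 i (F a) t = integral {a..r} (\<lambda>q. pderiv3 i (f q) t)" if r: "r \<in> {a..b}" for r
  proof -
    have "integral {a..r} (\<lambda>q. f q u) = F r u - F a u" for u
    proof (rule integral_unique, rule fundamental_theorem_of_calculus)
      show "((\<lambda>r. F r u) has_vector_derivative f q u) (at q within {a..r})" if "q \<in> {a..r}" for q
        unfolding has_real_derivative_iff_has_vector_derivative[symmetric]
        by (rule DERIV_subset[OF deriv]) (use r that in auto)
    qed (use r in auto)
    moreover have "((\<lambda>s. integral (cbox a r) (\<lambda>q. f q (t + s *\<^sub>R axis i 1))) has_field_derivative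
       integral (cbox a r) (\<lambda>q. pderiv3 i (f q) (t + 0 *\<^sub>R axis i 1))) (at 0 within UNIV)"
    proof (rule leibniz_rule_field_derivative)
      fix s :: real and q assume "q \<in> cbox a r"
      then show "((\<lambda>s. f q (t + s *\<^sub>R axis i 1)) has_field_derivative pderiv3 i (f q) (t + s *\<^sub>R axis i 1)) (at s within UNIV)"
        using smooth_familyD(1)[OF f, of q "[]"] r by (auto intro!: pderiv3_line)
    next
      fix s :: real
      show "(\<lambda>q. f q (t + s *\<^sub>R axis i 1)) integrable_on cbox a r"
        by (rule integrable_continuous) (use r in \<open>auto intro!: continuous_on_subset[OF cont]\<close>)
    next
      show "continuous_on (UNIV \<times> cbox a r) (\<lambda>(s, q). pderiv3 i (f q) (t + s *\<^sub>R axis i 1))"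
        using r by (auto simp: case_prod_beta intro!: continuous_intros
          continuous_on_compose2[OF cont1, where f = "\<lambda>p. (snd p, t + fst p *\<^sub>R axis i 1)", simplified])
    qed auto
    ultimately have "((\<lambda>s. F r (t + s *\<^sub>R axis i 1) - F a (t + s *\<^sub>R axis i 1)) has_field_derivative
       integral {a..r} (\<lambda>q. pderiv3 i (f q) t)) (at 0)" by simp
    moreover have "((\<lambda>s. F r (t + s *\<^sub>R axis i 1) - F a (t + s *\<^sub>R axis i 1)) has_field_derivative
       (pderiv3 i (F r) (t + 0 *\<^sub>R axis i 1) - pderiv3 i (F a) (t + 0 *\<^sub>R axis i 1))) (at 0)"
      using smooth_familyD(1)[OF F, of _ "[]"] r by (intro derivative_intros pderiv3_line) auto
    ultimately show ?thesis by (auto dest: DERIV_unique)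
  qed
  have "((\<lambda>r. pderiv3 i (F a) t + integral {a..r} (\<lambda>q. pderiv3 i (f q) t)) has_real_derivative 0 + pderiv3 i (f r) t) (at r within {a..b})"
    by (intro derivative_intros integral_has_real_derivative r)
       (auto intro!: continuous_on_compose2[OF cont1, where f = "\<lambda>p. (p, t)", simplified] continuous_intros)
  then have "((\<lambda>r. pderiv3 i (F a) t + integral {a..r} (\<lambda>q. pderiv3 i (f q) t)) has_real_derivative pderiv3 i (f r) t) (at r within {a..b})"
    by simp
  then show ?thesis
    by (rule has_field_derivative_transform_within[where d = 1]) (use r in \<open>auto simp flip: *\<close>)
qed

lemma smooth_family_pderivs_parameter_derivative:
  fixes F f :: "real \<Rightarrow> real^3 \<Rightarrow> real"
  assumes F: "smooth_family {a..b} F" and f: "smooth_family {a..b} f"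
    and deriv: "\<And>r t. r \<in> {a..b} \<Longrightarrow> ((\<lambda>r. F r t) has_real_derivative f r t) (at r within {a..b})"
  shows "r \<in> {a..b} \<Longrightarrow> ((\<lambda>r. pderivs is (F r) t) has_real_derivative pderivs is (f r) t) (at r within {a..b})"
proof (induction "is" arbitrary: r t)
  case (Cons i "is")
  show ?case
    using smooth_family_pderiv3_parameter_derivative[OF smooth_family_pderivs[OF F] smooth_family_pderivs[OF f] Cons.IH Cons.prems]
    by simp
qed (use deriv in simp)

text \<open>The first order remainder of \<open>F\<close> at \<open>r\<close> is small relative to
  the increment together with all its t-derivatives up to order \<open>N\<close>, uniformly on
  \<open>K\<close>; the bound of the distribution then makes the remainder of \<open>T (F r)\<close>
  small as well.\<close>

lemma cdistr_parameter_derivative: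
  fixes F f :: "real \<Rightarrow> real^3 \<Rightarrow> real"
  assumes T: "cdistr T"
    and F: "smooth_family {a..b} F" and f: "smooth_family {a..b} f"
    and deriv: "\<And>r t. r \<in> {a..b} \<Longrightarrow> ((\<lambda>r. F r t) has_real_derivative f r t) (at r within {a..b})"
    and r: "r \<in> {a..b}"
  shows "((\<lambda>r. T (F r)) has_real_derivative T (f r)) (at r within {a..b})"
  unfolding has_field_derivative_def has_derivative_within_alt
proof (intro conjI allI impI)
  obtain K C N where K: "compact K" "C \<ge> 0"
    "\<And>\<phi> e. smooth3_on UNIV \<phi> \<Longrightarrow> (\<And>is t. length is \<le> N \<Longrightarrow> t \<in> K \<Longrightarrow> \<bar>pderivs is \<phi> t\<bar> \<le> e) \<Longrightarrow> \<bar>T \<phi>\<bar> \<le> C * e"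
    using cdistr_bound[OF T] by metis
  fix e :: real assume e: "e > 0"
  have e': "e / (C + 1) > 0" using e K by simp
  obtain d where d: "d > 0" "\<And>q is t. q \<in> {a..b} \<Longrightarrow> \<bar>q - r\<bar> < d \<Longrightarrow> length is \<le> N \<Longrightarrow> t \<in> K \<Longrightarrow>
      \<bar>pderivs is (f q) t - pderivs is (f r) t\<bar> \<le> e / (C + 1)"
    using smooth_family_uniform[OF f K(1) r e', of N] e'
    unfolding eventually_at dist_real_def by (metis abs_zero diff_self less_eq_real_def)
  have sF: "smooth3_on UNIV (F q)" and sf: "smooth3_on UNIV (f q)" if "q \<in> {a..b}" for q
    using smooth_familyD(3)[OF F that] smooth_familyD(3)[OF f that] by auto
  show "\<exists>d>0. \<forall>y\<in>{a..b}. norm (y - r) < d \<longrightarrow> norm (T (F y) - T (F r) - T (f r) * (y - r)) \<le> e * norm (y - r)"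
  proof (intro exI[of _ d] conjI ballI impI)
    fix y assume y: "y \<in> {a..b}" "norm (y - r) < d"
    let ?g = "\<lambda>t. F y t - F r t - (y - r) * f r t"
    have s: "smooth3_on UNIV (\<lambda>t. F y t - F r t)"
      using sF[OF y(1)] sF[OF r] by (auto simp: smooth3_iff intro!: smooth_family_intros)
    then have "smooth3_on UNIV ?g"
      using sf[OF r] by (auto simp: smooth3_iff intro!: smooth_family_intros continuous_on_const)
    moreover have "\<bar>pderivs is ?g t\<bar> \<le> e / (C + 1) * \<bar>y - r\<bar>" if "length is \<le> N" "t \<in> K" for "is" t
    proof -
      let ?S = "{a..b} \<inter> ball r d"
      \<comment> \<open>The derivative of \<open>?g\<close> is the increment of \<open>?h\<close>
        between \<open>r\<close> and \<open>y\<close>. By the mean value inequality on the convex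
        set \<open>?S\<close> it suffices that the parameter derivative of \<open>?h\<close>, a
        difference of values of \<open>f\<close>, is small there.\<close>
      let ?h = "\<lambda>q. pderivs is (F q) t - q * pderivs is (f r) t"
      have "norm (?h y - ?h r) \<le> e / (C + 1) * norm (y - r)"
      proof (rule field_differentiable_bound[where S = ?S and f' = "\<lambda>q. pderivs is (f q) t - pderivs is (f r) t"])
        fix q assume q: "q \<in> ?S"
        have "((\<lambda>q. pderivs is (F q) t) has_real_derivative pderivs is (f q) t) (at q within ?S)"
          by (rule DERIV_subset[OF smooth_family_pderivs_parameter_derivative[OF F f deriv]]) (use q in auto)
        then show "(?h has_field_derivative pderivs is (f q) t - pderivs is (f r) t) (at q within ?S)"
          by (auto intro!: derivative_eq_intros)
        show "norm (pderivs is (f q) t - pderivs is (f r) t) \<le> e / (C + 1)"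
          using q d(2)[of q "is" t] that by (auto simp: dist_real_def abs_minus_commute)
      qed (use y r d in \<open>auto simp: dist_real_def abs_minus_commute intro!: convex_Int\<close>)
      moreover have "pderivs is ?g t = ?h y - ?h r"
        using pderivs_diff[OF s sf[OF r], of "is" "y - r"] pderivs_diff[OF sF[OF y(1)] sF[OF r], of "is" 1]
        by (simp add: algebra_simps)
      ultimately show ?thesis by simp
    qed
    ultimately have "\<bar>T ?g\<bar> \<le> C * (e / (C + 1) * \<bar>y - r\<bar>)" by (rule K(3))
    also have "\<dots> = C / (C + 1) * (e * \<bar>y - r\<bar>)" by simp
    also have "\<dots> \<le> 1 * (e * \<bar>y - r\<bar>)" by (rule mult_right_mono) (use e K in auto)
    finally have "\<bar>T ?g\<bar> \<le> e * \<bar>y - r\<bar>" by simp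
    moreover have "T ?g = 1 * T (\<lambda>t. F y t - F r t) + (- (y - r)) * T (f r)"
      using cdistr_lincomb[OF T s sf[OF r], of 1 "- (y - r)"] by (simp add: algebra_simps)
    ultimately show "norm (T (F y) - T (F r) - T (f r) * (y - r)) \<le> e * norm (y - r)"
      by (simp add: cdistr_diff[OF T sF[OF y(1)] sF[OF r]] algebra_simps)
  qed (use d in auto)
qed (rule bounded_linear_mult_right)

text \<open>Smooth interpolation by the step \<open>s\<close>, which is 0 for u at most d/2 and 1
  from d on: the value is 1 on the first range, u on the last, and a convex combination of two
  positive numbers in between.\<close>

definition cutoff :: "real \<Rightarrow> real \<Rightarrow> real" where
  "cutoff d u = (let s = flat 0 (u - d / 2) / (flat 0 (u - d / 2) + flat 0 (d - u)) in u * s + (1 - s))"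

lemma cutoff_denominator_pos: "d > 0 \<Longrightarrow> flat 0 (u - d / 2) + flat 0 (d - u) > 0"
  using flat_nonneg[of 0] flat_0_pos_iff[of "u - d / 2"] flat_0_pos_iff[of "d - u"]
  by (cases "u > d / 2") (auto intro: add_pos_nonneg add_nonneg_pos)

lemma cutoff_eq: "d > 0 \<Longrightarrow> u \<ge> d \<Longrightarrow> cutoff d u = u"
  using flat_0_pos_iff[of "u - d / 2"] by (simp add: cutoff_def Let_def flat_def)

lemma cutoff_pos: assumes "d > 0" shows "cutoff d u > 0"
proof (cases "u > d / 2")
  case True
  define s where "s = flat 0 (u - d / 2) / (flat 0 (u - d / 2) + flat 0 (d - u))"
  have "0 < s" "s \<le> 1"
    using True cutoff_denominator_pos[OF assms, of u] flat_nonneg[of 0 "d - u"]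
      flat_0_pos_iff[of "u - d / 2"] by (auto simp: s_def)
  then have "u * s + (1 - s) > 0"
    using True assms by (intro add_pos_nonneg) auto
  then show ?thesis by (simp add: cutoff_def s_def Let_def)
qed (simp add: cutoff_def flat_def)

lemma smooth_family_cutoff:
  assumes "d > 0" "smooth_family Y f"
  shows "smooth_family Y (\<lambda>y t. cutoff d (f y t))"
  unfolding cutoff_def Let_def using cutoff_denominator_pos[OF assms(1)]
  by (intro smooth_family_intros continuous_on_const assms) (simp_all add: less_imp_neq[symmetric])

section \<open>Pairings depend only on the values near the support\<close>

lemma cdistr_eq_0_locally:
  assumes T: "cdistr T"
  obtains K where "compact K" "dsupp T \<subseteq> K"
    "\<And>\<phi> U. smooth3_on UNIV \<phi> \<Longrightarrow> open U \<Longrightarrow> K \<subseteq> U \<Longrightarrow> (\<And>t. t \<in> U \<Longrightarrow> \<phi> t = 0) \<Longrightarrow> T \<phi> = 0"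
proof -
  obtain K C N where K: "compact K" "C \<ge> 0"
    "\<And>\<phi> e. smooth3_on UNIV \<phi> \<Longrightarrow> (\<And>is t. length is \<le> N \<Longrightarrow> t \<in> K \<Longrightarrow> \<bar>pderivs is \<phi> t\<bar> \<le> e) \<Longrightarrow> \<bar>T \<phi>\<bar> \<le> C * e"
    using cdistr_bound[OF T] by metis
  have 0: "T \<phi> = 0" if "smooth3_on UNIV \<phi>" "open U" "K \<subseteq> U" "\<And>t. t \<in> U \<Longrightarrow> \<phi> t = 0" for \<phi> U
  proof -
    have "pderivs is (\<lambda>t. 0) = (\<lambda>t. 0)" for "is"
      by (induction "is") (auto simp: pderiv3_def)
    then have "pderivs is \<phi> t = 0" if "t \<in> K" for "is" t
      using pderivs_cong_open[OF \<open>open U\<close>, of \<phi> "\<lambda>_. 0" t "is"] \<open>K \<subseteq> U\<close> that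
        \<open>\<And>t. t \<in> U \<Longrightarrow> \<phi> t = 0\<close> by auto
    then have "\<bar>T \<phi>\<bar> \<le> C * 0"
      using that(1) by (intro K(3)) auto
    then show ?thesis by simp
  qed
  moreover have "dsupp T \<subseteq> K"
  proof -
    \<comment> \<open>The complement of the closed support of such a function is an open
      neighbourhood of \<open>K\<close> on which it vanishes.\<close>
    have "T \<phi> = 0" if "smooth3_on UNIV \<phi>" "closure {x. \<phi> x \<noteq> 0} \<subseteq> - K" for \<phi>
      using that closure_subset[of "{x. \<phi> x \<noteq> 0}"] by (intro 0[of _ "- closure {x. \<phi> x \<noteq> 0}"]) auto
    then have "- K \<subseteq> - dsupp T"
      unfolding dsupp_def using K(1) by (intro subsetI) (auto intro!: exI[of _ "- K"] simp: compact_imp_closed)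
    then show ?thesis by auto
  qed
  ultimately show ?thesis using K(1) that by blast
qed

lemma compact_dsupp: assumes "cdistr T" shows "compact (dsupp T)"
proof -
  obtain K where "compact K" "dsupp T \<subseteq> K" using cdistr_eq_0_locally[OF assms] by metis
  moreover have "closed (dsupp T)" unfolding dsupp_def by (auto intro!: closed_Compl open_Union)
  ultimately show ?thesis by (metis compact_Int_closed inf.absorb_iff2 inf_commute)
qed

text \<open>A smooth partition of the part of the compact carrier off the open set \<open>U\<close> splits
  a function vanishing on \<open>U\<close> into test functions supported off the support.\<close>

lemma cdistr_eq_0_near_dsupp:
  assumes T: "cdistr T" and \<phi>: "smooth3_on UNIV \<phi>"
    and U: "open U" "dsupp T \<subseteq> U" "\<And>t. t \<in> U \<Longrightarrow> \<phi> t = 0"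
  shows "T \<phi> = 0"
proof -
  obtain K where K: "compact K"
    "\<And>\<phi> U. smooth3_on UNIV \<phi> \<Longrightarrow> open U \<Longrightarrow> K \<subseteq> U \<Longrightarrow> (\<And>t. t \<in> U \<Longrightarrow> \<phi> t = 0) \<Longrightarrow> T \<phi> = 0"
    using cdistr_eq_0_locally[OF T] by metis
  have cL: "compact (K - U)" using K(1) U(1) by (rule compact_diff)
  have "\<exists>r>0. \<forall>\<psi>. smooth3_on UNIV \<psi> \<longrightarrow> {t. \<psi> t \<noteq> 0} \<subseteq> cball c r \<longrightarrow> T \<psi> = 0" if c: "c \<in> K - U" for c
  proof -
    \<comment> \<open>The open set found around \<open>c\<close> annihilates only test functions
      with compact support inside it. Shrinking it to a closed ball makes compactness follow from
      boundedness.\<close>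
    have "c \<notin> dsupp T" using c U(2) by auto
    then obtain V where V: "open V" "c \<in> V"
      "\<And>\<psi>. smooth3_on UNIV \<psi> \<Longrightarrow> compact (closure {x. \<psi> x \<noteq> 0}) \<Longrightarrow> closure {x. \<psi> x \<noteq> 0} \<subseteq> V \<Longrightarrow> T \<psi> = 0"
      unfolding dsupp_def by blast
    obtain r where r: "r > 0" "cball c r \<subseteq> V" using V open_contains_cball by blast
    have "T \<psi> = 0" if \<psi>: "smooth3_on UNIV \<psi>" "{t. \<psi> t \<noteq> 0} \<subseteq> cball c r" for \<psi>
    proof -
      have "closure {t. \<psi> t \<noteq> 0} \<subseteq> cball c r" using \<psi>(2) by (intro closure_minimal) auto
      then show ?thesis
        using r by (intro V(3) \<psi>(1)) (auto intro: compact_closure[THEN iffD2] bounded_subset[OF bounded_cball \<psi>(2)])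
    qed
    then show ?thesis using r(1) by auto
  qed
  then obtain r where r: "\<And>c. c \<in> K - U \<Longrightarrow> r c > 0"
    "\<And>c \<psi>. c \<in> K - U \<Longrightarrow> smooth3_on UNIV \<psi> \<Longrightarrow> {t. \<psi> t \<noteq> 0} \<subseteq> cball c (r c) \<Longrightarrow> T \<psi> = 0" by metis
  have "K - U \<subseteq> (\<Union>c\<in>K - U. ball c (r c))" using r(1) by force
  then obtain P where P: "P \<subseteq> K - U" "finite P" "K - U \<subseteq> (\<Union>c\<in>P. ball c (r c))"
    using compactE_image[OF cL, of "K - U" "\<lambda>c. ball c (r c)"] by auto
  \<comment> \<open>A smooth bump that is positive exactly on the open ball around \<open>c\<close>,
    since \<open>flat 0\<close> is positive exactly at positive arguments.\<close>
  define \<beta> where "\<beta> c t = flat 0 ((r c)\<^sup>2 - (\<Sum>i\<in>UNIV. (t $ i - c $ i)\<^sup>2))" for c t :: "real^3"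
  have \<beta>_pos: "\<beta> c t > 0 \<longleftrightarrow> t \<in> ball c (r c)" if "c \<in> P" for c t
  proof -
    have "(\<Sum>i\<in>UNIV. (t $ i - c $ i)\<^sup>2) = (dist c t)\<^sup>2"
      by (simp add: dist_norm[of c t] norm_vec_def power2_commute L2_set_def sum_nonneg)
    moreover have "r c > 0" using that P(1) r(1) by auto
    ultimately show ?thesis
      using power2_less_imp_less[of "dist c t" "r c"] power_strict_mono[of "dist c t" "r c" 2]
      by (auto simp: \<beta>_def)
  qed
  have \<beta>_nonneg: "\<beta> c t \<ge> 0" for c t by (simp add: \<beta>_def flat_nonneg)
  define B where "B t = (\<Sum>c\<in>P. \<beta> c t)" for t
  have s\<beta>: "smooth_family Y (\<lambda>_. \<beta> c)" for c and Y :: "real set"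
    unfolding \<beta>_def by (intro smooth_family_intros continuous_on_const)
  have sB: "smooth_family Y (\<lambda>_. B)" for Y :: "real set"
    unfolding B_def by (intro smooth_family_intros s\<beta>)
  have cB: "continuous_on X B" for X
    using smooth3_continuous[of B "[]"] sB[of "{0}"] by (auto simp: smooth3_iff intro: continuous_on_subset)
  have B_pos: "B t > 0" if "t \<in> K - U" for t
  proof -
    obtain c where "c \<in> P" "t \<in> ball c (r c)" using P(3) \<open>t \<in> K - U\<close> by blast
    then have "c \<in> P" "\<beta> c t > 0" using \<beta>_pos by auto
    then show ?thesis unfolding B_def using P(2) \<beta>_nonneg by (intro sum_pos2) auto
  qed
  obtain \<epsilon> where \<epsilon>: "\<epsilon> > 0" "\<And>t. t \<in> K - U \<Longrightarrow> B t > \<epsilon>"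
  proof (cases "K - U = {}")
    case False
    obtain m where "m \<in> K - U" "\<And>t. t \<in> K - U \<Longrightarrow> B m \<le> B t"
      using continuous_attains_inf[OF cL False cB] by auto
    then show ?thesis using that[of "B m / 2"] B_pos by force
  qed (use that[of 1] in auto)
  \<comment> \<open>Normalising by \<open>B\<close> itself would divide by 0 where no bump is
    active. \<open>cutoff\<close> keeps the denominator positive and agrees with \<open>B\<close>
    wherever \<open>B\<close> is at least \<epsilon>, in particular near the part of
    \<open>K\<close> outside \<open>U\<close>.\<close>
  define \<psi> where "\<psi> c t = \<phi> t * \<beta> c t * inverse (cutoff \<epsilon> (B t))" for c t
  have s\<psi>: "smooth3_on UNIV (\<psi> c)" for c
    unfolding smooth3_iff \<psi>_def using cutoff_pos[OF \<epsilon>(1)]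
    by (intro smooth_family_intros s\<beta> sB smooth_family_smooth3[OF \<phi>] smooth_family_cutoff \<epsilon>(1))
       (simp add: less_imp_neq[symmetric])
  have "T (\<psi> c) = 0" if "c \<in> P" for c
  proof (rule r(2)[OF _ s\<psi>])
    show "c \<in> K - U" using that P(1) by auto
    show "{t. \<psi> c t \<noteq> 0} \<subseteq> cball c (r c)"
    proof
      fix t assume "t \<in> {t. \<psi> c t \<noteq> 0}"
      then have "\<beta> c t \<noteq> 0" by (auto simp: \<psi>_def)
      then have "t \<in> ball c (r c)" using \<beta>_pos[OF that, of t] \<beta>_nonneg[of c t] by linarith
      then show "t \<in> cball c (r c)" by simp
    qed
  qed
  then have "T (\<lambda>t. \<Sum>c\<in>P. \<psi> c t) = 0"
    by (simp add: cdistr_sum[OF T s\<psi>])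
  moreover have s: "smooth3_on UNIV (\<lambda>t. \<Sum>c\<in>P. \<psi> c t)"
    using s\<psi> by (auto simp: smooth3_iff intro!: smooth_family_intros)
  moreover have "T (\<lambda>t. \<phi> t - (\<Sum>c\<in>P. \<psi> c t)) = 0"
  proof (rule K(2))
    show "smooth3_on UNIV (\<lambda>t. \<phi> t - (\<Sum>c\<in>P. \<psi> c t))"
      using s \<phi> by (auto simp: smooth3_iff intro!: smooth_family_intros)
    \<comment> \<open>On \<open>U\<close> the function and all its pieces vanish; where
      \<open>B\<close> exceeds \<epsilon> the pieces add up to the function. Together these two open
      sets cover \<open>K\<close>.\<close>
    show "open (U \<union> B -` {\<epsilon><..})"
      using U(1) cB by (auto intro!: open_Un open_vimage)
    show "K \<subseteq> U \<union> B -` {\<epsilon><..}" using \<epsilon>(2) by auto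
    show "\<phi> t - (\<Sum>c\<in>P. \<psi> c t) = 0" if t: "t \<in> U \<union> B -` {\<epsilon><..}" for t
    proof -
      have "(\<Sum>c\<in>P. \<psi> c t) = \<phi> t * B t * inverse (cutoff \<epsilon> (B t))"
        by (simp add: \<psi>_def B_def sum_distrib_left sum_distrib_right)
      then show ?thesis
        using t U(3)[of t] \<epsilon>(1) cutoff_eq[OF \<epsilon>(1), of "B t"] by (cases "t \<in> U") auto
    qed
  qed
  ultimately show ?thesis using cdistr_diff[OF T \<phi> s] by simp
qed

lemma cdistr_cong_near_dsupp:
  assumes T: "cdistr T" and "smooth3_on UNIV f" "smooth3_on UNIV g"
    and "open U" "dsupp T \<subseteq> U" "\<And>t. t \<in> U \<Longrightarrow> f t = g t"
  shows "T f = T g"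
proof -
  have "smooth3_on UNIV (\<lambda>t. f t - g t)"
    using assms by (auto simp: smooth3_iff intro!: smooth_family_intros)
  then have "T (\<lambda>t. f t - g t) = 0"
    by (rule cdistr_eq_0_near_dsupp[OF T _ assms(4,5)]) (simp add: assms)
  then show ?thesis using cdistr_diff[OF T assms(2,3)] by simp
qed

text \<open>Makes the choice in \<open>dpair\<close> harmless: the chosen extension and
  \<open>g\<close> both agree with \<open>f\<close> near the support, hence with each other on the
  intersection of the two neighbourhoods.\<close>

lemma dpair_eq:
  assumes T: "cdistr T" and g: "smooth3_on UNIV g"
    and U: "open U" "dsupp T \<subseteq> U" "\<And>t. t \<in> U \<Longrightarrow> g t = f t"
  shows "dpair T f = T g"
proof -
  let ?P = "\<lambda>g. smooth3_on UNIV g \<and> (\<exists>U. open U \<and> dsupp T \<subseteq> U \<and> (\<forall>x\<in>U. g x = f x))"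
  have "?P (SOME g. ?P g)" by (rule someI[of ?P g]) (use g U in auto)
  then obtain V where V: "smooth3_on UNIV (SOME g. ?P g)" "open V" "dsupp T \<subseteq> V" "\<forall>x\<in>V. (SOME g. ?P g) x = f x"
    by auto
  have "T (SOME g. ?P g) = T g"
    by (rule cdistr_cong_near_dsupp[OF T V(1) g, of "U \<inter> V"]) (use U V in auto)
  then show ?thesis by (simp add: dpair_def)
qed

section \<open>Polar coordinates\<close>

text \<open>The axis \<open>j\<close> is the polar axis, so that the cosine belongs to
  \<open>x $ j\<close> for either \<open>j\<close> and both horizontal components are treated at
  once. Addition in the type \<open>2\<close> is modulo 2, so \<open>j + 1\<close> is the other
  index.\<close>

definition polar :: "2 \<Rightarrow> real \<Rightarrow> real \<Rightarrow> real^2" where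
  "polar j r \<theta> = (\<chi> k. if k = j then r * cos \<theta> else r * sin \<theta>)"

lemma num2_cases: "(k :: 2) = j \<or> k = j + 1"
  using exhaust_2[of k] exhaust_2[of j] by auto

lemma num2_neq [simp]: "(j :: 2) + 1 \<noteq> j" "j \<noteq> j + 1"
  using exhaust_2[of j] by auto

lemma sum_num2: "(\<Sum>k\<in>UNIV. f k) = f (j :: 2) + f (j + 1)"
proof -
  have "(\<Sum>k\<in>UNIV. f k) = (\<Sum>k\<in>{j, j + 1}. f k)"
    using num2_cases[of _ j] by (intro sum.cong) auto
  also have "\<dots> = f j + f (j + 1)" using num2_neq(2)[of j] by (subst sum.insert) (auto simp del: num2_neq)
  finally show ?thesis .
qed

lemma polar_nth [simp]: "polar j r \<theta> $ j = r * cos \<theta>" "polar j r \<theta> $ (j + 1) = r * sin \<theta>"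
  by (simp_all add: polar_def)

lemma polar_eqI: "x $ j = r * cos \<theta> \<Longrightarrow> x $ (j + 1) = r * sin \<theta> \<Longrightarrow> x = polar j r \<theta>"
  unfolding vec_eq_iff
proof
  fix k assume "x $ j = r * cos \<theta>" "x $ (j + 1) = r * sin \<theta>"
  then show "x $ k = polar j r \<theta> $ k" using num2_cases[of k j] by auto
qed

lemma norm_polar: "norm (polar j r \<theta>) = \<bar>r\<bar>"
  using sin_cos_squared_add[of \<theta>]
  by (simp add: norm_vec_def L2_set_def sum_num2[of _ j] power_mult_distrib flip: distrib_left)

lemma continuous_on_polar [continuous_intros]:
  fixes S :: "'a::t2_space set"
  shows "continuous_on S f \<Longrightarrow> continuous_on S g \<Longrightarrow> continuous_on S (\<lambda>x. polar j (f x) (g x))"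
  unfolding polar_def
proof (rule continuous_on_vec_lambda)
  fix k assume "continuous_on S f" "continuous_on S g"
  then show "continuous_on S (\<lambda>x. if k = j then f x * cos (g x) else f x * sin (g x))"
    by (cases "k = j") (auto intro!: continuous_intros)
qed

lemma has_derivative_polar:
  "((\<lambda>y. polar j (y $ 1) (y $ 2)) has_derivative
    (\<lambda>h. \<chi> k. if k = j then h $ 1 * cos (y $ 2) - y $ 1 * sin (y $ 2) * h $ 2
                else h $ 1 * sin (y $ 2) + y $ 1 * cos (y $ 2) * h $ 2)) (at (y :: real^2) within S)"
  unfolding has_derivative_componentwise_within[of "\<lambda>y. polar j (y $ 1) (y $ 2)"]
proof
  fix b :: "real^2" assume "b \<in> Basis"
  then obtain k where b: "b = axis k 1" by (auto simp: Basis_vec_def)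
  have *: "((\<lambda>y::real^2. y $ i) has_derivative (\<lambda>h. h $ i)) (at y within S)" for i
    by (intro bounded_linear_imp_has_derivative bounded_linear_vec_nth)
  have "((\<lambda>y. if k = j then y $ 1 * cos (y $ 2) else y $ 1 * sin (y $ 2)) has_derivative
      (\<lambda>h. if k = j then h $ 1 * cos (y $ 2) - y $ 1 * sin (y $ 2) * h $ 2
            else h $ 1 * sin (y $ 2) + y $ 1 * cos (y $ 2) * h $ 2)) (at y within S)"
    by (cases "k = j") (auto intro!: derivative_eq_intros * simp: algebra_simps)
  then show "((\<lambda>y. polar j (y $ 1) (y $ 2) \<bullet> b) has_derivative
      (\<lambda>h. (\<chi> k. if k = j then h $ 1 * cos (y $ 2) - y $ 1 * sin (y $ 2) * h $ 2
                else h $ 1 * sin (y $ 2) + y $ 1 * cos (y $ 2) * h $ 2) \<bullet> b)) (at y within S)"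
    by (simp add: b inner_axis polar_def)
qed

text \<open>For \<open>j = 2\<close> the components come in the opposite order and the determinant
  is - r; the absolute value covers both orientations.\<close>

lemma abs_det_polar:
  "\<bar>det (matrix (\<lambda>h::real^2. (\<chi> k. if k = j then h $ 1 * cos t - r * sin t * h $ 2
                else h $ 1 * sin t + r * cos t * h $ 2) :: real^2))\<bar> = \<bar>r\<bar>"
proof -
  have "r * (cos t * cos t) + r * (sin t * sin t) = r"
    using sin_cos_squared_add[of t] by (simp add: power2_eq_square flip: distrib_left)
  then show ?thesis
    using exhaust_2[of j] by (auto simp: det_2 matrix_def axis_def algebra_simps)
qed

text \<open>The bijection between pairs and two-component vectors maps boxes to boxes of the same
  content, so it carries the iterated integral for pairs over to vectors with scaling factor
  1.\<close>

lemma integral_cbox_cart2: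
  fixes f :: "real^2 \<Rightarrow> real"
  assumes f: "continuous_on (cbox (vector [a, c]) (vector [b, d])) f"
  shows "integral (cbox (vector [a, c]) (vector [b, d])) f =
    integral {a..b} (\<lambda>r. integral {c..d} (\<lambda>\<theta>. f (vector [r, \<theta>])))"
proof -
  define g where "g p = (vector [fst p, snd p] :: real^2)" for p :: "real \<times> real"
  define k where "k y = (y $ 1, y $ 2)" for y :: "real^2"
  have kg: "k (g p) = p" and gk: "g (k y) = y" for p y
    by (auto simp: g_def k_def vec_eq_iff forall_2)
  have g_cbox: "g ` cbox u v = cbox (g u) (g v)" for u v
  proof -
    have "y \<in> g ` cbox u v \<longleftrightarrow> k y \<in> cbox u v" for y using kg gk by (metis image_iff)
    then show ?thesis
      by (cases u; cases v) (auto simp: mem_box_cart forall_2 g_def k_def cbox_Pair_eq)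
  qed
  have k_cbox: "k ` cbox u v = cbox (k u) (k v)" for u v
    using g_cbox[of "k u" "k v"] by (metis (no_types, lifting) gk kg image_image image_ident image_cong)
  have cg: "continuous (at p) g" for p
  proof -
    have "continuous_on UNIV (\<lambda>p. g p $ i)" for i
    proof -
      have eq: "(\<lambda>p. g p $ i) = (if i = 1 then (\<lambda>p. fst p) else (\<lambda>p. snd p))"
        using exhaust_2[of i] by (auto simp: g_def)
      show ?thesis unfolding eq by (cases "i = 1") (simp_all add: continuous_on_fst continuous_on_snd continuous_on_id)
    qed
    then have "continuous_on UNIV (\<lambda>p. \<chi> i. g p $ i)"
      by (intro continuous_on_vec_lambda)
    then show ?thesis by (cases p) (simp add: continuous_on_eq_continuous_at)
  qed
  have content: "measure lborel (g ` cbox u v) = 1 * measure lborel (cbox u v)" for u v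
  proof -
    obtain u1 u2 v1 v2 where uv: "u = (u1, u2)" "v = (v1, v2)" by (cases u; cases v)
    have "cbox (g u) (g v) = {} \<longleftrightarrow> \<not> (u1 \<le> v1 \<and> u2 \<le> v2)"
      using interval_ne_empty_cart(1)[of "g u" "g v"] by (auto simp: uv g_def forall_2)
    then show ?thesis
      unfolding g_cbox by (auto simp: uv content_Pair content_cbox_if_cart UNIV_2) (simp_all add: g_def)
  qed
  have "(f has_integral integral (cbox (vector [a, c]) (vector [b, d])) f) (cbox (g (a, c)) (g (b, d)))"
    using f by (simp add: g_def integrable_integral integrable_continuous)
  then have "((\<lambda>p. f (g p)) has_integral (1 / 1) *\<^sub>R integral (cbox (vector [a, c]) (vector [b, d])) f) (k ` cbox (g (a, c)) (g (b, d)))"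
    by (intro has_integral_twiddle[of 1 k g] kg gk cg content) (auto simp only: g_cbox k_cbox zero_less_one)
  then have "((\<lambda>p. f (g p)) has_integral integral (cbox (vector [a, c]) (vector [b, d])) f) (cbox (a, c) (b, d))"
    by (simp add: k_cbox kg)
  then have "integral (cbox (vector [a, c]) (vector [b, d])) f = integral (cbox (a, c) (b, d)) (\<lambda>p. f (g p))"
    by (intro integral_unique[symmetric])
  also have "\<dots> = integral (cbox a b) (\<lambda>x. integral (cbox c d) (\<lambda>y. f (g (x, y))))"
  proof (intro integral_prod_continuous continuous_on_compose2[OF f] continuous_at_imp_continuous_on ballI cg)
    show "g ` cbox (a, c) (b, d) \<subseteq> cbox (vector [a, c]) (vector [b, d])"
      by (simp add: g_cbox) (simp add: g_def)
  qed
  finally show ?thesis by (simp add: g_def)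
qed

lemma integral_ball_polar:
  fixes f :: "real^2 \<Rightarrow> real"
  assumes f: "continuous_on UNIV f" and A: "A > 0"
  shows "integral (ball 0 A) f = integral {0..A} (\<lambda>r. integral {0..2 * pi} (\<lambda>\<theta>. r * f (polar j r \<theta>)))"
proof -
  define g where "g y = polar j (y $ 1) (y $ 2)" for y :: "real^2"
  define g' where "g' y = (\<lambda>h::real^2. (\<chi> k. if k = j then h $ 1 * cos (y $ 2) - y $ 1 * sin (y $ 2) * h $ 2
                else h $ 1 * sin (y $ 2) + y $ 1 * cos (y $ 2) * h $ 2) :: real^2)" for y :: "real^2"
  define S where "S = box (vector [0, 0] :: real^2) (vector [A, 2 * pi])"
  have S: "y \<in> S \<longleftrightarrow> 0 < y $ 1 \<and> y $ 1 < A \<and> 0 < y $ 2 \<and> y $ 2 < 2 * pi" for y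
    by (auto simp: S_def mem_box_cart forall_2)
  have inj: "inj_on g S"
  proof (rule inj_onI)
    fix x y assume x: "x \<in> S" and y: "y \<in> S" and eq: "g x = g y"
    have r: "x $ 1 = y $ 1"
      using arg_cong[OF eq, of norm] x y by (simp add: g_def norm_polar S)
    then have "cos (x $ 2) = cos (y $ 2)" "sin (x $ 2) = sin (y $ 2)"
      using arg_cong[OF eq, of "\<lambda>v. v $ j"] arg_cong[OF eq, of "\<lambda>v. v $ (j + 1)"] x y
      by (auto simp: g_def S)
    then obtain n :: int where n: "x $ 2 = y $ 2 + 2 * pi * n"
      using sin_cos_eq_iff[of "x $ 2" "y $ 2"] by auto
    then have "\<bar>2 * pi * n\<bar> < 2 * pi * 1" using x y by (auto simp: S)
    then have "\<bar>real_of_int n\<bar> < 1" by (simp add: abs_mult)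
    then have "n = 0" by linarith
    then show "x = y" using n r by (simp add: vec_eq_iff forall_2)
  qed
  have sub: "g ` S \<subseteq> ball 0 A"
    by (auto simp: g_def norm_polar S)
  \<comment> \<open>The open parameter rectangle misses only the centre and the ray \<theta> = 0.
    Discarding the whole line containing them is simpler and still negligible.\<close>
  have sup: "x \<in> g ` S" if x: "x \<in> ball 0 A" "x $ (j + 1) \<noteq> 0" for x
  proof -
    define r where "r = norm x"
    have "x \<noteq> 0" using x by auto
    then have r: "0 < r" "r < A" using x by (auto simp: r_def)
    have r2: "(x $ j)\<^sup>2 + (x $ (j + 1))\<^sup>2 = r\<^sup>2"
      by (simp add: r_def norm_vec_def L2_set_def sum_num2[of _ j])
    have "(x $ j / r)\<^sup>2 + (x $ (j + 1) / r)\<^sup>2 = 1"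
      using r(1) by (simp add: power_divide r2 flip: add_divide_distrib)
    then obtain t where t: "0 \<le> t" "t < 2 * pi" "x $ j / r = cos t" "x $ (j + 1) / r = sin t"
      by (rule sincos_total_2pi)
    have "t \<noteq> 0" using t(4) x(2) r(1) by auto
    moreover have "x = polar j r t"
      using t(3,4) r(1) by (intro polar_eqI) (auto simp: field_simps)
    ultimately show ?thesis
      using t r by (intro image_eqI[of _ _ "vector [r, t]"]) (auto simp: g_def S)
  qed
  have cf: "continuous_on X (\<lambda>y. \<bar>y $ 1\<bar> * f (g y))" for X
    unfolding g_def by (intro continuous_intros continuous_on_compose2[OF f]) auto
  \<comment> \<open>The change of variables theorem concerns functions with values in a vector type,
    hence the detour through \<open>real^1\<close>.\<close>
  define f1 :: "real^2 \<Rightarrow> real^1" where "f1 x = (\<chi> _. f x)" for x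
  have "(\<lambda>y. \<bar>det (matrix (g' y))\<bar> *\<^sub>R f1 (g y)) absolutely_integrable_on cbox (vector [0, 0]) (vector [A, 2 * pi])"
  proof (rule absolutely_integrable_continuous)
    have "(\<lambda>y. \<bar>det (matrix (g' y))\<bar> *\<^sub>R f1 (g y)) = (\<lambda>y. (\<chi> _. \<bar>y $ 1\<bar> * f (g y)) :: real^1)"
      by (simp add: g'_def abs_det_polar f1_def fun_eq_iff vec_eq_iff)
    then show "continuous_on (cbox (vector [0, 0]) (vector [A, 2 * pi])) (\<lambda>y. \<bar>det (matrix (g' y))\<bar> *\<^sub>R f1 (g y))"
      by (simp only:) (intro continuous_on_vec_lambda cf)
  qed
  then have ai: "(\<lambda>y. \<bar>det (matrix (g' y))\<bar> *\<^sub>R f1 (g y)) absolutely_integrable_on S"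
    unfolding S_def by (rule set_integrable_subset) (auto simp: box_subset_cbox)
  have Sm: "S \<in> sets lebesgue" by (simp add: S_def)
  have der: "(g has_derivative g' x) (at x within S)" for x
    unfolding g_def[abs_def] g'_def by (rule has_derivative_polar)
  have cov: "integral (g ` S) f1 = integral S (\<lambda>y. \<bar>det (matrix (g' y))\<bar> *\<^sub>R f1 (g y))"
    by (rule integral_change_of_variables[OF Sm der inj]) (use ai in auto)
  have "f1 absolutely_integrable_on g ` S"
    using absolutely_integrable_change_of_variables[OF Sm der inj] ai by blast
  then have i1: "f1 integrable_on g ` S" "(\<lambda>y. \<bar>det (matrix (g' y))\<bar> *\<^sub>R f1 (g y)) integrable_on S"
    using ai set_lebesgue_integral_eq_integral(1) by blast+
  have "integral (ball 0 A) f = integral (g ` S) f"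
  proof (rule integral_spike_set)
    show "negligible {x \<in> ball 0 A - g ` S. f x \<noteq> 0}"
      by (rule negligible_subset[OF negligible_standard_hyperplane_cart[of "j + 1"]]) (use sup in auto)
    show "negligible {x \<in> g ` S - ball 0 A. f x \<noteq> 0}"
      by (rule negligible_subset[OF negligible_empty]) (use sub in auto)
  qed
  also have "\<dots> = integral (g ` S) f1 $ 1"
    using i1 by (simp add: f1_def flip: integral_component_eq_cart)
  also have "\<dots> = integral S (\<lambda>y. (\<bar>det (matrix (g' y))\<bar> *\<^sub>R f1 (g y)) $ 1)"
    unfolding cov using i1 by (simp flip: integral_component_eq_cart)
  also have "\<dots> = integral S (\<lambda>y. \<bar>y $ 1\<bar> * f (g y))"
    by (simp add: g'_def abs_det_polar f1_def)
  also have "\<dots> = integral (cbox (vector [0, 0]) (vector [A, 2 * pi])) (\<lambda>y. \<bar>y $ 1\<bar> * f (g y))"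
    unfolding S_def by (rule integral_open_interval)
  also have "\<dots> = integral {0..A} (\<lambda>r. integral {0..2 * pi} (\<lambda>\<theta>. \<bar>r\<bar> * f (polar j r \<theta>)))"
    by (subst integral_cbox_cart2[OF cf]) (simp add: g_def)
  also have "\<dots> = integral {0..A} (\<lambda>r. integral {0..2 * pi} (\<lambda>\<theta>. r * f (polar j r \<theta>)))"
    by (rule integral_cong) auto
  finally show ?thesis .
qed

section \<open>The magnetic field\<close>

text \<open>The two horizontal coordinates as coordinates of the ambient space.\<close>

definition emb :: "2 \<Rightarrow> 3" where
  "emb k = (if k = 1 then 1 else 2)"

lemma pderiv3_coord: "pderiv3 k (\<lambda>t. t $ i) = (\<lambda>_. if k = i then 1 else 0)"
proof
  fix t
  have "((\<lambda>t::real^3. t $ i) has_derivative (\<lambda>h. h $ i)) (at t)"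
    by (intro bounded_linear_imp_has_derivative bounded_linear_vec_nth)
  from pderiv3_eq[OF this, of k] show "pderiv3 k (\<lambda>t. t $ i) t = (if k = i then 1 else 0)"
    by (simp add: axis_def)
qed

lemma smooth3_coord: "smooth3_on UNIV (\<lambda>t. t $ i)"
  by (simp add: smooth3_iff smooth_family_coord)

lemma pderiv3_diff:
  assumes "smooth3_on UNIV f" "smooth3_on UNIV g"
  shows "pderiv3 i (\<lambda>x. f x - c * g x) = (\<lambda>x. pderiv3 i f x - c * pderiv3 i g x)"
  using pderivs_diff[OF assms, of "[i]"] by simp

text \<open>\<open>d\<close> is a uniform gap between the supports and the measuring plane;
  functions of t may be altered inside that gap and above it without changing any pairing.\<close>

locale magnetisation =
  fixes M :: "3 \<Rightarrow> (real^3 \<Rightarrow> real) \<Rightarrow> real" and h d :: real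
  assumes distr: "cdistr (M i)"
    and d_pos: "d > 0"
    and below: "t \<in> dsupp (M i) \<Longrightarrow> h - t $ 3 > d"
begin

text \<open>The height below the measurement plane, made positive away from the support.\<close>

definition w :: "real^3 \<Rightarrow> real" where
  "w t = cutoff d (h - t $ 3)"

text \<open>The distribution \<open>- div M\<close>.\<close>

definition S :: "(real^3 \<Rightarrow> real) \<Rightarrow> real" where
  "S \<phi> = (\<Sum>i\<in>UNIV. M i (pderiv3 i \<phi>))"

lemma w_pos: "w t > 0"
  by (simp add: w_def cutoff_pos d_pos)

lemma w_neq_0 [simp]: "w t \<noteq> 0"
  using w_pos[of t] by simp

lemma smooth_family_w [smooth_family_intros]: "smooth_family Y (\<lambda>y t. w t)"
  unfolding w_def by (intro smooth_family_intros smooth_family_cutoff d_pos continuous_on_const)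

lemma smooth3_w: "smooth3_on UNIV w"
  using smooth_family_w by (simp add: smooth3_iff)

lemma smooth3_pderiv3: "smooth3_on UNIV f \<Longrightarrow> smooth3_on UNIV (pderiv3 i f)"
  using smooth_family_pderiv3[of "{0::real}" "\<lambda>_. f" i] by (simp add: smooth3_iff)

lemma S_diff:
  assumes "smooth3_on UNIV f" "smooth3_on UNIV g"
  shows "S (\<lambda>t. f t - c * g t) = S f - c * S g"
proof -
  have "M i (\<lambda>t. pderiv3 i f t - c * pderiv3 i g t) = M i (pderiv3 i f) - c * M i (pderiv3 i g)" for i
    using cdistr_lincomb[OF distr[of i] smooth3_pderiv3[OF assms(1)] smooth3_pderiv3[OF assms(2)], where a = 1 and b = "- c"]
    by simp
  then show ?thesis
    by (simp add: S_def pderiv3_diff[OF assms] sum_subtractf sum_distrib_left)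
qed

lemma S_const: "S (\<lambda>t. c) = 0"
proof -
  have "pderiv3 i (\<lambda>t. c) = (\<lambda>t. 0)" for i by (simp add: pderiv3_def fun_eq_iff)
  then show ?thesis by (simp add: S_def cdistr_zero[OF distr])
qed

lemma S_scale: "smooth3_on UNIV f \<Longrightarrow> S (\<lambda>t. c * f t) = c * S f"
  using S_diff[of "\<lambda>_. 0" f, where c = "- c"] S_const[of 0] by (simp add: smooth3_const)

lemma S_add: "smooth3_on UNIV f \<Longrightarrow> smooth3_on UNIV g \<Longrightarrow> S (\<lambda>t. f t + g t) = S f + S g"
  using S_diff[of f g, where c = "- 1"] by simp

lemma S_coord: "S (\<lambda>t. t $ i) = moment M i"
proof -
  have "M k (\<lambda>_. if k = i then 1 else 0) = (if k = i then moment M i else 0)" for k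
    by (simp add: moment_def cdistr_zero[OF distr])
  then show ?thesis by (simp add: S_def pderiv3_coord)
qed

definition near :: "(real^3) set" where
  "near = {t. h - t $ 3 > d}"

lemma open_near: "open near"
  unfolding near_def by (intro open_Collect_less continuous_intros)

lemma dsupp_near: "dsupp (M i) \<subseteq> near"
  using below by (auto simp: near_def)

lemma w_near: "t \<in> near \<Longrightarrow> w t = h - t $ 3"
  using cutoff_eq[OF d_pos, of "h - t $ 3"] by (simp add: near_def w_def)

text \<open>Near the supports the gradient of \<open>w\<close> is minus the third unit vector, and
  only values near the supports count. This is where m_3 enters: \<open>w\<close> is the leading
  coefficient of the kernel at infinity.\<close>

lemma S_w: "S w = - moment M 3"
proof -
  have "M k (pderiv3 k w) = M k (\<lambda>_. if k = 3 then - 1 else 0)" for k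
  proof (rule cdistr_cong_near_dsupp[OF distr smooth3_pderiv3[OF smooth3_w] smooth3_const open_near dsupp_near])
    fix t assume t: "t \<in> near"
    have "pderivs [k] w t = pderivs [k] (\<lambda>t. h - 1 * t $ 3) t"
      by (rule pderivs_cong_open[OF open_near _ t]) (simp add: w_near)
    also have "\<dots> = pderiv3 k (\<lambda>_. h) t - 1 * pderiv3 k (\<lambda>t. t $ 3) t"
      using pderiv3_diff[OF smooth3_const smooth3_coord, of k h 1 3] by (simp add: fun_eq_iff)
    also have "\<dots> = (if k = 3 then - 1 else 0)"
      by (simp add: pderiv3_coord) (simp add: pderiv3_def)
    finally show "pderiv3 k w t = (if k = 3 then - 1 else 0)" by simp
  qed
  moreover have "M 3 (\<lambda>_. - 1) = - moment M 3"
    using cdistr_scale[OF distr smooth3_const, of 3 "- 1" 1] by (simp add: moment_def)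
  moreover have "M k (\<lambda>_. if k = 3 then - 1 else 0) = (if k = 3 then M 3 (\<lambda>_. - 1) else 0)" for k
    by (simp add: cdistr_zero[OF distr])
  ultimately show ?thesis by (simp add: S_def)
qed

lemma S_family_continuous: "smooth_family Y f \<Longrightarrow> continuous_on Y (\<lambda>y. S (f y))"
  unfolding S_def by (intro continuous_on_sum cdistr_family_continuous[OF distr] smooth_family_pderiv3)

lemma S_parameter_derivative:
  fixes F f :: "real \<Rightarrow> real^3 \<Rightarrow> real"
  assumes F: "smooth_family {a..b} F" and f: "smooth_family {a..b} f"
    and deriv: "\<And>r t. r \<in> {a..b} \<Longrightarrow> ((\<lambda>r. F r t) has_real_derivative f r t) (at r within {a..b})"
    and r: "r \<in> {a..b}"
  shows "((\<lambda>r. S (F r)) has_real_derivative S (f r)) (at r within {a..b})"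
  unfolding S_def
  by (intro DERIV_sum cdistr_parameter_derivative[OF distr] smooth_family_pderiv3 F f r
        smooth_family_pderiv3_parameter_derivative[OF F f deriv])

text \<open>The squared distance from the point \<open>(a / \<rho>, b / \<rho>, h)\<close>, scaled by \<open>\<rho>\<^sup>2\<close>; the factor
  makes it regular at \<open>\<rho> = 0\<close>, the point at infinity.\<close>

definition dist2 :: "2 \<Rightarrow> real \<Rightarrow> real \<Rightarrow> real \<Rightarrow> real^3 \<Rightarrow> real" where
  "dist2 j a b \<rho> t = (a - \<rho> * t $ emb j)\<^sup>2 + (b - \<rho> * t $ emb (j + 1))\<^sup>2 + (\<rho> * w t)\<^sup>2"

text \<open>At \<rho> = 1 this is w / R^3 seen from the point (a, b, h). By homogeneity, taking a
  unit vector (a, b) and \<rho> = 1/r gives r^3 times the kernel seen from horizontal position r (a,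
  b).\<close>

definition poisson :: "2 \<Rightarrow> real \<Rightarrow> real \<Rightarrow> real \<Rightarrow> real^3 \<Rightarrow> real" where
  "poisson j a b \<rho> t = w t / sqrt (dist2 j a b \<rho> t) ^ 3"

lemma dist2_pos: "\<rho> \<noteq> 0 \<or> a\<^sup>2 + b\<^sup>2 > 0 \<Longrightarrow> dist2 j a b \<rho> t > 0"
  by (cases "\<rho> = 0") (auto simp: dist2_def intro!: add_nonneg_pos)

lemma smooth_family_dist2 [smooth_family_intros]:
  "continuous_on Y a \<Longrightarrow> continuous_on Y b \<Longrightarrow> continuous_on Y \<rho> \<Longrightarrow>
    smooth_family Y (\<lambda>y t. dist2 j (a y) (b y) (\<rho> y) t)"
  unfolding dist2_def by (intro smooth_family_intros)

lemma smooth_family_poisson: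
  assumes "continuous_on Y a" "continuous_on Y b" "continuous_on Y \<rho>"
    and "\<And>y. y \<in> Y \<Longrightarrow> \<rho> y \<noteq> 0 \<or> (a y)\<^sup>2 + (b y)\<^sup>2 > 0"
  shows "smooth_family Y (\<lambda>y. poisson j (a y) (b y) (\<rho> y))"
  unfolding poisson_def using dist2_pos[OF assms(4)]
  by (intro smooth_family_intros assms) (auto simp: less_imp_neq[symmetric])

lemma dist2_at_1: "dist2 j (x $ j) (x $ (j + 1)) 1 t = hdist2 x t + (w t)\<^sup>2"
  using sum_num2[of "\<lambda>k. (x $ k - t $ emb k)\<^sup>2" j] by (simp add: dist2_def hdist2_def sum_2 emb_def)

text \<open>A derivative in a general direction (c1, c2, c3) settles the three components of the
  kernel in one computation. For the third unit vector the numerator is 3 z^2 - D = 2 z^2 - a^2 -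
  b^2.\<close>

lemma kernel_line_derivative:
  fixes a b z c1 c2 c3 :: real
  assumes "z > 0"
  defines "D \<equiv> a\<^sup>2 + b\<^sup>2 + z\<^sup>2"
  shows "((\<lambda>s. (z - s * c3) / sqrt ((a - s * c1)\<^sup>2 + (b - s * c2)\<^sup>2 + (z - s * c3)\<^sup>2) ^ 3) has_real_derivative
     (3 * z * (a * c1 + b * c2 + z * c3) - D * c3) / D powr (5 / 2)) (at 0)"
proof -
  have D: "D > 0" using assms by (simp add: D_def add_nonneg_pos)
  define R where "R = sqrt D"
  have R: "R > 0" "R ^ 2 = D" using D by (auto simp: R_def)
  have "D powr (5 / 2) = R ^ 5"
  proof -
    have "D powr (5 / 2) = (D powr (1 / 2)) powr 5" by (simp add: powr_powr)
    also have "\<dots> = R powr real 5" using D by (simp add: powr_half_sqrt R_def)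
    also have "\<dots> = R ^ 5" using R(1) by (rule powr_realpow)
    finally show ?thesis .
  qed
  moreover have "((\<lambda>s. (z - s * c3) / sqrt ((a - s * c1)\<^sup>2 + (b - s * c2)\<^sup>2 + (z - s * c3)\<^sup>2) ^ 3) has_real_derivative
     (- c3 * R ^ 3 - z * (3 * R ^ 2 * (- (a * c1 + b * c2 + z * c3) / R))) / (R ^ 3 * R ^ 3)) (at 0)"
    using D R(1) by (auto intro!: derivative_eq_intros simp: R_def D_def field_simps)
  moreover have "(- c3 * R ^ 3 - z * (3 * R ^ 2 * (- (a * c1 + b * c2 + z * c3) / R))) / (R ^ 3 * R ^ 3)
     = (3 * z * (a * c1 + b * c2 + z * c3) - D * c3) / R ^ 5"
    unfolding R(2)[symmetric] using R(1) by (simp add: field_simps eval_nat_numeral)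
  ultimately show ?thesis by simp
qed

lemma pderiv3_poisson:
  assumes t: "t \<in> near"
  shows "pderiv3 i (poisson j (x $ j) (x $ (j + 1)) 1) t = 4 * pi * kerB h x i t"
proof -
  define \<psi> where "\<psi> t = (h - t $ 3) / sqrt ((x $ 1 - t $ 1)\<^sup>2 + (x $ 2 - t $ 2)\<^sup>2 + (h - t $ 3)\<^sup>2) ^ 3" for t :: "real^3"
  have z: "h - t $ 3 > 0" using t d_pos by (simp add: near_def)
  have "pderivs [i] (poisson j (x $ j) (x $ (j + 1)) 1) t = pderivs [i] \<psi> t"
    by (rule pderivs_cong_open[OF open_near _ t]) (simp add: poisson_def dist2_at_1 hdist2_def w_near \<psi>_def)
  also have "\<dots> = deriv (\<lambda>s. (h - t $ 3 - s * axis i 1 $ 3) / sqrt ((x $ 1 - t $ 1 - s * axis i 1 $ 1)\<^sup>2 +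
      (x $ 2 - t $ 2 - s * axis i 1 $ 2)\<^sup>2 + (h - t $ 3 - s * axis i 1 $ 3)\<^sup>2) ^ 3) 0"
    by (simp add: pderiv3_def \<psi>_def diff_diff_eq)
  also have "\<dots> = 4 * pi * kerB h x i t"
    unfolding DERIV_imp_deriv[OF kernel_line_derivative[OF z]] kerB_def hdist2_def
    using exhaust_3[of i] by (auto simp: axis_def power2_eq_square algebra_simps)
  finally show ?thesis by simp
qed

lemma B3_eq: "B3 M h x = S (poisson j (x $ j) (x $ (j + 1)) 1) / (4 * pi)"
proof -
  let ?P = "poisson j (x $ j) (x $ (j + 1)) 1"
  have "smooth_family {0::real} (\<lambda>_. ?P)"
    by (rule smooth_family_poisson) (auto intro!: continuous_intros)
  then have s: "smooth3_on UNIV ?P" by (simp add: smooth3_iff)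
  have "dpair (M i) (kerB h x i) = 1 / (4 * pi) * M i (pderiv3 i ?P)" for i
  proof -
    have "smooth3_on UNIV (\<lambda>t. 1 / (4 * pi) * pderiv3 i ?P t)"
      using smooth3_pderiv3[OF s, of i] unfolding smooth3_iff
      by (intro smooth_family_intros continuous_on_const)
    then have "dpair (M i) (kerB h x i) = M i (\<lambda>t. 1 / (4 * pi) * pderiv3 i ?P t)"
      by (rule dpair_eq[OF distr _ open_near dsupp_near]) (simp add: pderiv3_poisson)
    then show ?thesis by (simp only: cdistr_scale[OF distr smooth3_pderiv3[OF s]])
  qed
  then show ?thesis by (simp add: B3_def S_def sum_3 add_divide_distrib)
qed

lemma continuous_on_B3: "continuous_on UNIV (B3 M h)"
proof -
  have "continuous_on UNIV (\<lambda>x::real^2. S (poisson 1 (x $ 1) (x $ (1 + 1)) 1))"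
    by (rule S_family_continuous, rule smooth_family_poisson) (auto intro!: continuous_intros)
  moreover have "B3 M h = (\<lambda>x. S (poisson 1 (x $ 1) (x $ (1 + 1)) 1) / (4 * pi))"
    using B3_eq[of _ 1] by (rule ext)
  ultimately show ?thesis by (simp only:) (intro continuous_intros; simp)
qed

lemma ball_moment_polar:
  assumes "A > 0"
  shows "integral (ball 0 A) (\<lambda>x. (x $ j) ^ q * B3 M h x) =
    integral {0..A} (\<lambda>r. integral {0..2 * pi} (\<lambda>\<theta>. r * (r * cos \<theta>) ^ q * S (poisson j (r * cos \<theta>) (r * sin \<theta>) 1))) / (4 * pi)"
proof -
  have "continuous_on UNIV (\<lambda>x::real^2. (x $ j) ^ q * B3 M h x)"
    by (intro continuous_intros continuous_on_B3)
  note integral_ball_polar[OF this assms, of j]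
  also have "(\<lambda>r \<theta>. r * ((polar j r \<theta> $ j) ^ q * B3 M h (polar j r \<theta>))) =
     (\<lambda>r \<theta>. r * (r * cos \<theta>) ^ q * S (poisson j (r * cos \<theta>) (r * sin \<theta>) 1) / (4 * pi))"
    by (simp add: fun_eq_iff B3_eq[of _ j])
  finally show ?thesis by (simp only: integral_divide)
qed

lemma continuous_on_poisson_polar:
  "continuous_on X (\<lambda>(r, \<theta>). S (poisson j (r * cos \<theta>) (r * sin \<theta>) 1))"
  unfolding case_prod_beta
  by (rule S_family_continuous, rule smooth_family_poisson) (auto intro!: continuous_intros)

text \<open>The divergence theorem on a disc, in polar coordinates: \<open>F\<close> and \<open>G\<close> are \<open>r\<close> times the
  radial component and the angular component of a vector field.\<close>

lemma polar_divergence: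
  fixes F F' G G' :: "real \<times> real \<Rightarrow> real^3 \<Rightarrow> real"
  assumes A: "A \<ge> 0"
    and fam: "smooth_family ({0..A} \<times> {0..2 * pi}) F" "smooth_family ({0..A} \<times> {0..2 * pi}) F'"
      "smooth_family ({0..A} \<times> {0..2 * pi}) G" "smooth_family ({0..A} \<times> {0..2 * pi}) G'"
    and F': "\<And>r \<theta> t. 0 \<le> r \<Longrightarrow> ((\<lambda>r. F (r, \<theta>) t) has_real_derivative F' (r, \<theta>) t) (at r)"
    and G': "\<And>r \<theta> t. 0 \<le> r \<Longrightarrow> ((\<lambda>\<theta>. G (r, \<theta>) t) has_real_derivative G' (r, \<theta>) t) (at \<theta>)"
    and F0: "\<And>\<theta>. F (0, \<theta>) = (\<lambda>t. 0)"
    and G0: "\<And>r. G (r, 2 * pi) = G (r, 0)"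
  shows "integral {0..A} (\<lambda>r. integral {0..2 * pi} (\<lambda>\<theta>. S (\<lambda>t. F' (r, \<theta>) t + G' (r, \<theta>) t))) =
    integral {0..2 * pi} (\<lambda>\<theta>. S (F (A, \<theta>)))"
proof -
  let ?Y = "{0..A} \<times> {0..2 * pi}"
  have cF: "continuous_on ?Y (\<lambda>y. S (F' y))" and cG: "continuous_on ?Y (\<lambda>y. S (G' y))"
    using fam by (auto intro: S_family_continuous)
  have add: "S (\<lambda>t. F' (r, \<theta>) t + G' (r, \<theta>) t) = S (F' (r, \<theta>)) + S (G' (r, \<theta>))"
    if "r \<in> {0..A}" "\<theta> \<in> {0..2 * pi}" for r \<theta>
    using that by (intro S_add smooth_familyD(3)[OF fam(2)] smooth_familyD(3)[OF fam(4)]) auto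
  \<comment> \<open>By periodicity the angular part contributes nothing on any circle.\<close>
  have iG: "((\<lambda>\<theta>. S (G' (r, \<theta>))) has_integral 0) {0..2 * pi}" if r: "r \<in> {0..A}" for r
  proof -
    have re: "continuous_on {0..2 * pi} (\<lambda>\<theta>. (r, \<theta>))" "(\<lambda>\<theta>. (r, \<theta>)) ` {0..2 * pi} \<subseteq> ?Y"
      using r by (auto intro!: continuous_intros)
    have "((\<lambda>\<theta>. S (G' (r, \<theta>))) has_integral (S (G (r, 2 * pi)) - S (G (r, 0)))) {0..2 * pi}"
    proof (rule fundamental_theorem_of_calculus)
      fix \<theta> assume "\<theta> \<in> {0..2 * pi}"
      then have "((\<lambda>\<theta>. S (G (r, \<theta>))) has_real_derivative S (G' (r, \<theta>))) (at \<theta> within {0..2 * pi})"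
        using r by (intro S_parameter_derivative smooth_family_reindex[OF fam(3) re]
          smooth_family_reindex[OF fam(4) re] DERIV_subset[OF G']) auto
      then show "((\<lambda>\<theta>. S (G (r, \<theta>))) has_vector_derivative S (G' (r, \<theta>))) (at \<theta> within {0..2 * pi})"
        by (simp add: has_real_derivative_iff_has_vector_derivative)
    qed simp
    then show ?thesis by (simp add: G0)
  qed
  have iF: "((\<lambda>r. S (F' (r, \<theta>))) has_integral S (F (A, \<theta>))) {0..A}" if \<theta>: "\<theta> \<in> {0..2 * pi}" for \<theta>
  proof -
    have re: "continuous_on {0..A} (\<lambda>r. (r, \<theta>))" "(\<lambda>r. (r, \<theta>)) ` {0..A} \<subseteq> ?Y"
      using \<theta> by (auto intro!: continuous_intros)
    have "((\<lambda>r. S (F' (r, \<theta>))) has_integral (S (F (A, \<theta>)) - S (F (0, \<theta>)))) {0..A}"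
    proof (rule fundamental_theorem_of_calculus)
      fix r assume "r \<in> {0..A}"
      then have "((\<lambda>r. S (F (r, \<theta>))) has_real_derivative S (F' (r, \<theta>))) (at r within {0..A})"
        using \<theta> by (intro S_parameter_derivative smooth_family_reindex[OF fam(1) re]
          smooth_family_reindex[OF fam(2) re] DERIV_subset[OF F']) auto
      then show "((\<lambda>r. S (F (r, \<theta>))) has_vector_derivative S (F' (r, \<theta>))) (at r within {0..A})"
        by (simp add: has_real_derivative_iff_has_vector_derivative)
    qed (use A in simp)
    then show ?thesis by (simp add: F0 S_const)
  qed
  have "integral {0..2 * pi} (\<lambda>\<theta>. S (\<lambda>t. F' (r, \<theta>) t + G' (r, \<theta>) t)) = integral {0..2 * pi} (\<lambda>\<theta>. S (F' (r, \<theta>)))"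
    if r: "r \<in> {0..A}" for r
  proof -
    have "continuous_on {0..2 * pi} (\<lambda>\<theta>. S (F' (r, \<theta>)))"
      by (rule continuous_on_compose2[OF cF]) (use r in \<open>auto intro!: continuous_intros\<close>)
    then have "((\<lambda>\<theta>. S (F' (r, \<theta>))) has_integral integral {0..2 * pi} (\<lambda>\<theta>. S (F' (r, \<theta>)))) {0..2 * pi}"
      by (intro integrable_integral integrable_continuous_real)
    from has_integral_add[OF this iG[OF r]] show ?thesis
      by (intro integral_unique) (rule has_integral_eq[rotated], auto simp: add[OF r])
  qed
  then have "integral {0..A} (\<lambda>r. integral {0..2 * pi} (\<lambda>\<theta>. S (\<lambda>t. F' (r, \<theta>) t + G' (r, \<theta>) t))) =
      integral {0..A} (\<lambda>r. integral {0..2 * pi} (\<lambda>\<theta>. S (F' (r, \<theta>))))"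
    by (rule integral_cong) auto
  \<comment> \<open>After the interchange the inner integral is that of a radial derivative, and
    only the boundary r = A survives because \<open>F\<close> vanishes at r = 0.\<close>
  also have "\<dots> = integral {0..2 * pi} (\<lambda>\<theta>. integral {0..A} (\<lambda>r. S (F' (r, \<theta>))))"
    using integral_swap_continuous[of 0 0 A "2 * pi" "\<lambda>r \<theta>. S (F' (r, \<theta>))"] cF
    by (simp add: cbox_Pair_eq case_prod_beta)
  also have "\<dots> = integral {0..2 * pi} (\<lambda>\<theta>. S (F (A, \<theta>)))"
    using integral_unique[OF iF] by (rule integral_cong) auto
  finally show ?thesis .
qed

text \<open>In the parameter \<rho> = 1/A infinity is the endpoint 0 of a compact interval, and an
  integral depending continuously on \<rho> converges to its value there.\<close>

lemma tendsto_circle_integral: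
  fixes f :: "real \<times> real \<Rightarrow> real^3 \<Rightarrow> real"
  assumes "smooth_family ({0..1} \<times> {0..2 * pi}) f"
  shows "((\<lambda>A. integral {0..2 * pi} (\<lambda>\<theta>. S (f (1 / A, \<theta>)))) \<longlongrightarrow> integral {0..2 * pi} (\<lambda>\<theta>. S (f (0, \<theta>)))) at_top"
proof -
  have "continuous_on ({0..1} \<times> cbox 0 (2 * pi)) (\<lambda>(\<rho>, \<theta>). S (f (\<rho>, \<theta>)))"
    using S_family_continuous[OF assms] by (simp add: case_prod_beta)
  then have "continuous_on {0..1} (\<lambda>\<rho>. integral (cbox 0 (2 * pi)) (\<lambda>\<theta>. S (f (\<rho>, \<theta>))))"
    by (rule integral_continuous_on_param)
  from this[unfolded continuous_on_def, rule_format, of 0]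
  have "((\<lambda>\<rho>. integral {0..2 * pi} (\<lambda>\<theta>. S (f (\<rho>, \<theta>)))) \<longlongrightarrow> integral {0..2 * pi} (\<lambda>\<theta>. S (f (0, \<theta>)))) (at 0 within {0..1})"
    by simp
  moreover have "filterlim (\<lambda>A::real. 1 / A) (at 0 within {0..1}) at_top"
    unfolding filterlim_at
  proof
    show "\<forall>\<^sub>F A::real in at_top. 1 / A \<in> {0..1} \<and> 1 / A \<noteq> 0"
      using eventually_ge_at_top[of 1] by eventually_elim auto
    show "((\<lambda>A::real. 1 / A) \<longlongrightarrow> 0) at_top"
      using tendsto_inverse_0_at_top[OF filterlim_ident] by (simp add: inverse_eq_divide)
  qed
  ultimately show ?thesis by (rule filterlim_compose)
qed

lemma dist2_scale: "r \<noteq> 0 \<Longrightarrow> dist2 j (r * a) (r * b) 1 t = r\<^sup>2 * dist2 j a b (1 / r) t"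
  by (simp add: dist2_def power2_eq_square field_simps)

lemma dist2_circle_pos: "dist2 j (cos \<theta>) (sin \<theta>) \<rho> t > 0"
  by (rule dist2_pos) simp

section \<open>The vector fields whose divergences give the Poisson kernel\<close>

context
  fixes j :: 2
begin

definition R :: "real \<Rightarrow> real \<Rightarrow> real^3 \<Rightarrow> real" where
  "R r \<theta> t = sqrt (dist2 j (r * cos \<theta>) (r * sin \<theta>) 1 t)"

text \<open>\<xi> and \<eta> are the radial and the angular component of the horizontal vector from
  t to the point with polar coordinates (r, \<theta>). The angular one does not depend on r, as the
  position vector itself is radial.\<close>

definition \<xi> :: "real \<Rightarrow> real \<Rightarrow> real^3 \<Rightarrow> real" where
  "\<xi> r \<theta> t = cos \<theta> * (r * cos \<theta> - t $ emb j) + sin \<theta> * (r * sin \<theta> - t $ emb (j + 1))"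

definition \<eta> :: "real \<Rightarrow> real^3 \<Rightarrow> real" where
  "\<eta> \<theta> t = sin \<theta> * t $ emb j - cos \<theta> * t $ emb (j + 1)"

lemma R_pos: "R r \<theta> t > 0"
  by (simp add: R_def dist2_pos)

lemma R_square: "(R r \<theta> t)\<^sup>2 = dist2 j (r * cos \<theta>) (r * sin \<theta>) 1 t"
  using dist2_pos[of 1 "r * cos \<theta>" "r * sin \<theta>" j t] by (simp add: R_def)

lemma \<xi>_eq: "\<xi> r \<theta> t = r - (cos \<theta> * t $ emb j + sin \<theta> * t $ emb (j + 1))"
proof -
  have "r * (cos \<theta> * cos \<theta>) + r * (sin \<theta> * sin \<theta>) = r"
    using sin_cos_squared_add[of \<theta>] by (simp add: power2_eq_square flip: distrib_left)
  then show ?thesis by (simp add: \<xi>_def algebra_simps)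
qed

lemma \<xi>_\<eta>_square: "(\<xi> r \<theta> t)\<^sup>2 + (\<eta> \<theta> t)\<^sup>2 = (R r \<theta> t)\<^sup>2 - (w t)\<^sup>2"
proof -
  have c: "(cos \<theta>)\<^sup>2 = 1 - (sin \<theta>)\<^sup>2" by (simp add: cos_squared_eq)
  show ?thesis
    unfolding \<xi>_eq \<eta>_def R_square dist2_def
    by (simp add: power2_diff power2_sum power_mult_distrib c algebra_simps)
qed

lemma R_radial_derivative: "((\<lambda>r. R r \<theta> t) has_real_derivative \<xi> r \<theta> t / R r \<theta> t) (at r)"
  unfolding R_def dist2_def \<xi>_def
  by (rule derivative_eq_intros refl | use dist2_pos[of 1 "r * cos \<theta>" "r * sin \<theta>" j t] in \<open>simp add: dist2_def field_simps\<close>)+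

lemma R_angular_derivative: "((\<lambda>\<theta>. R r \<theta> t) has_real_derivative r * \<eta> \<theta> t / R r \<theta> t) (at \<theta>)"
  unfolding R_def dist2_def \<eta>_def
  by (rule derivative_eq_intros refl | use dist2_pos[of 1 "r * cos \<theta>" "r * sin \<theta>" j t] in \<open>simp add: dist2_def field_simps\<close>)+

lemma \<xi>_radial_derivative: "((\<lambda>r. \<xi> r \<theta> t) has_real_derivative 1) (at r)"
  unfolding \<xi>_eq by (auto intro!: derivative_eq_intros)

lemma \<eta>_derivative: "((\<lambda>\<theta>. \<eta> \<theta> t) has_real_derivative r - \<xi> r \<theta> t) (at \<theta>)"
  unfolding \<xi>_eq \<eta>_def by (auto intro!: derivative_eq_intros)

lemma smooth_family_R [smooth_family_intros]:
  fixes Y :: "(real \<times> real) set"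
  shows "smooth_family Y (\<lambda>y t. R (fst y) (snd y) t)"
  unfolding R_def using dist2_pos[of 1]
  by (intro smooth_family_intros continuous_intros) auto

lemma smooth_family_\<xi> [smooth_family_intros]:
  fixes Y :: "(real \<times> real) set"
  shows "smooth_family Y (\<lambda>y t. \<xi> (fst y) (snd y) t)"
  unfolding \<xi>_def by (intro smooth_family_intros continuous_intros)

lemma smooth_family_\<eta> [smooth_family_intros]:
  fixes Y :: "(real \<times> real) set"
  shows "smooth_family Y (\<lambda>y t. \<eta> (snd y) t)"
  unfolding \<eta>_def by (intro smooth_family_intros continuous_intros)


text \<open>The Poisson kernel \<open>w / R\<^sup>3\<close> is the divergence of \<open>(x - t) / (R (R + w))\<close>, which is regular also
  above \<open>t\<close>.\<close>

lemma zeroth_field_divergence: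
  "(\<xi> r \<theta> t / (R r \<theta> t * (R r \<theta> t + w t)) + r / (R r \<theta> t * (R r \<theta> t + w t))
      - r * \<xi> r \<theta> t * \<xi> r \<theta> t * (2 * R r \<theta> t + w t) / (R r \<theta> t * (R r \<theta> t * (R r \<theta> t + w t))\<^sup>2)) +
   ((r - \<xi> r \<theta> t) / (R r \<theta> t * (R r \<theta> t + w t))
      - r * \<eta> \<theta> t * \<eta> \<theta> t * (2 * R r \<theta> t + w t) / (R r \<theta> t * (R r \<theta> t * (R r \<theta> t + w t))\<^sup>2)) =
   r * poisson j (r * cos \<theta>) (r * sin \<theta>) 1 t" (is "?l = _")
proof -
  define x e \<rho> v where "x = \<xi> r \<theta> t" and "e = \<eta> \<theta> t" and "\<rho> = R r \<theta> t" and "v = w t"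
  have pos: "\<rho> > 0" "v > 0" by (simp_all add: \<rho>_def v_def R_pos w_pos)
  \<comment> \<open>The two quadratic terms of the divergence combine to R^2 - w^2 = (R - w)(R + w),
    which cancels against the denominator.\<close>
  have sq: "x * x + e * e = \<rho> * \<rho> - v * v"
    using \<xi>_\<eta>_square[of r \<theta> t] by (simp add: x_def e_def \<rho>_def v_def power2_eq_square)
  have "?l = 2 * r / (\<rho> * (\<rho> + v)) - r * (x * x + e * e) * (2 * \<rho> + v) / (\<rho> * (\<rho> * (\<rho> + v))\<^sup>2)"
    unfolding x_def[symmetric] e_def[symmetric] \<rho>_def[symmetric] v_def[symmetric]
    by (simp add: diff_divide_distrib add_divide_distrib algebra_simps)
  also have "\<dots> = r * v / \<rho> ^ 3"
    unfolding sq using pos by (simp add: divide_simps power2_eq_square power3_eq_cube) (simp add: algebra_simps)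
  finally show ?thesis by (simp add: poisson_def R_def \<rho>_def v_def)
qed

lemma zeroth_field_radial_derivative:
  "((\<lambda>r. r * \<xi> r \<theta> t / (R r \<theta> t * (R r \<theta> t + w t))) has_real_derivative
     \<xi> r \<theta> t / (R r \<theta> t * (R r \<theta> t + w t)) + r / (R r \<theta> t * (R r \<theta> t + w t))
      - r * \<xi> r \<theta> t * \<xi> r \<theta> t * (2 * R r \<theta> t + w t) / (R r \<theta> t * (R r \<theta> t * (R r \<theta> t + w t))\<^sup>2)) (at r)"
proof -
  have pos: "R r \<theta> t > 0" "R r \<theta> t + w t > 0" using R_pos[of r \<theta> t] w_pos[of t] by auto
  show ?thesis
    using pos
    by (auto intro!: derivative_eq_intros R_radial_derivative \<xi>_radial_derivative)
       (simp add: divide_simps power2_eq_square, simp add: algebra_simps)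
qed

lemma zeroth_field_angular_derivative:
  "((\<lambda>\<theta>. \<eta> \<theta> t / (R r \<theta> t * (R r \<theta> t + w t))) has_real_derivative
     (r - \<xi> r \<theta> t) / (R r \<theta> t * (R r \<theta> t + w t))
      - r * \<eta> \<theta> t * \<eta> \<theta> t * (2 * R r \<theta> t + w t) / (R r \<theta> t * (R r \<theta> t * (R r \<theta> t + w t))\<^sup>2)) (at \<theta>)"
proof -
  have pos: "R r \<theta> t > 0" "R r \<theta> t + w t > 0" using R_pos[of r \<theta> t] w_pos[of t] by auto
  show ?thesis
    using pos
    by (auto intro!: derivative_eq_intros R_angular_derivative \<eta>_derivative)
       (simp add: divide_simps power2_eq_square, simp add: algebra_simps)
qed

text \<open>The field is - w / R times the j-th unit vector: differentiating - w / R in x_j gives w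
  (x_j - t_j) / R^3. In polar components the unit vector is (cos \<theta>, - sin \<theta>), and the
  radial component carries the additional factor r.\<close>

lemma first_field_divergence:
  "(- cos \<theta> * w t / R r \<theta> t + r * cos \<theta> * w t * \<xi> r \<theta> t / R r \<theta> t ^ 3) +
   (cos \<theta> * w t / R r \<theta> t - r * sin \<theta> * w t * \<eta> \<theta> t / R r \<theta> t ^ 3) =
   r * (r * cos \<theta> - t $ emb j) * poisson j (r * cos \<theta>) (r * sin \<theta>) 1 t"
proof -
  have "cos \<theta> * \<xi> r \<theta> t - sin \<theta> * \<eta> \<theta> t = r * cos \<theta> - (cos \<theta> * cos \<theta> + sin \<theta> * sin \<theta>) * t $ emb j"
    unfolding \<xi>_eq \<eta>_def by (simp add: algebra_simps del: sin_cos_squared_add3)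
  then have *: "cos \<theta> * \<xi> r \<theta> t - sin \<theta> * \<eta> \<theta> t = r * cos \<theta> - t $ emb j" by (simp add: sin_cos_squared_add3)
  show ?thesis
    unfolding *[symmetric] by (simp add: poisson_def R_def diff_divide_distrib algebra_simps)
qed

lemma first_field_radial_derivative:
  "((\<lambda>r. - r * cos \<theta> * w t / R r \<theta> t) has_real_derivative
     - cos \<theta> * w t / R r \<theta> t + r * cos \<theta> * w t * \<xi> r \<theta> t / R r \<theta> t ^ 3) (at r)"
  using R_pos[of r \<theta> t]
  by (auto intro!: derivative_eq_intros R_radial_derivative)
     (simp add: field_simps power3_eq_cube)

lemma first_field_angular_derivative:
  "((\<lambda>\<theta>. sin \<theta> * w t / R r \<theta> t) has_real_derivative
     cos \<theta> * w t / R r \<theta> t - r * sin \<theta> * w t * \<eta> \<theta> t / R r \<theta> t ^ 3) (at \<theta>)"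
  using R_pos[of r \<theta> t]
  by (auto intro!: derivative_eq_intros R_angular_derivative)
     (simp add: field_simps power3_eq_cube)

end

section \<open>Limits of the flux and of the first moment\<close>

lemma R_scale: "r > 0 \<Longrightarrow> R j r \<theta> t = r * sqrt (dist2 j (cos \<theta>) (sin \<theta>) (1 / r) t)"
  by (simp add: R_def dist2_scale real_sqrt_mult)

lemma smooth_family_dist2_circle [smooth_family_intros]:
  fixes Y :: "(real \<times> real) set"
  shows "smooth_family Y (\<lambda>y t. sqrt (dist2 j (cos (snd y)) (sin (snd y)) (fst y) t))"
  using dist2_circle_pos by (intro smooth_family_intros continuous_intros) auto

lemma smooth3_poisson_polar: "smooth3_on UNIV (poisson j (r * cos \<theta>) (r * sin \<theta>) 1)"
proof -
  have "smooth_family {0::real} (\<lambda>_. poisson j (r * cos \<theta>) (r * sin \<theta>) 1)"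
    by (rule smooth_family_poisson) (auto intro!: continuous_intros)
  then show ?thesis by (simp add: smooth3_iff)
qed

lemma sum_R_w_neq_0 [simp]: "R j r \<theta> t + w t \<noteq> 0" "R j r \<theta> t \<noteq> 0"
  using R_pos[of j r \<theta> t] w_pos[of t] by auto

lemma sqrt_dist2_circle_neq_0 [simp]: "dist2 j (cos \<theta>) (sin \<theta>) \<rho> t \<noteq> 0"
  using dist2_circle_pos[of j \<theta> \<rho> t] by simp

lemma sqrt_dist2_circle_w_neq_0 [simp]:
  "\<rho> \<ge> 0 \<Longrightarrow> sqrt (dist2 j (cos \<theta>) (sin \<theta>) \<rho> t) + \<rho> * w t \<noteq> 0"
proof -
  assume "\<rho> \<ge> 0"
  then have "sqrt (dist2 j (cos \<theta>) (sin \<theta>) \<rho> t) + \<rho> * w t > 0"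
    using dist2_circle_pos[of j \<theta> \<rho> t] w_pos[of t] by (intro add_pos_nonneg) auto
  then show ?thesis by simp
qed

lemma dist2_circle_0 [simp]: "dist2 j (cos \<theta>) (sin \<theta>) 0 t = 1"
  by (simp add: dist2_def)

text \<open>Dividing numerator and denominator by A^2 turns the boundary integrand into an
  expression in 1 / A that remains smooth at 0, where it equals 1.\<close>

lemma zeroth_field_at_infinity:
  assumes "A > 0"
  shows "A * \<xi> j A \<theta> t / (R j A \<theta> t * (R j A \<theta> t + w t)) =
    (1 - 1 / A * (cos \<theta> * t $ emb j + sin \<theta> * t $ emb (j + 1))) /
    (sqrt (dist2 j (cos \<theta>) (sin \<theta>) (1 / A) t) * (sqrt (dist2 j (cos \<theta>) (sin \<theta>) (1 / A) t) + 1 / A * w t))"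
proof -
  define \<rho> s where "\<rho> = sqrt (dist2 j (cos \<theta>) (sin \<theta>) (1 / A) t)"
    and "s = cos \<theta> * t $ emb j + sin \<theta> * t $ emb (j + 1)"
  have "\<rho> > 0" using dist2_circle_pos by (simp add: \<rho>_def)
  then have "A * \<rho> + w t > 0" "\<rho> + w t / A > 0" using w_pos[of t] assms by (auto intro: add_pos_pos)
  then have "A * (A - s) / (A * \<rho> * (A * \<rho> + w t)) = (1 - s / A) / (\<rho> * (\<rho> + w t / A))"
    using assms \<open>\<rho> > 0\<close> by (simp add: divide_simps)
  then show ?thesis using assms by (simp add: R_scale \<xi>_eq \<rho>_def s_def)
qed

lemma periodic: "R j r (2 * pi) t = R j r 0 t" "\<eta> j (2 * pi) t = \<eta> j 0 t"
  by (simp_all add: R_def \<eta>_def)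

lemma tendsto_flux: "((\<lambda>A. integral (ball 0 A) (\<lambda>x. B3 M h x)) \<longlongrightarrow> 0) at_top"
proof -
  define j :: 2 where "j = 1"
  define f where "f y t = (1 - fst y * (cos (snd y) * t $ emb j + sin (snd y) * t $ emb (j + 1))) /
    (sqrt (dist2 j (cos (snd y)) (sin (snd y)) (fst y) t) *
      (sqrt (dist2 j (cos (snd y)) (sin (snd y)) (fst y) t) + fst y * w t))" for y :: "real \<times> real" and t
  have "smooth_family ({0..1} \<times> {0..2 * pi}) f"
    unfolding f_def by (intro smooth_family_intros continuous_intros) auto
  note tendsto_circle_integral[OF this]
  moreover have "f (0, \<theta>) = (\<lambda>t. 1)" for \<theta>
    by (simp add: f_def fun_eq_iff)
  ultimately have "((\<lambda>A. integral {0..2 * pi} (\<lambda>\<theta>. S (f (1 / A, \<theta>)))) \<longlongrightarrow> 0) at_top"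
    by (simp add: S_const)
  then have "((\<lambda>A. integral {0..2 * pi} (\<lambda>\<theta>. S (f (1 / A, \<theta>))) / (4 * pi)) \<longlongrightarrow> 0 / (4 * pi)) at_top"
    by (intro tendsto_divide tendsto_const) auto
  moreover have "\<forall>\<^sub>F A in at_top. integral {0..2 * pi} (\<lambda>\<theta>. S (f (1 / A, \<theta>))) / (4 * pi) = integral (ball 0 A) (\<lambda>x. B3 M h x)"
    using eventually_gt_at_top[of 0]
  proof eventually_elim
    case (elim A)
    have "integral (ball 0 A) (\<lambda>x. B3 M h x) =
      integral {0..A} (\<lambda>r. integral {0..2 * pi} (\<lambda>\<theta>. S (\<lambda>t. r * poisson j (r * cos \<theta>) (r * sin \<theta>) 1 t))) / (4 * pi)"
      using ball_moment_polar[OF elim, of j 0] by (simp add: S_scale smooth3_poisson_polar)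
    also have "integral {0..A} (\<lambda>r. integral {0..2 * pi} (\<lambda>\<theta>. S (\<lambda>t. r * poisson j (r * cos \<theta>) (r * sin \<theta>) 1 t))) =
      integral {0..2 * pi} (\<lambda>\<theta>. S (\<lambda>t. A * \<xi> j A \<theta> t / (R j A \<theta> t * (R j A \<theta> t + w t))))"
      unfolding zeroth_field_divergence[symmetric]
      by (rule polar_divergence[where
         F = "\<lambda>y t. fst y * \<xi> j (fst y) (snd y) t / (R j (fst y) (snd y) t * (R j (fst y) (snd y) t + w t))"
         and F' = "\<lambda>y t. \<xi> j (fst y) (snd y) t / (R j (fst y) (snd y) t * (R j (fst y) (snd y) t + w t)) + fst y / (R j (fst y) (snd y) t * (R j (fst y) (snd y) t + w t))
            - fst y * \<xi> j (fst y) (snd y) t * \<xi> j (fst y) (snd y) t * (2 * R j (fst y) (snd y) t + w t) / (R j (fst y) (snd y) t * (R j (fst y) (snd y) t * (R j (fst y) (snd y) t + w t))\<^sup>2)"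
         and G = "\<lambda>y t. \<eta> j (snd y) t / (R j (fst y) (snd y) t * (R j (fst y) (snd y) t + w t))"
         and G' = "\<lambda>y t. (fst y - \<xi> j (fst y) (snd y) t) / (R j (fst y) (snd y) t * (R j (fst y) (snd y) t + w t))
            - fst y * \<eta> j (snd y) t * \<eta> j (snd y) t * (2 * R j (fst y) (snd y) t + w t) / (R j (fst y) (snd y) t * (R j (fst y) (snd y) t * (R j (fst y) (snd y) t + w t))\<^sup>2)",
         unfolded fst_conv snd_conv])
        (use elim in \<open>auto intro!: smooth_family_intros continuous_intros zeroth_field_radial_derivative zeroth_field_angular_derivative
           simp: periodic\<close>)
    also have "\<dots> = integral {0..2 * pi} (\<lambda>\<theta>. S (f (1 / A, \<theta>)))"
      unfolding zeroth_field_at_infinity[OF elim] f_def by simp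
    finally show ?case by simp
  qed
  ultimately show ?thesis by (simp add: Lim_transform_eventually)
qed

lemma first_field_at_infinity:
  assumes "A > 0"
  shows "- A * cos \<theta> * w t / R j A \<theta> t = - cos \<theta> * w t / sqrt (dist2 j (cos \<theta>) (sin \<theta>) (1 / A) t)"
  using assms by (simp add: R_scale)

text \<open>The factor x_j is split into t_j, which is constant for the divergence in x and
  multiplies the field of the flux, and x_j - t_j, which has a field of its own.\<close>

lemma tendsto_first_moment:
  "((\<lambda>A. integral (ball 0 A) (\<lambda>x. x $ j * B3 M h x)) \<longlongrightarrow> moment M (emb j) / 2) at_top"
proof -
  define f where "f y t = t $ emb j * ((1 - fst y * (cos (snd y) * t $ emb j + sin (snd y) * t $ emb (j + 1))) /
    (sqrt (dist2 j (cos (snd y)) (sin (snd y)) (fst y) t) *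
      (sqrt (dist2 j (cos (snd y)) (sin (snd y)) (fst y) t) + fst y * w t))) +
    - cos (snd y) * w t / sqrt (dist2 j (cos (snd y)) (sin (snd y)) (fst y) t)" for y :: "real \<times> real" and t
  have "smooth_family ({0..1} \<times> {0..2 * pi}) f"
    unfolding f_def by (intro smooth_family_intros continuous_intros) auto
  note tendsto_circle_integral[OF this]
  also have "integral {0..2 * pi} (\<lambda>\<theta>. S (f (0, \<theta>))) = 2 * pi * moment M (emb j)"
  proof -
    \<comment> \<open>At infinity the second field leaves - cos \<theta> times \<open>w\<close>,
      which averages out over the circle; only t_j remains.\<close>
    have "f (0, \<theta>) = (\<lambda>t. t $ emb j - cos \<theta> * w t)" for \<theta>
      by (simp add: f_def fun_eq_iff)
    then have "S (f (0, \<theta>)) = moment M (emb j) - cos \<theta> * S w" for \<theta>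
      by (simp add: S_diff[OF smooth3_coord smooth3_w] S_coord)
    moreover have "((\<lambda>\<theta>. moment M (emb j) - cos \<theta> * S w) has_integral
      (moment M (emb j) * (2 * pi) - sin (2 * pi) * S w) - (moment M (emb j) * 0 - sin 0 * S w)) {0..2 * pi}"
      by (intro fundamental_theorem_of_calculus)
         (auto intro!: derivative_eq_intros simp flip: has_real_derivative_iff_has_vector_derivative)
    ultimately show ?thesis by (simp add: integral_unique mult.commute)
  qed
  finally have "((\<lambda>A. integral {0..2 * pi} (\<lambda>\<theta>. S (f (1 / A, \<theta>))) / (4 * pi)) \<longlongrightarrow> 2 * pi * moment M (emb j) / (4 * pi)) at_top"
    by (intro tendsto_divide tendsto_const) auto
  moreover have "\<forall>\<^sub>F A in at_top. integral {0..2 * pi} (\<lambda>\<theta>. S (f (1 / A, \<theta>))) / (4 * pi) = integral (ball 0 A) (\<lambda>x. x $ j * B3 M h x)"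
    using eventually_gt_at_top[of 0]
  proof eventually_elim
    case (elim A)
    have split: "r * (r * cos \<theta>) * poisson j (r * cos \<theta>) (r * sin \<theta>) 1 t =
      (t $ emb j * (\<xi> j r \<theta> t / (R j r \<theta> t * (R j r \<theta> t + w t)) + r / (R j r \<theta> t * (R j r \<theta> t + w t))
            - r * \<xi> j r \<theta> t * \<xi> j r \<theta> t * (2 * R j r \<theta> t + w t) / (R j r \<theta> t * (R j r \<theta> t * (R j r \<theta> t + w t))\<^sup>2))
        + (- cos \<theta> * w t / R j r \<theta> t + r * cos \<theta> * w t * \<xi> j r \<theta> t / R j r \<theta> t ^ 3)) +
      (t $ emb j * ((r - \<xi> j r \<theta> t) / (R j r \<theta> t * (R j r \<theta> t + w t))
            - r * \<eta> j \<theta> t * \<eta> j \<theta> t * (2 * R j r \<theta> t + w t) / (R j r \<theta> t * (R j r \<theta> t * (R j r \<theta> t + w t))\<^sup>2))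
        + (cos \<theta> * w t / R j r \<theta> t - r * sin \<theta> * w t * \<eta> j \<theta> t / R j r \<theta> t ^ 3))" for r \<theta> t
    proof -
      have comb: "T * a + b + (T * c + e) = T * (a + c) + (b + e)" for T a b c e :: real
        by (simp add: algebra_simps)
      show ?thesis
        unfolding comb zeroth_field_divergence first_field_divergence by (simp add: algebra_simps)
    qed
    have "integral (ball 0 A) (\<lambda>x. x $ j * B3 M h x) =
      integral {0..A} (\<lambda>r. integral {0..2 * pi} (\<lambda>\<theta>. S (\<lambda>t. r * (r * cos \<theta>) * poisson j (r * cos \<theta>) (r * sin \<theta>) 1 t))) / (4 * pi)"
      using ball_moment_polar[OF elim, of j 1] by (simp only: S_scale smooth3_poisson_polar power_one_right)
    also have "integral {0..A} (\<lambda>r. integral {0..2 * pi} (\<lambda>\<theta>. S (\<lambda>t. r * (r * cos \<theta>) * poisson j (r * cos \<theta>) (r * sin \<theta>) 1 t))) =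
      integral {0..2 * pi} (\<lambda>\<theta>. S (\<lambda>t. t $ emb j * (A * \<xi> j A \<theta> t / (R j A \<theta> t * (R j A \<theta> t + w t)))
        + - A * cos \<theta> * w t / R j A \<theta> t))"
    proof -
      have d1: "((\<lambda>r. t $ emb j * (r * \<xi> j r \<theta> t / (R j r \<theta> t * (R j r \<theta> t + w t))) + - r * cos \<theta> * w t / R j r \<theta> t) has_real_derivative
        (t $ emb j * (\<xi> j r \<theta> t / (R j r \<theta> t * (R j r \<theta> t + w t)) + r / (R j r \<theta> t * (R j r \<theta> t + w t))
            - r * \<xi> j r \<theta> t * \<xi> j r \<theta> t * (2 * R j r \<theta> t + w t) / (R j r \<theta> t * (R j r \<theta> t * (R j r \<theta> t + w t))\<^sup>2))
        + (- cos \<theta> * w t / R j r \<theta> t + r * cos \<theta> * w t * \<xi> j r \<theta> t / R j r \<theta> t ^ 3))) (at r)" for r \<theta> t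
        by (rule DERIV_add[OF DERIV_cmult[OF zeroth_field_radial_derivative] first_field_radial_derivative])
      have d2: "((\<lambda>\<theta>. t $ emb j * (\<eta> j \<theta> t / (R j r \<theta> t * (R j r \<theta> t + w t))) + sin \<theta> * w t / R j r \<theta> t) has_real_derivative
        (t $ emb j * ((r - \<xi> j r \<theta> t) / (R j r \<theta> t * (R j r \<theta> t + w t))
            - r * \<eta> j \<theta> t * \<eta> j \<theta> t * (2 * R j r \<theta> t + w t) / (R j r \<theta> t * (R j r \<theta> t * (R j r \<theta> t + w t))\<^sup>2))
        + (cos \<theta> * w t / R j r \<theta> t - r * sin \<theta> * w t * \<eta> j \<theta> t / R j r \<theta> t ^ 3))) (at \<theta>)" for r \<theta> t
        by (rule DERIV_add[OF DERIV_cmult[OF zeroth_field_angular_derivative] first_field_angular_derivative])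
      show ?thesis
      unfolding split
      proof (rule polar_divergence[where
         F = "\<lambda>y t. t $ emb j * (fst y * \<xi> j (fst y) (snd y) t / (R j (fst y) (snd y) t * (R j (fst y) (snd y) t + w t)))
           + - fst y * cos (snd y) * w t / R j (fst y) (snd y) t"
         and F' = "\<lambda>y t. t $ emb j * (\<xi> j (fst y) (snd y) t / (R j (fst y) (snd y) t * (R j (fst y) (snd y) t + w t)) + fst y / (R j (fst y) (snd y) t * (R j (fst y) (snd y) t + w t))
            - fst y * \<xi> j (fst y) (snd y) t * \<xi> j (fst y) (snd y) t * (2 * R j (fst y) (snd y) t + w t) / (R j (fst y) (snd y) t * (R j (fst y) (snd y) t * (R j (fst y) (snd y) t + w t))\<^sup>2))
            + (- cos (snd y) * w t / R j (fst y) (snd y) t + fst y * cos (snd y) * w t * \<xi> j (fst y) (snd y) t / R j (fst y) (snd y) t ^ 3)"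
         and G = "\<lambda>y t. t $ emb j * (\<eta> j (snd y) t / (R j (fst y) (snd y) t * (R j (fst y) (snd y) t + w t)))
            + sin (snd y) * w t / R j (fst y) (snd y) t"
         and G' = "\<lambda>y t. t $ emb j * ((fst y - \<xi> j (fst y) (snd y) t) / (R j (fst y) (snd y) t * (R j (fst y) (snd y) t + w t))
            - fst y * \<eta> j (snd y) t * \<eta> j (snd y) t * (2 * R j (fst y) (snd y) t + w t) / (R j (fst y) (snd y) t * (R j (fst y) (snd y) t * (R j (fst y) (snd y) t + w t))\<^sup>2))
            + (cos (snd y) * w t / R j (fst y) (snd y) t - fst y * sin (snd y) * w t * \<eta> j (snd y) t / R j (fst y) (snd y) t ^ 3)",
         unfolded fst_conv snd_conv], goal_cases)
        case 1 show ?case using elim by simp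
      next
        case 2 show ?case by (intro smooth_family_intros continuous_intros) simp_all
      next
        case 3 show ?case by (intro smooth_family_intros continuous_intros) simp_all
      next
        case 4 show ?case by (intro smooth_family_intros continuous_intros) simp_all
      next
        case 5 show ?case by (intro smooth_family_intros continuous_intros) simp_all
      next
        case 6 show ?case by (rule d1)
      next
        case 7 show ?case by (rule d2)
      qed (simp_all add: periodic)
    qed
    also have "\<dots> = integral {0..2 * pi} (\<lambda>\<theta>. S (f (1 / A, \<theta>)))"
      unfolding zeroth_field_at_infinity[OF elim] first_field_at_infinity[OF elim] f_def by simp
    finally show ?case by simp
  qed
  ultimately show ?thesis by (simp add: Lim_transform_eventually)
qed

end

section \<open>The expansion at infinity\<close>

text \<open>Taylor expansion of (1 + z)^(-3/2) with an exact rational remainder in place of an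
  estimate. With y = sqrt (1 + z) and z = (y - 1)(y + 1), the difference of y^3 times the Taylor
  polynomial and 1 is a polynomial in y divisible by (y - 1)^5; the numerator of the remainder is
  the quotient. Smoothness of the remainder is then immediate, with no bounds on its
  derivatives.\<close>

lemma inverse_cube_expansion:
  fixes y z :: real
  assumes "y > 0" "y\<^sup>2 = 1 + z"
  shows "1 / y ^ 3 = 1 - 3 / 2 * z + 15 / 8 * z ^ 2 - 35 / 16 * z ^ 3 + 315 / 128 * z ^ 4 -
    z ^ 5 * ((128 + 640 * y + 1920 * y ^ 2 + 3325 * y ^ 3 + 3185 * y ^ 4 + 1575 * y ^ 5 + 315 * y ^ 6) / 128
      / (y ^ 3 * (1 + y) ^ 5))"
proof -
  have z: "z = (y - 1) * (1 + y)" using assms(2) by (simp add: algebra_simps power2_eq_square)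
  have pos: "y ^ 3 \<noteq> 0" "(1 + y) ^ 5 \<noteq> 0" using assms(1) by auto
  let ?n = "(128 + 640 * y + 1920 * y ^ 2 + 3325 * y ^ 3 + 3185 * y ^ 4 + 1575 * y ^ 5 + 315 * y ^ 6) / 128"
  have "z ^ 5 * (?n / (y ^ 3 * (1 + y) ^ 5)) = (y - 1) ^ 5 * ?n / y ^ 3"
    unfolding z power_mult_distrib using pos by (simp add: field_simps)
  moreover have "1 = y ^ 3 * (1 - 3 / 2 * z + 15 / 8 * z ^ 2 - 35 / 16 * z ^ 3 + 315 / 128 * z ^ 4) - (y - 1) ^ 5 * ?n"
    unfolding z by (simp add: field_simps) algebra
  moreover have "1 / y ^ 3 = P - X" if "X = Y / y ^ 3" "1 = y ^ 3 * P - Y" for P X Y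
    using pos(1) that(1) by (subst that(2)) (simp add: diff_divide_distrib)
  ultimately show ?thesis by blast
qed

text \<open>Coefficient, exponents of the two horizontal coordinates and exponent of \<open>t\<^sub>1\<^sup>2 + t\<^sub>2\<^sup>2 + w\<^sup>2\<close> of
  the terms of order \<open>k\<close> of \<open>(1 - 2 \<rho> s + \<rho>\<^sup>2 N)\<^bsup>-3/2\<^esup>\<close> with \<open>s = t\<^sub>1 cos \<theta> + t\<^sub>2 sin \<theta>\<close>.\<close>

definition expansion_terms :: "nat \<Rightarrow> (real \<times> nat \<times> nat \<times> nat) list" where
  "expansion_terms k =
    (if k = 0 then [(1, 0, 0, 0)]
     else if k = 1 then [(3, 1, 0, 0), (3, 0, 1, 0)]
     else if k = 2 then [(15/2, 2, 0, 0), (15, 1, 1, 0), (15/2, 0, 2, 0), (-3/2, 0, 0, 1)]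
     else if k = 3 then [(35/2, 3, 0, 0), (105/2, 2, 1, 0), (105/2, 1, 2, 0), (35/2, 0, 3, 0),
       (-15/2, 1, 0, 1), (-15/2, 0, 1, 1)]
     else if k = 4 then [(315/8, 4, 0, 0), (315/2, 3, 1, 0), (945/4, 2, 2, 0), (315/2, 1, 3, 0), (315/8, 0, 4, 0),
       (-105/4, 2, 0, 1), (-105/2, 1, 1, 1), (-105/4, 0, 2, 1), (15/8, 0, 0, 2)]
     else [])"

text \<open>Regroups the truncated series by powers of \<rho>. The argument is \<rho> u with u of
  degree 1 in \<rho>, so its powers up to the second stay within order 4 and only the third and
  fourth overflow into the factor of \<rho>^5.\<close>

lemma expansion_identity:
  fixes s N \<rho> :: real
  defines "u \<equiv> \<rho> * N - 2 * s"
  shows "1 - 3 / 2 * (\<rho> * u) + 15 / 8 * (\<rho> * u) ^ 2 - 35 / 16 * (\<rho> * u) ^ 3 + 315 / 128 * (\<rho> * u) ^ 4 =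
    1 + \<rho> * (3 * s) + \<rho> ^ 2 * (15 / 2 * s ^ 2 - 3 / 2 * N) + \<rho> ^ 3 * (35 / 2 * s ^ 3 - 15 / 2 * s * N)
     + \<rho> ^ 4 * (315 / 8 * s ^ 4 - 105 / 4 * s ^ 2 * N + 15 / 8 * N ^ 2)
     + \<rho> ^ 5 * (- 35 / 16 * (\<rho> * N ^ 3 - 6 * N ^ 2 * s)
         + 315 / 128 * (\<rho> ^ 3 * N ^ 4 - 8 * \<rho> ^ 2 * N ^ 3 * s + 24 * \<rho> * N ^ 2 * s ^ 2 - 32 * N * s ^ 3))"
  unfolding u_def by (simp add: field_simps) algebra

text \<open>The right sides are the homogenised Gegenbauer polynomials of index 3/2. Expanding the
  powers of \<sigma> separates the dependence on t from that on \<theta>, so the distribution can be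
  applied term by term.\<close>

lemma expansion_terms_sum:
  fixes x y c s N :: real
  defines "\<sigma> \<equiv> x * c + y * s"
  shows "(\<Sum>(\<kappa>, a, b, e)\<leftarrow>expansion_terms 0. \<kappa> * (x ^ a * y ^ b * N ^ e) * (c ^ a * s ^ b)) = 1"
    and "(\<Sum>(\<kappa>, a, b, e)\<leftarrow>expansion_terms 1. \<kappa> * (x ^ a * y ^ b * N ^ e) * (c ^ a * s ^ b)) = 3 * \<sigma>"
    and "(\<Sum>(\<kappa>, a, b, e)\<leftarrow>expansion_terms 2. \<kappa> * (x ^ a * y ^ b * N ^ e) * (c ^ a * s ^ b)) = 15 / 2 * \<sigma> ^ 2 - 3 / 2 * N"
    and "(\<Sum>(\<kappa>, a, b, e)\<leftarrow>expansion_terms 3. \<kappa> * (x ^ a * y ^ b * N ^ e) * (c ^ a * s ^ b)) = 35 / 2 * \<sigma> ^ 3 - 15 / 2 * \<sigma> * N"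
    and "(\<Sum>(\<kappa>, a, b, e)\<leftarrow>expansion_terms 4. \<kappa> * (x ^ a * y ^ b * N ^ e) * (c ^ a * s ^ b)) =
      315 / 8 * \<sigma> ^ 4 - 105 / 4 * \<sigma> ^ 2 * N + 15 / 8 * N ^ 2"
  unfolding expansion_terms_def \<sigma>_def by (simp_all add: field_simps) algebra+

section \<open>Integrals of products of cosine and sine powers\<close>

definition trig_moment :: "nat \<Rightarrow> nat \<Rightarrow> real" where
  "trig_moment a b = integral {0..2 * pi} (\<lambda>\<theta>. cos \<theta> ^ a * sin \<theta> ^ b)"

lemma trig_moment_integral:
  "((\<lambda>\<theta>. cos \<theta> ^ a * sin \<theta> ^ b) has_integral trig_moment a b) {0..2 * pi}"
  unfolding trig_moment_def
  by (intro integrable_integral integrable_continuous_real continuous_intros)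

lemma trig_moment_sin_sin: "trig_moment a (b + 2) = trig_moment a b - trig_moment (a + 2) b"
proof -
  have "(\<lambda>\<theta>::real. cos \<theta> ^ a * sin \<theta> ^ (b + 2)) = (\<lambda>\<theta>. cos \<theta> ^ a * sin \<theta> ^ b - cos \<theta> ^ (a + 2) * sin \<theta> ^ b)"
  proof
    fix \<theta> :: real
    have "cos \<theta> ^ a * sin \<theta> ^ (b + 2) = cos \<theta> ^ a * sin \<theta> ^ b * (sin \<theta>)\<^sup>2"
      by (simp only: power_add mult.assoc)
    also have "\<dots> = cos \<theta> ^ a * sin \<theta> ^ b * (1 - (cos \<theta>)\<^sup>2)" by (simp only: sin_squared_eq)
    also have "\<dots> = cos \<theta> ^ a * sin \<theta> ^ b - cos \<theta> ^ (a + 2) * sin \<theta> ^ b"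
      by (simp only: power_add right_diff_distrib mult_1_right mult.commute mult.left_commute)
    finally show "cos \<theta> ^ a * sin \<theta> ^ (b + 2) = cos \<theta> ^ a * sin \<theta> ^ b - cos \<theta> ^ (a + 2) * sin \<theta> ^ b" .
  qed
  then show ?thesis
    using has_integral_unique[OF trig_moment_integral[of a "b + 2"]]
      has_integral_diff[OF trig_moment_integral[of a b] trig_moment_integral[of "a + 2" b]] by simp
qed

lemma trig_moment_1: "trig_moment a 1 = 0"
proof -
  have "((\<lambda>\<theta>. cos \<theta> ^ a * sin \<theta> ^ 1) has_integral (- (cos (2 * pi) ^ (a + 1) / (a + 1)) - (- (cos 0 ^ (a + 1) / (a + 1))))) {0..2 * pi}"
  proof (rule fundamental_theorem_of_calculus)
    fix x :: real
    have "((\<lambda>\<theta>. - (cos \<theta> ^ (a + 1) / (a + 1))) has_real_derivative cos x ^ a * sin x ^ 1) (at x)"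
      by (rule DERIV_cong[OF DERIV_minus[OF DERIV_cdivide[OF DERIV_power[OF DERIV_cos, of "a + 1"]]]])
         (simp del: of_nat_add)
    then show "((\<lambda>\<theta>. - (cos \<theta> ^ (a + 1) / (a + 1))) has_vector_derivative cos x ^ a * sin x ^ 1) (at x within {0..2 * pi})"
      by (auto simp: has_real_derivative_iff_has_vector_derivative intro: has_vector_derivative_at_within)
  qed simp
  then show ?thesis
    using trig_moment_integral[of a 1] by (simp add: has_integral_unique)
qed

lemma trig_moment_odd_sin: "odd b \<Longrightarrow> trig_moment a b = 0"
proof (induction b arbitrary: a rule: induct_nat_012)
  case (ge2 n)
  then show ?case using trig_moment_sin_sin[of a n] by simp
qed (use trig_moment_1 in auto)

text \<open>The derivative of cos^(a+1) sin integrates to 0 over a period; writing sin^2 as 1 -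
  cos^2 turns this into the recursion.\<close>

lemma trig_moment_cos_cos: "trig_moment (a + 2) 0 = (a + 1) / (a + 2) * trig_moment a 0"
proof -
  have "((\<lambda>\<theta>. cos \<theta> ^ (a + 2) * sin \<theta> ^ 0 - (a + 1) * (cos \<theta> ^ a * sin \<theta> ^ 2)) has_integral
      (cos (2 * pi) ^ (a + 1) * sin (2 * pi) - cos 0 ^ (a + 1) * sin 0)) {0..2 * pi}"
  proof (rule fundamental_theorem_of_calculus)
    fix x :: real
    have "((\<lambda>\<theta>. cos \<theta> ^ (a + 1) * sin \<theta>) has_real_derivative cos x ^ (a + 2) * sin x ^ 0 - (a + 1) * (cos x ^ a * sin x ^ 2)) (at x)"
      by (rule DERIV_cong[OF DERIV_mult[OF DERIV_power[OF DERIV_cos, of "a + 1"] DERIV_sin]])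
         (simp add: algebra_simps power2_eq_square)
    then show "((\<lambda>\<theta>. cos \<theta> ^ (a + 1) * sin \<theta>) has_vector_derivative cos x ^ (a + 2) * sin x ^ 0 - (a + 1) * (cos x ^ a * sin x ^ 2)) (at x within {0..2 * pi})"
      by (auto simp: has_real_derivative_iff_has_vector_derivative intro: has_vector_derivative_at_within)
  qed simp
  moreover have "((\<lambda>\<theta>. cos \<theta> ^ (a + 2) * sin \<theta> ^ 0 - (a + 1) * (cos \<theta> ^ a * sin \<theta> ^ 2)) has_integral
      (trig_moment (a + 2) 0 - (a + 1) * trig_moment a 2)) {0..2 * pi}"
    by (intro has_integral_diff has_integral_mult_right trig_moment_integral)
  ultimately have "trig_moment (a + 2) 0 - (a + 1) * trig_moment a 2 = cos (2 * pi) ^ (a + 1) * sin (2 * pi) - cos 0 ^ (a + 1) * sin 0"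
    by (rule has_integral_unique[rotated])
  then have "trig_moment (a + 2) 0 = (a + 1) * trig_moment a 2" by simp
  moreover have "trig_moment a 2 = trig_moment a 0 - trig_moment (a + 2) 0"
    using trig_moment_sin_sin[of a 0] by (simp only: add_0)
  ultimately have "(real a + 2) * trig_moment (a + 2) 0 = (real a + 1) * trig_moment a 0"
    by (simp only: of_nat_add of_nat_1) algebra
  then show ?thesis by (simp add: field_simps)
qed

lemma trig_moment_0: "trig_moment 0 0 = 2 * pi"
  by (simp add: trig_moment_def)

lemma trig_moment_odd_cos: "odd a \<Longrightarrow> trig_moment a b = 0"
proof (induction b arbitrary: a rule: induct_nat_012)
  case 0
  have "((\<lambda>\<theta>. cos \<theta> ^ 1 * sin \<theta> ^ 0) has_integral sin (2 * pi) - sin 0) {0..2 * pi}"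
    by (rule fundamental_theorem_of_calculus)
       (auto intro!: derivative_eq_intros simp flip: has_real_derivative_iff_has_vector_derivative)
  from has_integral_unique[OF trig_moment_integral this] have "trig_moment 1 0 = 0" by simp
  with 0 show ?case
    by (induction a rule: induct_nat_012) (use trig_moment_cos_cos in auto)
next
  case (ge2 n)
  then show ?case using trig_moment_sin_sin[of a n] by simp
qed (use trig_moment_1 in auto)

section \<open>The expansion of the Poisson kernel under the pairing\<close>

context magnetisation
begin

text \<open>These numbers are the unknown data of the magnetisation in the expansion.
  \<open>multipole j 0 0 0\<close> is - m_3; the weights of the theorem have to eliminate the
  others.\<close>

definition multipole :: "2 \<Rightarrow> nat \<Rightarrow> nat \<Rightarrow> nat \<Rightarrow> real" where
  "multipole j a b e = S (\<lambda>t. w t * (t $ emb j ^ a * t $ emb (j + 1) ^ b * ((t $ emb j)\<^sup>2 + (t $ emb (j + 1))\<^sup>2 + (w t)\<^sup>2) ^ e))"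

text \<open>All contributions beyond order 4, divided by \<rho>^5: the overflow terms of
  \<open>expansion_identity\<close> and the exact tail of \<open>inverse_cube_expansion\<close>. A
  closed expression with positive denominators, it is smooth up to and including \<rho> = 0.\<close>

definition remainder :: "2 \<Rightarrow> real \<Rightarrow> real \<Rightarrow> real^3 \<Rightarrow> real" where
  "remainder j \<rho> \<theta> t =
    (let s = t $ emb j * cos \<theta> + t $ emb (j + 1) * sin \<theta>; N = (t $ emb j)\<^sup>2 + (t $ emb (j + 1))\<^sup>2 + (w t)\<^sup>2;
       u = \<rho> * N - 2 * s; y = sqrt (dist2 j (cos \<theta>) (sin \<theta>) \<rho> t) in
     w t * (- 35 / 16 * (\<rho> * N ^ 3 - 6 * N ^ 2 * s)
         + 315 / 128 * (\<rho> ^ 3 * N ^ 4 - 8 * \<rho> ^ 2 * N ^ 3 * s + 24 * \<rho> * N ^ 2 * s ^ 2 - 32 * N * s ^ 3)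
       - u ^ 5 * ((128 + 640 * y + 1920 * y ^ 2 + 3325 * y ^ 3 + 3185 * y ^ 4 + 1575 * y ^ 5 + 315 * y ^ 6) / 128
      / (y ^ 3 * (1 + y) ^ 5))))"

lemma smooth_family_remainder:
  fixes Y :: "(real \<times> real) set"
  shows "smooth_family Y (\<lambda>y t. remainder j (fst y) (snd y) t)"
proof -
  have "1 + sqrt (dist2 j (cos \<theta>) (sin \<theta>) \<rho> t) \<noteq> 0" for \<rho> \<theta> t
  proof -
    have "1 + sqrt (dist2 j (cos \<theta>) (sin \<theta>) \<rho> t) > 0"
      using dist2_circle_pos[of j \<theta> \<rho> t] by (intro add_pos_pos) auto
    then show ?thesis by simp
  qed
  then show ?thesis
    unfolding remainder_def Let_def
    by (intro smooth_family_intros continuous_intros) (simp_all add: dist2_circle_pos)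
qed

lemma poisson_expansion:
  "poisson j (cos \<theta>) (sin \<theta>) \<rho> t = (\<Sum>k<5. \<rho> ^ k * (\<Sum>(\<kappa>, a, b, e)\<leftarrow>expansion_terms k. \<kappa> * (cos \<theta> ^ a * sin \<theta> ^ b) *
      (w t * (t $ emb j ^ a * t $ emb (j + 1) ^ b * ((t $ emb j)\<^sup>2 + (t $ emb (j + 1))\<^sup>2 + (w t)\<^sup>2) ^ e))))
    + \<rho> ^ 5 * remainder j \<rho> \<theta> t"
proof -
  define x y v where "x = t $ emb j" and "y = t $ emb (j + 1)" and "v = w t"
  define N where "N = x\<^sup>2 + y\<^sup>2 + v\<^sup>2"
  define s where "s = x * cos \<theta> + y * sin \<theta>"
  define u where "u = \<rho> * N - 2 * s"
  define R where "R = sqrt (dist2 j (cos \<theta>) (sin \<theta>) \<rho> t)"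
  have R: "R > 0" using dist2_circle_pos by (simp add: R_def)
  \<comment> \<open>Cosine and sine become variables bound only by the circle equation, which makes
    this a polynomial identity.\<close>
  have "(C - \<rho> * x)\<^sup>2 + (T - \<rho> * y)\<^sup>2 + (\<rho> * v)\<^sup>2 = 1 + \<rho> * (\<rho> * N - 2 * (x * C + y * T))" if "C\<^sup>2 + T\<^sup>2 = 1" for C T
    using that unfolding N_def by algebra
  from this[of "cos \<theta>" "sin \<theta>"] have "R\<^sup>2 = 1 + \<rho> * u"
    using dist2_circle_pos[of j \<theta> \<rho> t] by (simp add: R_def dist2_def u_def s_def x_def y_def v_def)
  from inverse_cube_expansion[OF R this]
  have e: "1 / R ^ 3 = 1 + \<rho> * (3 * s) + \<rho> ^ 2 * (15 / 2 * s ^ 2 - 3 / 2 * N) + \<rho> ^ 3 * (35 / 2 * s ^ 3 - 15 / 2 * s * N)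
     + \<rho> ^ 4 * (315 / 8 * s ^ 4 - 105 / 4 * s ^ 2 * N + 15 / 8 * N ^ 2)
     + \<rho> ^ 5 * (- 35 / 16 * (\<rho> * N ^ 3 - 6 * N ^ 2 * s)
         + 315 / 128 * (\<rho> ^ 3 * N ^ 4 - 8 * \<rho> ^ 2 * N ^ 3 * s + 24 * \<rho> * N ^ 2 * s ^ 2 - 32 * N * s ^ 3))
     - \<rho> ^ 5 * (u ^ 5 * ((128 + 640 * R + 1920 * R ^ 2 + 3325 * R ^ 3 + 3185 * R ^ 4 + 1575 * R ^ 5 + 315 * R ^ 6) / 128
      / (R ^ 3 * (1 + R) ^ 5)))"
    unfolding expansion_identity[of \<rho> N s, folded u_def] power_mult_distrib[of \<rho> u 5] by (simp only: mult.assoc)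
  have v: "(\<Sum>(\<kappa>, a, b, e)\<leftarrow>L. \<kappa> * (cos \<theta> ^ a * sin \<theta> ^ b) * (v * (x ^ a * y ^ b * N ^ e))) =
    v * (\<Sum>(\<kappa>, a, b, e)\<leftarrow>L. \<kappa> * (x ^ a * y ^ b * N ^ e) * (cos \<theta> ^ a * sin \<theta> ^ b))" for L :: "(real \<times> nat \<times> nat \<times> nat) list"
    by (induction L) (auto simp: algebra_simps)
  have "poisson j (cos \<theta>) (sin \<theta>) \<rho> t = v * (1 / R ^ 3)"
    by (simp add: poisson_def R_def v_def)
  also have "\<dots> = (\<Sum>k<5. \<rho> ^ k * (v * (\<Sum>(\<kappa>, a, b, e)\<leftarrow>expansion_terms k. \<kappa> * (x ^ a * y ^ b * N ^ e) * (cos \<theta> ^ a * sin \<theta> ^ b))))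
     + \<rho> ^ 5 * remainder j \<rho> \<theta> t"
  proof -
    have five: "(\<Sum>k<5. \<rho> ^ k * (v * f k)) = v * f 0 + \<rho> * (v * f 1) + \<rho> ^ 2 * (v * f 2) + \<rho> ^ 3 * (v * f 3) + \<rho> ^ 4 * (v * f 4)"
      for f :: "nat \<Rightarrow> real"
      by (simp add: eval_nat_numeral)
    have comb: "v * (1 + \<rho> * P1 + \<rho> ^ 2 * P2 + \<rho> ^ 3 * P3 + \<rho> ^ 4 * P4 + \<rho> ^ 5 * E - \<rho> ^ 5 * X) =
      v * 1 + \<rho> * (v * P1) + \<rho> ^ 2 * (v * P2) + \<rho> ^ 3 * (v * P3) + \<rho> ^ 4 * (v * P4) + \<rho> ^ 5 * (v * (E - X))" for P1 P2 P3 P4 E X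
      by (simp add: algebra_simps)
    show ?thesis
      unfolding e five remainder_def Let_def x_def[symmetric] y_def[symmetric] v_def[symmetric]
        R_def[symmetric] N_def[symmetric] s_def[symmetric] u_def[symmetric]
        expansion_terms_sum[where x = x and y = y and c = "cos \<theta>" and s = "sin \<theta>" and N = N, folded s_def]
      by (rule comb)
  qed
  finally show ?thesis
    unfolding v[symmetric] unfolding N_def x_def y_def v_def .
qed

lemma S_sum_list:
  assumes "\<And>c f. (c, f) \<in> set cfs \<Longrightarrow> smooth3_on UNIV f"
  shows "S (\<lambda>t. \<Sum>(c, f)\<leftarrow>cfs. c * f t) = (\<Sum>(c, f)\<leftarrow>cfs. c * S f) \<and> smooth3_on UNIV (\<lambda>t. \<Sum>(c, f)\<leftarrow>cfs. c * f t)"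
  using assms
proof (induction cfs)
  case (Cons cf cfs)
  obtain c f where cf: "cf = (c, f)" by (cases cf)
  have s: "smooth3_on UNIV f" "smooth3_on UNIV (\<lambda>t. c * f t)"
    using Cons.prems[of c f] cf by (auto simp: smooth3_iff intro!: smooth_family_intros continuous_on_const)
  moreover have IH: "S (\<lambda>t. \<Sum>(c, f)\<leftarrow>cfs. c * f t) = (\<Sum>(c, f)\<leftarrow>cfs. c * S f)" "smooth3_on UNIV (\<lambda>t. \<Sum>(c, f)\<leftarrow>cfs. c * f t)"
    using Cons by auto
  moreover have "smooth3_on UNIV (\<lambda>t. c * f t + (\<Sum>(c, f)\<leftarrow>cfs. c * f t))"
    using s(2) IH(2) unfolding smooth3_iff by (rule smooth_family_add)
  ultimately show ?case by (simp add: cf S_add S_scale)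
qed (simp add: S_const smooth3_const)

lemma S_poisson_expansion:
  "S (poisson j (cos \<theta>) (sin \<theta>) \<rho>) =
    (\<Sum>k<5. \<rho> ^ k * (\<Sum>(\<kappa>, a, b, e)\<leftarrow>expansion_terms k. \<kappa> * multipole j a b e * (cos \<theta> ^ a * sin \<theta> ^ b)))
    + \<rho> ^ 5 * S (remainder j \<rho> \<theta>)"
proof -
  define f where "f a b e t = w t * (t $ emb j ^ a * t $ emb (j + 1) ^ b * ((t $ emb j)\<^sup>2 + (t $ emb (j + 1))\<^sup>2 + (w t)\<^sup>2) ^ e)" for a b e t
  have sf: "smooth3_on UNIV (f a b e)" for a b e
    unfolding f_def smooth3_iff by (intro smooth_family_intros)
  have Sf: "multipole j a b e = S (f a b e)" for a b e
    by (simp add: multipole_def f_def[abs_def])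
  define g where "g k t = (\<Sum>(\<kappa>, a, b, e)\<leftarrow>expansion_terms k. \<kappa> * (cos \<theta> ^ a * sin \<theta> ^ b) * f a b e t)" for k t
  have g: "S (g k) = (\<Sum>(\<kappa>, a, b, e)\<leftarrow>expansion_terms k. \<kappa> * multipole j a b e * (cos \<theta> ^ a * sin \<theta> ^ b)) \<and> smooth3_on UNIV (g k)" for k
    using S_sum_list[of "map (\<lambda>(\<kappa>, a, b, e). (\<kappa> * (cos \<theta> ^ a * sin \<theta> ^ b), f a b e)) (expansion_terms k)"] sf
    by (auto simp: g_def[abs_def] comp_def case_prod_unfold Sf mult_ac)
  have r: "smooth3_on UNIV (remainder j \<rho> \<theta>)"
    using smooth_family_reindex[OF smooth_family_remainder[of UNIV j], of "{0::real}" "\<lambda>_. (\<rho>, \<theta>)"] by (simp add: smooth3_iff)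
  have "poisson j (cos \<theta>) (sin \<theta>) \<rho> = (\<lambda>t. \<Sum>(c, f)\<leftarrow>map (\<lambda>k. (\<rho> ^ k, g k)) [0..<5] @ [(\<rho> ^ 5, remainder j \<rho> \<theta>)]. c * f t)"
    by (simp add: fun_eq_iff poisson_expansion f_def g_def comp_def interv_sum_list_conv_sum_set_nat atLeast0LessThan del: upt_rec_numeral)
  moreover have "S \<dots> = (\<Sum>(c, f)\<leftarrow>map (\<lambda>k. (\<rho> ^ k, g k)) [0..<5] @ [(\<rho> ^ 5, remainder j \<rho> \<theta>)]. c * S f)"
    by (rule S_sum_list[THEN conjunct1]) (use g r in auto)
  ultimately show ?thesis by (simp add: g comp_def interv_sum_list_conv_sum_set_nat atLeast0LessThan del: upt_rec_numeral)
qed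

end

section \<open>Integrating powers of the radius\<close>

lemma power_quotient_derivative:
  fixes r :: real
  assumes "r > 0"
  shows "((\<lambda>r. r ^ q / r ^ (k + 1)) has_real_derivative (real q - 1 - real k) * (r ^ q / r ^ (k + 2))) (at r)"
proof -
  have "((\<lambda>r. r ^ q / r ^ (k + 1)) has_real_derivative
    (real q * r ^ (q - 1) * r ^ (k + 1) - r ^ q * (real (k + 1) * r ^ k)) / (r ^ (k + 1) * r ^ (k + 1))) (at r)"
    using assms by (auto intro!: derivative_eq_intros simp del: of_nat_add power_Suc)
  \<comment> \<open>For q = 0 the truncated exponent q - 1 is wrong, but its coefficient
    vanishes.\<close>
  moreover have "real q * r ^ (q - 1) * r = real q * r ^ q"
    by (cases q) auto
  then have "(real q * r ^ (q - 1) * r ^ (k + 1) - r ^ q * (real (k + 1) * r ^ k)) / (r ^ (k + 1) * r ^ (k + 1)) =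
    (real q - 1 - real k) * (r ^ q / r ^ (k + 2))"
    using assms by (simp add: divide_simps) (simp add: algebra_simps)
  ultimately show ?thesis by simp
qed

text \<open>Quotients of natural powers stand for powers with exponent of either sign; the excluded
  case q = k + 1 is the one with a logarithm.\<close>

lemma power_quotient_integral:
  fixes A B :: real
  assumes "1 \<le> A" "A \<le> B" "q \<noteq> k + 1"
  shows "((\<lambda>r. r ^ q / r ^ (k + 2)) has_integral
    (B ^ q / B ^ (k + 1) - A ^ q / A ^ (k + 1)) / (real q - 1 - real k)) {A..B}"
proof -
  have "((\<lambda>r. (real q - 1 - real k) * (r ^ q / r ^ (k + 2))) has_integral
    (B ^ q / B ^ (k + 1) - A ^ q / A ^ (k + 1))) {A..B}"
  proof (rule fundamental_theorem_of_calculus)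
    fix r assume "r \<in> {A..B}"
    then have "((\<lambda>r. r ^ q / r ^ (k + 1)) has_real_derivative (real q - 1 - real k) * (r ^ q / r ^ (k + 2))) (at r within {A..B})"
      using assms(1) by (intro has_field_derivative_at_within[OF power_quotient_derivative]) auto
    then show "((\<lambda>r. r ^ q / r ^ (k + 1)) has_vector_derivative (real q - 1 - real k) * (r ^ q / r ^ (k + 2))) (at r within {A..B})"
      by (simp only: has_real_derivative_iff_has_vector_derivative)
  qed (use assms in auto)
  from has_integral_divide[OF this, of "real q - 1 - real k"] assms(3) show ?thesis by simp
qed

lemma power_quotient_antimono:
  fixes r :: real
  assumes "r \<ge> 1" "n \<le> k"
  shows "r ^ q / r ^ k \<le> r ^ q / r ^ n"
  using assms by (intro divide_left_mono power_increasing) auto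

text \<open>If \<open>J\<close> oscillates less than \<open>g\<close> decreases, then \<open>J + g\<close> decreases and \<open>J - g\<close> increases; the
  infimum of \<open>J + g\<close> lies between them.\<close>

lemma limit_from_oscillation:
  fixes J g :: "real \<Rightarrow> real"
  assumes osc: "\<And>A B. 1 \<le> A \<Longrightarrow> A \<le> B \<Longrightarrow> \<bar>J B - J A\<bar> \<le> g A - g B"
    and g: "\<And>A. 1 \<le> A \<Longrightarrow> g A \<ge> 0"
  obtains Z where "\<And>A. 1 \<le> A \<Longrightarrow> \<bar>J A - Z\<bar> \<le> g A"
proof -
  define Z where "Z = (INF A\<in>{1..}. J A + g A)"
  have *: "J A - g A \<le> J B + g B" if "1 \<le> A" "1 \<le> B" for A B
    using osc[of A B] osc[of B A] g[OF that(1)] g[OF that(2)] that by (cases "A \<le> B") auto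
  have "Z \<le> J A + g A" if "1 \<le> A" for A
    unfolding Z_def using *[of 1] that by (intro cINF_lower) (auto intro!: bdd_belowI2)
  moreover have "J A - g A \<le> Z" if "1 \<le> A" for A
    unfolding Z_def using * that by (intro cINF_greatest) auto
  ultimately show ?thesis by (intro that[of Z]) (auto simp: abs_le_iff algebra_simps)
qed

text \<open>\<open>Z\<close> collects everything that does not depend on A: the integral over
  [0, 1], the lower endpoints of the explicit powers, and the limit of the integrated error if that
  converges. The last two hypotheses keep logarithms out of the error and of the main terms.\<close>

lemma integral_power_expansion:
  fixes \<Phi> :: "real \<Rightarrow> real"
  assumes cont: "continuous_on {0..} \<Phi>"
    and bound: "\<And>r. r \<ge> 1 \<Longrightarrow> \<bar>\<Phi> r - (\<Sum>k<n. \<beta> k * (r ^ q / r ^ (k + 2)))\<bar> \<le> C * (r ^ q / r ^ (n + 2))"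
    and qn: "q \<noteq> n + 1" and \<beta>: "\<And>k. k < n \<Longrightarrow> q = k + 1 \<Longrightarrow> \<beta> k = 0"
  obtains Z C' where "\<And>A. A \<ge> 1 \<Longrightarrow>
    \<bar>integral {0..A} \<Phi> - (Z + (\<Sum>k<n. \<beta> k / (real q - 1 - real k) * (A ^ q / A ^ (k + 1))))\<bar> \<le> C' * (A ^ q / A ^ (n + 1))"
proof -
  define e where "e r = \<Phi> r - (\<Sum>k<n. \<beta> k * (r ^ q / r ^ (k + 2)))" for r
  define J where "J A = integral {1..A} e" for A
  define H where "H A = A ^ q / A ^ (n + 1)" for A :: real
  define c where "c = C / (real q - 1 - real n)"
  have C: "C \<ge> 0" using bound[of 1] by simp
  have H: "H A \<ge> 0" if "1 \<le> A" for A using that by (simp add: H_def)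
  have ce: "continuous_on {1..A} e" for A
    unfolding e_def by (intro continuous_intros continuous_on_subset[OF cont]) auto
  have diff: "\<bar>J B - J A\<bar> \<le> c * (H B - H A)" if AB: "1 \<le> A" "A \<le> B" for A B
  proof -
    have "J A + integral {A..B} e = J B"
      unfolding J_def using AB ce by (intro Henstock_Kurzweil_Integration.integral_combine integrable_continuous_real) auto
    moreover have "norm (integral {A..B} e) \<le> integral {A..B} (\<lambda>r. C * (r ^ q / r ^ (n + 2)))"
    proof (rule integral_norm_bound_integral)
      show "e integrable_on {A..B}"
        using AB by (intro integrable_continuous_real continuous_on_subset[OF ce[of B]]) auto
      show "(\<lambda>r. C * (r ^ q / r ^ (n + 2))) integrable_on {A..B}"
        using AB by (intro integrable_continuous_real continuous_intros) auto
      show "norm (e r) \<le> C * (r ^ q / r ^ (n + 2))" if "r \<in> {A..B}" for r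
        using bound[of r] that AB by (simp add: e_def)
    qed
    moreover have "integral {A..B} (\<lambda>r. C * (r ^ q / r ^ (n + 2))) = c * (H B - H A)"
      using has_integral_mult_right[OF power_quotient_integral[OF AB qn], of C]
      by (simp add: integral_unique c_def H_def)
    ultimately show ?thesis by simp
  qed
  obtain Z where Z: "\<And>A. 1 \<le> A \<Longrightarrow> \<bar>J A - Z\<bar> \<le> \<bar>c\<bar> * H A"
  proof (cases "q > n + 1")
    case True
    then have c: "c \<ge> 0" using C by (simp add: c_def)
    show ?thesis
    proof (rule that)
      fix A :: real assume A: "1 \<le> A"
      have "J 1 = 0" by (simp add: J_def)
      then show "\<bar>J A - 0\<bar> \<le> \<bar>c\<bar> * H A"
        using diff[of 1 A] A c mult_nonneg_nonneg[OF c H[of 1]] by (simp add: algebra_simps)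
    qed
  next
    case False
    then have c: "c \<le> 0" using C qn by (simp add: c_def divide_nonneg_neg)
    show ?thesis
    proof (rule limit_from_oscillation[of J "\<lambda>A. \<bar>c\<bar> * H A"])
      show "\<bar>J B - J A\<bar> \<le> \<bar>c\<bar> * H A - \<bar>c\<bar> * H B" if "1 \<le> A" "A \<le> B" for A B
        using diff[OF that] c by (simp add: algebra_simps)
    qed (use H that in auto)
  qed
  show ?thesis
  proof (rule that)
    fix A :: real assume A: "A \<ge> 1"
    have i: "((\<lambda>r. \<beta> k * (r ^ q / r ^ (k + 2))) has_integral
        \<beta> k / (real q - 1 - real k) * (A ^ q / A ^ (k + 1)) - \<beta> k / (real q - 1 - real k)) {1..A}" if "k < n" for k
    proof (cases "q = k + 1")
      case False
      have "b * ((P - 1) / c) = b / c * P - b / c" for b P c :: real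
        by (simp add: diff_divide_distrib right_diff_distrib)
      with has_integral_mult_right[OF power_quotient_integral[OF _ A False], of "\<beta> k"]
      show ?thesis by (simp only: power_one div_by_1 order_refl simp_thms)
    qed (use \<beta>[OF that] in simp)
    have "integral {1..A} \<Phi> = integral {1..A} (\<lambda>r. e r + (\<Sum>k<n. \<beta> k * (r ^ q / r ^ (k + 2))))"
      by (simp add: e_def)
    also have "\<dots> = J A + (\<Sum>k<n. \<beta> k / (real q - 1 - real k) * (A ^ q / A ^ (k + 1)) - \<beta> k / (real q - 1 - real k))"
      unfolding J_def
      by (intro integral_unique has_integral_add integrable_integral integrable_continuous_real ce has_integral_sum)
         (use i in auto)
    finally have "integral {1..A} \<Phi> = J A + (\<Sum>k<n. \<beta> k / (real q - 1 - real k) * (A ^ q / A ^ (k + 1)))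
       - (\<Sum>k<n. \<beta> k / (real q - 1 - real k))" by (simp add: sum_subtractf)
    moreover have "integral {0..1} \<Phi> + integral {1..A} \<Phi> = integral {0..A} \<Phi>"
      using A by (intro Henstock_Kurzweil_Integration.integral_combine integrable_continuous_real continuous_on_subset[OF cont]) auto
    ultimately show "\<bar>integral {0..A} \<Phi> - ((Z + integral {0..1} \<Phi> - (\<Sum>k<n. \<beta> k / (real q - 1 - real k))) +
        (\<Sum>k<n. \<beta> k / (real q - 1 - real k) * (A ^ q / A ^ (k + 1))))\<bar> \<le> \<bar>c\<bar> * (A ^ q / A ^ (n + 1))"
      using Z[OF A] by (simp add: H_def)
  qed
qed

section \<open>Expansion of the integrals over discs\<close>

context magnetisation
begin

definition angular_coefficient :: "2 \<Rightarrow> nat \<Rightarrow> nat \<Rightarrow> real" where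
  "angular_coefficient j q k = (\<Sum>(\<kappa>, a, b, e)\<leftarrow>expansion_terms k. \<kappa> * multipole j a b e * trig_moment (q + a) b)"

lemma angular_coefficient_integral:
  "((\<lambda>\<theta>. cos \<theta> ^ q * (\<Sum>(\<kappa>, a, b, e)\<leftarrow>expansion_terms k. \<kappa> * multipole j a b e * (cos \<theta> ^ a * sin \<theta> ^ b)))
    has_integral angular_coefficient j q k) {0..2 * pi}"
proof -
  have "((\<lambda>\<theta>. cos \<theta> ^ q * (\<Sum>(\<kappa>, a, b, e)\<leftarrow>L. \<kappa> * multipole j a b e * (cos \<theta> ^ a * sin \<theta> ^ b)))
    has_integral (\<Sum>(\<kappa>, a, b, e)\<leftarrow>L. \<kappa> * multipole j a b e * trig_moment (q + a) b)) {0..2 * pi}" for L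
  proof (induction L)
    case (Cons x L)
    obtain \<kappa> a b e where x: "x = (\<kappa>, a, b, e)" by (cases x)
    have "((\<lambda>\<theta>. \<kappa> * multipole j a b e * (cos \<theta> ^ (q + a) * sin \<theta> ^ b)) has_integral
       \<kappa> * multipole j a b e * trig_moment (q + a) b) {0..2 * pi}"
      by (intro has_integral_mult_right trig_moment_integral)
    from has_integral_add[OF this Cons.IH] show ?case
      by (simp add: x distrib_left power_add mult_ac)
  qed simp
  then show ?thesis by (simp add: angular_coefficient_def)
qed

lemma poisson_scale: "r > 0 \<Longrightarrow> poisson j (r * a) (r * b) 1 t = 1 / r ^ 3 * poisson j a b (1 / r) t"
  by (simp add: poisson_def dist2_scale real_sqrt_mult power_mult_distrib)

lemma circle_integral_expansion:
  assumes r: "r > 0"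
  shows "integral {0..2 * pi} (\<lambda>\<theta>. r * (r * cos \<theta>) ^ q * S (poisson j (r * cos \<theta>) (r * sin \<theta>) 1)) =
    (\<Sum>k<5. angular_coefficient j q k * (r ^ q / r ^ (k + 2))) +
    integral {0..2 * pi} (\<lambda>\<theta>. cos \<theta> ^ q * S (remainder j (1 / r) \<theta>)) * (r ^ q / r ^ 7)"
proof -
  have s: "smooth3_on UNIV (poisson j (cos \<theta>) (sin \<theta>) (1 / r))" for \<theta>
    unfolding smooth3_iff by (rule smooth_family_poisson) auto
  have eq: "r * (r * cos \<theta>) ^ q * S (poisson j (r * cos \<theta>) (r * sin \<theta>) 1) =
    (\<Sum>k<5. r ^ q / r ^ (k + 2) * (cos \<theta> ^ q *
        (\<Sum>(\<kappa>, a, b, e)\<leftarrow>expansion_terms k. \<kappa> * multipole j a b e * (cos \<theta> ^ a * sin \<theta> ^ b))))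
    + r ^ q / r ^ 7 * (cos \<theta> ^ q * S (remainder j (1 / r) \<theta>))" for \<theta>
  proof -
    have "S (poisson j (r * cos \<theta>) (r * sin \<theta>) 1) = 1 / r ^ 3 * S (poisson j (cos \<theta>) (sin \<theta>) (1 / r))"
      using poisson_scale[OF r] by (subst S_scale[OF s, symmetric]) presburger
    moreover have "r * r ^ q * (1 / r ^ 3) * (1 / r) ^ k = r ^ q / r ^ (k + 2)" for k
      using r by (simp add: field_simps eval_nat_numeral)
    then have "r * (r * c) ^ q * (1 / r ^ 3 * ((\<Sum>k<5. (1 / r) ^ k * X k) + (1 / r) ^ 5 * Y)) =
      (\<Sum>k<5. r ^ q / r ^ (k + 2) * (c ^ q * X k)) + r ^ q / r ^ 7 * (c ^ q * Y)" for c Y :: real and X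
    proof -
      have k: "r * (r * c) ^ q * (1 / r ^ 3 * ((1 / r) ^ k * x)) = r ^ q / r ^ (k + 2) * (c ^ q * x)" for k x
        unfolding \<open>\<And>k. r * r ^ q * (1 / r ^ 3) * (1 / r) ^ k = r ^ q / r ^ (k + 2)\<close>[symmetric]
        by (simp only: power_mult_distrib mult_ac)
      show ?thesis
        unfolding distrib_left sum_distrib_left k k[of 5, simplified] by simp
    qed
    ultimately show ?thesis by (simp only: S_poisson_expansion)
  qed
  have "continuous_on {0..2 * pi} (\<lambda>\<theta>. S (remainder j (1 / r) \<theta>))"
    by (rule S_family_continuous)
       (rule smooth_family_reindex[OF smooth_family_remainder[of UNIV j], of _ "\<lambda>\<theta>. (1 / r, \<theta>)", simplified],
         intro continuous_intros)
  then have "((\<lambda>\<theta>. cos \<theta> ^ q * S (remainder j (1 / r) \<theta>)) has_integral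
      integral {0..2 * pi} (\<lambda>\<theta>. cos \<theta> ^ q * S (remainder j (1 / r) \<theta>))) {0..2 * pi}"
    by (intro integrable_integral integrable_continuous_real continuous_intros)
  then show ?thesis
    unfolding eq
    by (subst integral_unique[OF has_integral_add[OF has_integral_sum[OF _ has_integral_mult_right[OF angular_coefficient_integral]]
          has_integral_mult_right]]) (auto simp: mult.commute)
qed

text \<open>The truncation order is left free so that q = n + 1 can be avoided by parity: n = 5
  serves odd q and n = 4 serves even q. A remaining logarithm can only come from an order k with q =
  k + 1, whose coefficient is required to vanish.\<close>

lemma moment_expansion:
  assumes n: "n \<le> 5" and qn: "q \<noteq> n + 1"
    and 0: "\<And>k. k < n \<Longrightarrow> q = k + 1 \<Longrightarrow> angular_coefficient j q k = 0"
  obtains Z C where "\<And>A. A \<ge> 1 \<Longrightarrow>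
    \<bar>integral (ball 0 A) (\<lambda>x. (x $ j) ^ q * B3 M h x) -
      (Z + (\<Sum>k<n. angular_coefficient j q k / (4 * pi * (real q - 1 - real k)) * (A ^ q / A ^ (k + 1))))\<bar> \<le> C * (A ^ q / A ^ (n + 1))"
proof -
  define \<Phi> where "\<Phi> r = integral {0..2 * pi} (\<lambda>\<theta>. r * (r * cos \<theta>) ^ q * S (poisson j (r * cos \<theta>) (r * sin \<theta>) 1))" for r
  define E where "E \<rho> = integral {0..2 * pi} (\<lambda>\<theta>. cos \<theta> ^ q * S (remainder j \<rho> \<theta>))" for \<rho>
  define \<beta> where "\<beta> = angular_coefficient j q"
  have "continuous_on {0..} (\<lambda>r. integral (cbox 0 (2 * pi)) (\<lambda>\<theta>. r * (r * cos \<theta>) ^ q * S (poisson j (r * cos \<theta>) (r * sin \<theta>) 1)))"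
    using continuous_on_poisson_polar[of "{0..} \<times> {0..2 * pi}" j]
    by (intro integral_continuous_on_param) (auto simp: case_prod_beta intro!: continuous_intros)
  then have cont: "continuous_on {0..} \<Phi>" by (simp add: \<Phi>_def[abs_def])
  \<comment> \<open>Radii r at least 1 correspond to \<rho> = 1/r in (0, 1]. Since the remainder
    extends continuously to \<rho> = 0, compactness bounds it uniformly in r.\<close>
  have "continuous_on ({0..1} \<times> {0..2 * pi}) (\<lambda>y. S (remainder j (fst y) (snd y)))"
    by (intro S_family_continuous smooth_family_remainder)
  then have "continuous_on {0..1} (\<lambda>\<rho>. integral (cbox 0 (2 * pi)) (\<lambda>\<theta>. cos \<theta> ^ q * S (remainder j \<rho> \<theta>)))"
    by (intro integral_continuous_on_param) (auto simp: case_prod_beta intro!: continuous_intros)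
  then have "compact (E ` {0..1})"
    by (intro compact_continuous_image) (simp_all add: E_def[abs_def])
  then have "bounded (E ` {0..1})" by (rule compact_imp_bounded)
  then obtain B where "\<forall>x\<in>E ` {0..1}. norm x \<le> B"
    unfolding bounded_iff by blast
  then have B: "\<bar>E \<rho>\<bar> \<le> B" if "0 \<le> \<rho>" "\<rho> \<le> 1" for \<rho>
    using that by auto
  have bound: "\<bar>\<Phi> r - (\<Sum>k<n. \<beta> k * (r ^ q / r ^ (k + 2)))\<bar> \<le> ((\<Sum>k\<in>{n..<5}. \<bar>\<beta> k\<bar>) + B) * (r ^ q / r ^ (n + 2))" if r: "r \<ge> 1" for r
  proof -
    have m: "r ^ q / r ^ k \<le> r ^ q / r ^ (n + 2)" "r ^ q / r ^ k \<ge> 0" if "k \<ge> n + 2" for k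
      using power_quotient_antimono[OF r that] r by auto
    \<comment> \<open>The orders from \<open>n\<close> to 4 are not resolved but counted as error;
      for r at least 1 they decay at least as fast as order \<open>n\<close>.\<close>
    have "{..<5} = {..<n} \<union> {n..<5}" "{..<n} \<inter> {n..<5} = {}" using n by auto
    then have "\<Phi> r - (\<Sum>k<n. \<beta> k * (r ^ q / r ^ (k + 2))) = (\<Sum>k\<in>{n..<5}. \<beta> k * (r ^ q / r ^ (k + 2))) + E (1 / r) * (r ^ q / r ^ 7)"
      using circle_integral_expansion[of r q j] r by (simp add: \<Phi>_def \<beta>_def E_def sum.union_disjoint)
    also have "\<bar>\<dots>\<bar> \<le> (\<Sum>k\<in>{n..<5}. \<bar>\<beta> k * (r ^ q / r ^ (k + 2))\<bar>) + \<bar>E (1 / r) * (r ^ q / r ^ 7)\<bar>"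
      by (intro order_trans[OF abs_triangle_ineq] add_mono sum_abs) auto
    also have "\<dots> \<le> (\<Sum>k\<in>{n..<5}. \<bar>\<beta> k\<bar> * (r ^ q / r ^ (n + 2))) + B * (r ^ q / r ^ (n + 2))"
    proof (intro add_mono sum_mono)
      show "\<bar>\<beta> k * (r ^ q / r ^ (k + 2))\<bar> \<le> \<bar>\<beta> k\<bar> * (r ^ q / r ^ (n + 2))" if "k \<in> {n..<5}" for k
        unfolding abs_mult using m[of "k + 2"] that
        by (intro mult_left_mono) (auto simp only: abs_of_nonneg atLeastLessThan_iff add_le_cancel_right abs_ge_zero)
      show "\<bar>E (1 / r) * (r ^ q / r ^ 7)\<bar> \<le> B * (r ^ q / r ^ (n + 2))"
        unfolding abs_mult using m[of 7] m(2)[of "n + 2"] B[of "1 / r"] r n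
        by (intro mult_mono) (auto simp: abs_of_nonneg)
    qed
    finally show ?thesis by (simp only: distrib_right sum_distrib_right)
  qed
  obtain Z C where Z: "\<And>A. A \<ge> 1 \<Longrightarrow>
    \<bar>integral {0..A} \<Phi> - (Z + (\<Sum>k<n. \<beta> k / (real q - 1 - real k) * (A ^ q / A ^ (k + 1))))\<bar> \<le> C * (A ^ q / A ^ (n + 1))"
    by (rule integral_power_expansion[OF cont bound qn]) (use 0 in \<open>auto simp: \<beta>_def\<close>)
  show ?thesis
  proof (rule that)
    fix A :: real assume A: "A \<ge> 1"
    have "integral (ball 0 A) (\<lambda>x. (x $ j) ^ q * B3 M h x) -
      (Z / (4 * pi) + (\<Sum>k<n. \<beta> k / (4 * pi * (real q - 1 - real k)) * (A ^ q / A ^ (k + 1)))) =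
      (integral {0..A} \<Phi> - (Z + (\<Sum>k<n. \<beta> k / (real q - 1 - real k) * (A ^ q / A ^ (k + 1))))) / (4 * pi)"
    proof -
      have "integral (ball 0 A) (\<lambda>x. (x $ j) ^ q * B3 M h x) = integral {0..A} \<Phi> / (4 * pi)"
        unfolding \<Phi>_def using A by (intro ball_moment_polar) simp
      moreover have "\<beta> k / (4 * pi * c) * y = \<beta> k / c * y / (4 * pi)" for k c y
        by simp
      ultimately show ?thesis
        by (simp only: diff_divide_distrib add_divide_distrib sum_divide_distrib)
    qed
    also have "\<bar>\<dots>\<bar> \<le> C * (A ^ q / A ^ (n + 1)) / (4 * pi)"
    proof -
      have "\<bar>X / (4 * pi)\<bar> \<le> Y / (4 * pi)" if "\<bar>X\<bar> \<le> Y" for X Y :: real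
        using divide_right_mono[OF that, of "4 * pi"] by (simp add: abs_divide)
      then show ?thesis using Z[OF A] .
    qed
    finally show "\<bar>integral (ball 0 A) (\<lambda>x. (x $ j) ^ q * B3 M h x) -
      (Z / (4 * pi) + (\<Sum>k<n. angular_coefficient j q k / (4 * pi * (real q - 1 - real k)) * (A ^ q / A ^ (k + 1))))\<bar> \<le> C / (4 * pi) * (A ^ q / A ^ (n + 1))"
      by (simp only: \<beta>_def times_divide_eq_left)
  qed
qed

end

lemma trig_moment_values:
  "trig_moment 2 0 = pi" "trig_moment 4 0 = 3 / 4 * pi" "trig_moment 6 0 = 5 / 8 * pi"
  "trig_moment 8 0 = 35 / 64 * pi" "trig_moment 10 0 = 63 / 128 * pi" "trig_moment 12 0 = 231 / 512 * pi"
  "trig_moment 14 0 = 429 / 1024 * pi"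
proof -
  show 2: "trig_moment 2 0 = pi" using trig_moment_cos_cos[of 0] by (simp add: trig_moment_0 del: add_2_eq_Suc add_2_eq_Suc')
  show 4: "trig_moment 4 0 = 3 / 4 * pi" using trig_moment_cos_cos[of 2] by (simp add: 2)
  show 6: "trig_moment 6 0 = 5 / 8 * pi" using trig_moment_cos_cos[of 4] by (simp add: 4)
  show 8: "trig_moment 8 0 = 35 / 64 * pi" using trig_moment_cos_cos[of 6] by (simp add: 6)
  show 10: "trig_moment 10 0 = 63 / 128 * pi" using trig_moment_cos_cos[of 8] by (simp add: 8)
  show 12: "trig_moment 12 0 = 231 / 512 * pi" using trig_moment_cos_cos[of 10] by (simp add: 10)
  show "trig_moment 14 0 = 429 / 1024 * pi" using trig_moment_cos_cos[of 12] by (simp add: 12)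
qed

lemma bigo_inverse_powerI:
  fixes f :: "real \<Rightarrow> real"
  assumes "\<And>A. A \<ge> 1 \<Longrightarrow> \<bar>f A\<bar> \<le> C / A ^ n" "N \<le> n"
  shows "f \<in> O(\<lambda>A. 1 / A ^ N)"
proof (rule bigoI[where c = "\<bar>C\<bar>"], use eventually_ge_at_top[of 1] in eventually_elim)
  case (elim A)
  have "\<bar>f A\<bar> \<le> \<bar>C\<bar> * (1 / A ^ n)" using assms(1)[OF elim] elim
    by (metis abs_ge_self divide_right_mono mult.right_neutral order_trans times_divide_eq_right zero_le_power zero_le_one)
  also have "\<dots> \<le> \<bar>C\<bar> * (1 / A ^ N)"
    using elim assms(2) by (intro mult_left_mono divide_left_mono power_increasing) auto
  finally show ?case using elim by simp
qed

context magnetisation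
begin

text \<open>In the terms of order k the exponents a and b of cosine and sine have a sum of the
  parity of k. If q and k have opposite parity, q + a or b is odd and the integral vanishes. This
  includes every case q = k + 1, so no logarithm occurs.\<close>

lemma angular_coefficient_even_order:
  assumes "odd q"
  shows "angular_coefficient j q 0 = 0" "angular_coefficient j q 2 = 0" "angular_coefficient j q 4 = 0"
  using assms by (simp_all add: angular_coefficient_def expansion_terms_def trig_moment_odd_cos trig_moment_odd_sin)

lemma angular_coefficient_odd_order:
  assumes "even q"
  shows "angular_coefficient j q 1 = 0" "angular_coefficient j q 3 = 0"
  using assms by (simp_all add: angular_coefficient_def expansion_terms_def trig_moment_odd_cos trig_moment_odd_sin)

lemma angular_coefficient_0: "angular_coefficient j q 0 = - moment M 3 * trig_moment q 0"
  by (simp add: angular_coefficient_def expansion_terms_def multipole_def S_w)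

lemma angular_coefficient_1: "angular_coefficient j q 1 = 3 * multipole j 1 0 0 * trig_moment (q + 1) 0"
  using trig_moment_1[of q] by (simp add: angular_coefficient_def expansion_terms_def)

text \<open>Eliminating the sine leaves two pure cosine integrals, whose multipole factors do not
  depend on q. A weighted sum over q therefore cancels for every magnetisation once two purely
  numerical sums vanish.\<close>

lemma angular_coefficient_2:
  "angular_coefficient j q 2 = (15 / 2 * multipole j 0 2 0 - 3 / 2 * multipole j 0 0 1) * trig_moment q 0
    + (15 / 2 * multipole j 2 0 0 - 15 / 2 * multipole j 0 2 0) * trig_moment (q + 2) 0"
proof -
  have "trig_moment q 2 = trig_moment q 0 - trig_moment (q + 2) 0"
    using trig_moment_sin_sin[of q 0] by (simp only: add_0)
  moreover have "trig_moment (q + 1) 1 = 0" by (rule trig_moment_1)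
  ultimately show ?thesis
    by (simp add: angular_coefficient_def expansion_terms_def) (simp add: field_simps)
qed

lemma angular_coefficient_3:
  "angular_coefficient j q 3 = (105 / 2 * multipole j 1 2 0 - 15 / 2 * multipole j 1 0 1) * trig_moment (q + 1) 0
    + (35 / 2 * multipole j 3 0 0 - 105 / 2 * multipole j 1 2 0) * trig_moment (q + 3) 0"
proof -
  have "trig_moment (q + 1) 2 = trig_moment (q + 1) 0 - trig_moment (q + 3) 0"
    using trig_moment_sin_sin[of "q + 1" 0] by (simp add: numeral_eq_Suc)
  moreover have "trig_moment q 1 = 0" "trig_moment q 3 = 0" "trig_moment (q + 2) 1 = 0"
    by (simp_all add: trig_moment_odd_sin)
  ultimately show ?thesis
    by (simp add: angular_coefficient_def expansion_terms_def) (simp add: field_simps)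
qed

lemma inverse_power_tendsto_0: "k > 0 \<Longrightarrow> ((\<lambda>A::real. c / A ^ k) \<longlongrightarrow> 0) at_top"
  by (intro real_tendsto_divide_at_top[OF tendsto_const] filterlim_pow_at_top filterlim_ident)

text \<open>Scaling by A^(q-1) gives all odd moments the same powers 1/A and 1/A^3. The constant of
  integration becomes Z / A^(q-1): it is m_j / 2 for q = 1, and lies within the error for q >
  N.\<close>

lemma odd_moment_asymptotics:
  fixes j :: 2
  assumes q: "odd q"
  defines "\<alpha> \<equiv> 3 * multipole j 1 0 0 / (4 * pi)"
    and "x \<equiv> (105 / 2 * multipole j 1 2 0 - 15 / 2 * multipole j 1 0 1) / (4 * pi)"
    and "y \<equiv> (35 / 2 * multipole j 3 0 0 - 105 / 2 * multipole j 1 2 0) / (4 * pi)"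
  assumes N: "N \<le> 5" "q = 1 \<or> N < q"
  shows "(\<lambda>A. integral (ball 0 A) (\<lambda>x. (x $ j) ^ q * B3 M h x) / A ^ (q - 1) -
      ((if q = 1 then moment M (emb j) / 2 else 0) + \<alpha> * (trig_moment (q + 1) 0 / (real q - 2)) / A +
       (x * (trig_moment (q + 1) 0 / (real q - 4)) + y * (trig_moment (q + 3) 0 / (real q - 4))) / A ^ 3))
    \<in> O(\<lambda>A. 1 / A ^ N)"
proof -
  define I where "I A = integral (ball 0 A) (\<lambda>x. (x $ j) ^ q * B3 M h x)" for A
  define u where "u = \<alpha> * (trig_moment (q + 1) 0 / (real q - 2))"
  define v where "v = x * (trig_moment (q + 1) 0 / (real q - 4)) + y * (trig_moment (q + 3) 0 / (real q - 4))"
  obtain p where p: "q = Suc p" using q by (cases q) auto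
  have five: "{..<5} = {0, 1, 2, 3, 4 :: nat}" by auto
  obtain Z C where Z: "\<And>A. A \<ge> 1 \<Longrightarrow>
    \<bar>I A - (Z + (\<Sum>k<5. angular_coefficient j q k / (4 * pi * (real q - 1 - real k)) * (A ^ q / A ^ (k + 1))))\<bar> \<le> C * (A ^ q / A ^ (5 + 1))"
  proof (rule moment_expansion[of 5 q j, folded I_def])
    fix k :: nat assume "k < 5" "q = k + 1"
    then have "even k" "k \<in> {..<5}" using q by auto
    then have "k = 0 \<or> k = 2 \<or> k = 4" unfolding five by auto
    then show "angular_coefficient j q k = 0" using angular_coefficient_even_order[OF q] by auto
  qed (use q in auto)
  have "(\<Sum>k<5. angular_coefficient j q k / (4 * pi * (real q - 1 - real k)) * (A ^ q / A ^ (k + 1))) = A ^ p * (u / A + v / A ^ 3)"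
    if "A \<ge> 1" for A
  proof -
    have "A ^ q / A ^ 2 = A ^ p / A" "A ^ q / A ^ 4 = A ^ p / A ^ 3"
      using that by (simp_all add: p eval_nat_numeral)
    moreover have "angular_coefficient j q 1 / (4 * pi * (real q - 2)) = u"
      by (simp only: angular_coefficient_1 u_def \<alpha>_def times_divide_times_eq)
    moreover have "angular_coefficient j q 3 / (4 * pi * (real q - 4)) = v"
      by (simp only: angular_coefficient_3 v_def x_def y_def times_divide_times_eq add_divide_distrib)
    moreover have "(\<Sum>k<5. angular_coefficient j q k / (4 * pi * (real q - 1 - real k)) * (A ^ q / A ^ (k + 1))) =
      angular_coefficient j q 1 / (4 * pi * (real q - 2)) * (A ^ q / A ^ 2) +
      angular_coefficient j q 3 / (4 * pi * (real q - 4)) * (A ^ q / A ^ 4)"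
      using angular_coefficient_even_order[OF q, of j]
      by (simp add: five power2_eq_square power3_eq_cube power4_eq_xxxx mult.assoc)
    ultimately show ?thesis by (simp add: distrib_left mult.commute)
  qed
  moreover have "A ^ q / A ^ (5 + 1) = A ^ p / A ^ 5" if "A \<ge> 1" for A :: real
    using that by (simp add: p eval_nat_numeral)
  ultimately have Z': "\<bar>I A - (Z + A ^ p * (u / A + v / A ^ 3))\<bar> \<le> C * (A ^ p / A ^ 5)" if "A \<ge> 1" for A
    using Z[OF that] that by simp
  have C: "C \<ge> 0" using Z'[of 1] by simp
  have b: "\<bar>I A / A ^ p - (Z / A ^ p + u / A + v / A ^ 3)\<bar> \<le> C / A ^ 5" if A: "A \<ge> 1" for A
  proof -
    have "\<bar>I A - (Z + A ^ p * (u / A + v / A ^ 3))\<bar> / A ^ p \<le> C * (A ^ p / A ^ 5) / A ^ p"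
      using Z'[OF A] A by (intro divide_right_mono) auto
    also have "\<bar>I A - (Z + A ^ p * (u / A + v / A ^ 3))\<bar> / A ^ p = \<bar>(I A - (Z + A ^ p * (u / A + v / A ^ 3))) / A ^ p\<bar>"
      using A by (simp add: abs_divide)
    also have "(I A - (Z + A ^ p * (u / A + v / A ^ 3))) / A ^ p = I A / A ^ p - (Z / A ^ p + u / A + v / A ^ 3)"
      using A by (simp add: diff_divide_distrib add_divide_distrib)
    finally show ?thesis using A by simp
  qed
  have e: "(\<lambda>A. I A / A ^ p - (Z / A ^ p + u / A + v / A ^ 3)) \<in> O(\<lambda>A. 1 / A ^ N)"
    by (rule bigo_inverse_powerI[OF b N(1)])
  have "(\<lambda>A. I A / A ^ p - ((if q = 1 then moment M (emb j) / 2 else 0) + u / A + v / A ^ 3)) \<in> O(\<lambda>A. 1 / A ^ N)"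
  proof (cases "q = 1")
    case True
    \<comment> \<open>So far \<open>Z\<close> is only known to exist. All other terms tend to 0, so
      it equals the limit of the first moment, which the boundary integrals have computed.\<close>
    have "((\<lambda>A. C / A ^ 5 + (\<bar>u / A ^ 1\<bar> + \<bar>v / A ^ 3\<bar>)) \<longlongrightarrow> 0 + (\<bar>0\<bar> + \<bar>0\<bar>)) at_top"
      by (intro tendsto_intros inverse_power_tendsto_0) auto
    then have lim: "((\<lambda>A. C / A ^ 5 + (\<bar>u / A ^ 1\<bar> + \<bar>v / A ^ 3\<bar>)) \<longlongrightarrow> 0) at_top"
      by simp
    have "\<forall>\<^sub>F A in at_top. norm (I A - Z) \<le> C / A ^ 5 + (\<bar>u / A ^ 1\<bar> + \<bar>v / A ^ 3\<bar>)"
      using eventually_ge_at_top[of 1]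
    proof eventually_elim
      case (elim A)
      have "p = 0" using p True by simp
      then have "\<bar>I A - (Z + u / A + v / A ^ 3)\<bar> \<le> C / A ^ 5" using b[OF elim] by simp
      then show ?case unfolding power_one_right real_norm_def by linarith
    qed
    from Lim_null_comparison[OF this lim] have "((\<lambda>A. I A - Z) \<longlongrightarrow> 0) at_top" .
    then have "(I \<longlongrightarrow> Z) at_top" by (simp add: LIM_zero_cancel)
    moreover have "(I \<longlongrightarrow> moment M (emb j) / 2) at_top"
      using tendsto_first_moment[of j] True by (simp add: I_def[abs_def])
    ultimately have Z2: "Z = moment M (emb j) / 2"
      using tendsto_unique[OF trivial_limit_at_top_linorder] by blast
    show ?thesis using e[unfolded Z2] p True by simp
  next
    case False
    have "(\<lambda>A. Z / A ^ p) \<in> O(\<lambda>A. 1 / A ^ N)"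
      by (rule bigo_inverse_powerI[of _ "\<bar>Z\<bar>" p]) (use False N p in \<open>auto simp: abs_divide\<close>)
    from sum_in_bigo(1)[OF e this] show ?thesis using False by (simp add: algebra_simps)
  qed
  then show ?thesis by (simp add: I_def u_def v_def p)
qed

text \<open>Unlike m_j, the moment m_3 is not the constant of integration but sits in the 1/A term,
  which the extra factor A brings to order 0. That factor would make a constant grow for q = 0, so
  there the vanishing of the flux at infinity is essential.\<close>

lemma even_moment_asymptotics:
  fixes j :: 2
  assumes q: "even q"
  defines "x \<equiv> (15 / 2 * multipole j 0 2 0 - 3 / 2 * multipole j 0 0 1) / (4 * pi)"
    and "y \<equiv> (15 / 2 * multipole j 2 0 0 - 15 / 2 * multipole j 0 2 0) / (4 * pi)"
  assumes N: "N \<le> 4" "q = 0 \<or> N < q"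
  shows "(\<lambda>A. A * integral (ball 0 A) (\<lambda>x. (x $ j) ^ q * B3 M h x) / A ^ q -
      (- moment M 3 / (4 * pi) * (trig_moment q 0 / (real q - 1)) +
       (x * (trig_moment q 0 / (real q - 3)) + y * (trig_moment (q + 2) 0 / (real q - 3))) / A ^ 2))
    \<in> O(\<lambda>A. 1 / A ^ N)"
proof -
  define I where "I A = integral (ball 0 A) (\<lambda>x. (x $ j) ^ q * B3 M h x)" for A
  define u where "u = - moment M 3 / (4 * pi) * (trig_moment q 0 / (real q - 1))"
  define v where "v = x * (trig_moment q 0 / (real q - 3)) + y * (trig_moment (q + 2) 0 / (real q - 3))"
  have four: "{..<4} = {0, 1, 2, 3 :: nat}" by auto
  obtain Z C where Z: "\<And>A. A \<ge> 1 \<Longrightarrow>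
    \<bar>I A - (Z + (\<Sum>k<4. angular_coefficient j q k / (4 * pi * (real q - 1 - real k)) * (A ^ q / A ^ (k + 1))))\<bar> \<le> C * (A ^ q / A ^ (4 + 1))"
  proof (rule moment_expansion[of 4 q j, folded I_def])
    fix k :: nat assume "k < 4" "q = k + 1"
    then have "odd k" "k \<in> {..<4}" using q by auto
    then have "k = 1 \<or> k = 3" unfolding four by auto
    then show "angular_coefficient j q k = 0" using angular_coefficient_odd_order[OF q] by auto
  qed (use q in auto)
  have "(\<Sum>k<4. angular_coefficient j q k / (4 * pi * (real q - 1 - real k)) * (A ^ q / A ^ (k + 1))) = A ^ q / A * (u + v / A ^ 2)"
    if "A \<ge> 1" for A
  proof -
    have "A ^ q / A ^ 3 = A ^ q / A / A ^ 2"
      using that by (simp_all add: eval_nat_numeral)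
    moreover have "angular_coefficient j q 0 / (4 * pi * (real q - 1)) = u"
      by (simp only: angular_coefficient_0 u_def times_divide_times_eq)
    moreover have "angular_coefficient j q 2 / (4 * pi * (real q - 3)) = v"
      by (simp only: angular_coefficient_2 v_def x_def y_def times_divide_times_eq add_divide_distrib)
    moreover have "(\<Sum>k<4. angular_coefficient j q k / (4 * pi * (real q - 1 - real k)) * (A ^ q / A ^ (k + 1))) =
      angular_coefficient j q 0 / (4 * pi * (real q - 1)) * (A ^ q / A) +
      angular_coefficient j q 2 / (4 * pi * (real q - 3)) * (A ^ q / A ^ 3)"
      using angular_coefficient_odd_order[OF q, of j]
      by (simp add: four power2_eq_square power3_eq_cube power4_eq_xxxx mult.assoc)
    ultimately show ?thesis by (simp add: distrib_left mult.commute)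
  qed
  moreover have "A ^ q / A ^ (4 + 1) = A ^ q / A / A ^ 4" if "A \<ge> 1" for A :: real
    using that by (simp add: eval_nat_numeral)
  ultimately have Z': "\<bar>I A - (Z + A ^ q / A * (u + v / A ^ 2))\<bar> \<le> C * (A ^ q / A / A ^ 4)" if "A \<ge> 1" for A
    using Z[OF that] that by simp
  have b: "\<bar>A * I A / A ^ q - (A * Z / A ^ q + u + v / A ^ 2)\<bar> \<le> C / A ^ 4" if A: "A \<ge> 1" for A
  proof -
    have "A / A ^ q * \<bar>I A - (Z + A ^ q / A * (u + v / A ^ 2))\<bar> \<le> A / A ^ q * (C * (A ^ q / A / A ^ 4))"
      using Z'[OF A] A by (intro mult_left_mono) auto
    also have "A / A ^ q * \<bar>I A - (Z + A ^ q / A * (u + v / A ^ 2))\<bar> = \<bar>A / A ^ q * (I A - (Z + A ^ q / A * (u + v / A ^ 2)))\<bar>"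
      using A by (simp add: abs_mult)
    also have "A / A ^ q * (I A - (Z + A ^ q / A * (u + v / A ^ 2))) = A * I A / A ^ q - (A * Z / A ^ q + u + v / A ^ 2)"
      using A by (simp add: right_diff_distrib distrib_left)
    finally show ?thesis using A by simp
  qed
  have e: "(\<lambda>A. A * I A / A ^ q - (A * Z / A ^ q + u + v / A ^ 2)) \<in> O(\<lambda>A. 1 / A ^ N)"
    by (rule bigo_inverse_powerI[OF b N(1)])
  have "(\<lambda>A. A * I A / A ^ q - (u + v / A ^ 2)) \<in> O(\<lambda>A. 1 / A ^ N)"
  proof (cases "q = 0")
    case True
    have "((\<lambda>A. C / A ^ 5 + (\<bar>u / A ^ 1\<bar> + \<bar>v / A ^ 3\<bar>)) \<longlongrightarrow> 0 + (\<bar>0\<bar> + \<bar>0\<bar>)) at_top"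
      by (intro tendsto_intros inverse_power_tendsto_0) auto
    then have lim: "((\<lambda>A. C / A ^ 5 + (\<bar>u / A ^ 1\<bar> + \<bar>v / A ^ 3\<bar>)) \<longlongrightarrow> 0) at_top"
      by simp
    have "\<forall>\<^sub>F A in at_top. norm (I A - Z) \<le> C / A ^ 5 + (\<bar>u / A ^ 1\<bar> + \<bar>v / A ^ 3\<bar>)"
      using eventually_ge_at_top[of 1]
    proof eventually_elim
      case (elim A)
      have "1 / A * (u + v / A ^ 2) = u / A + v / A ^ 3" "C * (1 / A / A ^ 4) = C / A ^ 5"
        using elim by (simp_all add: field_simps eval_nat_numeral)
      then have "\<bar>I A - (Z + (u / A + v / A ^ 3))\<bar> \<le> C / A ^ 5"
        using Z'[OF elim] unfolding True power_0 by (simp only:)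
      then show ?case unfolding power_one_right real_norm_def by linarith
    qed
    from Lim_null_comparison[OF this lim] have "((\<lambda>A. I A - Z) \<longlongrightarrow> 0) at_top" .
    then have "(I \<longlongrightarrow> Z) at_top" by (simp add: LIM_zero_cancel)
    moreover have "(I \<longlongrightarrow> 0) at_top"
      using tendsto_flux True by (simp add: I_def[abs_def])
    ultimately have "Z = 0"
      using tendsto_unique[OF trivial_limit_at_top_linorder] by blast
    then show ?thesis using e True by simp
  next
    case False
    then obtain p where p: "q = Suc p" by (cases q) auto
    \<comment> \<open>The unknown constant contributes Z / A^(q-1), which is within the error
      because q exceeds N.\<close>
    have "(\<lambda>A. A * Z / A ^ q) \<in> O(\<lambda>A. 1 / A ^ N)"
    proof (rule bigo_inverse_powerI[where C = "\<bar>Z\<bar>" and n = p])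
      fix A :: real assume "A \<ge> 1"
      then show "\<bar>A * Z / A ^ q\<bar> \<le> \<bar>Z\<bar> / A ^ p" by (simp add: p abs_divide abs_mult)
    next
      show "N \<le> p" using False N p by auto
    qed
    from sum_in_bigo(1)[OF e this] show ?thesis by (simp add: algebra_simps)
  qed
  then show ?thesis by (simp add: I_def u_def v_def)
qed

end

section \<open>Conditions on the weights\<close>

lemma sum_list_in_bigo:
  fixes f :: "'a \<Rightarrow> real \<Rightarrow> real"
  assumes "\<And>x. x \<in> set L \<Longrightarrow> f x \<in> O[F](g)"
  shows "(\<lambda>A. \<Sum>x\<leftarrow>L. f x A) \<in> O[F](g)"
  using assms by (induction L) (auto intro: sum_in_bigo)

context magnetisation
begin

lemma ball_moment_sum_list:
  "integral (ball 0 A) (\<lambda>x. \<Sum>(c, q)\<leftarrow>L. c * ((x $ j) ^ q * B3 M h x)) =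
    (\<Sum>(c, q)\<leftarrow>L. c * integral (ball 0 A) (\<lambda>x. (x $ j) ^ q * B3 M h x))"
proof -
  have i: "(\<lambda>x. (x $ j) ^ q * B3 M h x) integrable_on ball 0 A" for q
  proof -
    obtain a :: "real^2" where a: "ball 0 A \<subseteq> cbox (- a) a"
      using bounded_subset_cbox_symmetric[OF bounded_ball] by blast
    have "(\<lambda>x. (x $ j) ^ q * B3 M h x) absolutely_integrable_on cbox (- a) a"
      by (intro absolutely_integrable_continuous continuous_intros continuous_on_subset[OF continuous_on_B3]) auto
    then have "(\<lambda>x. (x $ j) ^ q * B3 M h x) absolutely_integrable_on ball 0 A"
      by (rule set_integrable_subset) (use a in auto)
    then show ?thesis by (rule set_lebesgue_integral_eq_integral(1))
  qed
  have "((\<lambda>x. \<Sum>(c, q)\<leftarrow>L. c * ((x $ j) ^ q * B3 M h x)) has_integral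
    (\<Sum>(c, q)\<leftarrow>L. c * integral (ball 0 A) (\<lambda>x. (x $ j) ^ q * B3 M h x))) (ball 0 A)"
  proof (induction L)
    case (Cons p L)
    obtain c q where "p = (c, q)" by (cases p)
    with has_integral_add[OF has_integral_mult_right[OF integrable_integral[OF i[of q]], of c] Cons.IH]
    show ?case by simp
  qed simp
  then show ?thesis by (rule integral_unique)
qed

text \<open>A pair (c, q) stands for the summand c (x_j / A)^(q-1) x_j of the weight. The
  normalisation is 2 because the first moment tends to m_j / 2. The 1/A term has one unknown factor
  and the 1/A^3 term has two independent ones, hence one and two cancellation conditions, each
  required only if the term exceeds the error.\<close>

lemma odd_estimate:
  fixes L :: "(real \<times> nat) list" and j :: 2
  assumes N: "N \<le> 5" and L: "\<And>c q. (c, q) \<in> set L \<Longrightarrow> odd q \<and> (q = 1 \<or> N < q)"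
    and lead: "k * (\<Sum>(c, q)\<leftarrow>L. if q = 1 then c else 0) = 2"
    and cancel1: "1 < N \<Longrightarrow> (\<Sum>(c, q)\<leftarrow>L. c * (trig_moment (q + 1) 0 / (real q - 2))) = 0"
    and cancel3: "3 < N \<Longrightarrow> (\<Sum>(c, q)\<leftarrow>L. c * (trig_moment (q + 1) 0 / (real q - 4))) = 0"
      "3 < N \<Longrightarrow> (\<Sum>(c, q)\<leftarrow>L. c * (trig_moment (q + 3) 0 / (real q - 4))) = 0"
    and f: "\<And>A x. A > 0 \<Longrightarrow> f A x = (\<Sum>(c, q)\<leftarrow>L. c / A ^ (q - 1) * ((x $ j) ^ q * B3 M h x))"
  shows "(\<lambda>A. moment M (emb j) - k * integral (ball 0 A) (f A)) \<in> O(\<lambda>A. 1 / A ^ N)"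
proof -
  define I where "I q A = integral (ball 0 A) (\<lambda>x. (x $ j) ^ q * B3 M h x)" for q A
  define \<alpha> x y where "\<alpha> = 3 * multipole j 1 0 0 / (4 * pi)"
    and "x = (105 / 2 * multipole j 1 2 0 - 15 / 2 * multipole j 1 0 1) / (4 * pi)"
    and "y = (35 / 2 * multipole j 3 0 0 - 105 / 2 * multipole j 1 2 0) / (4 * pi)"
  define e where "e q A = I q A / A ^ (q - 1) -
      ((if q = 1 then moment M (emb j) / 2 else 0) + \<alpha> * (trig_moment (q + 1) 0 / (real q - 2)) / A +
       (x * (trig_moment (q + 1) 0 / (real q - 4)) + y * (trig_moment (q + 3) 0 / (real q - 4))) / A ^ 3)" for q A
  have "e q \<in> O(\<lambda>A. 1 / A ^ N)" if "(c, q) \<in> set L" for c q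
    unfolding e_def[abs_def] I_def \<alpha>_def x_def y_def
    by (rule odd_moment_asymptotics) (use L[OF that] N in auto)
  then have 1: "(\<lambda>A. \<Sum>(c, q)\<leftarrow>L. c * e q A) \<in> O(\<lambda>A. 1 / A ^ N)"
    unfolding case_prod_unfold by (intro sum_list_in_bigo) (auto simp: landau_o.big.cmult_in_iff)
  define s1 s3 where "s1 = \<alpha> * (\<Sum>(c, q)\<leftarrow>L. c * (trig_moment (q + 1) 0 / (real q - 2)))"
    and "s3 = x * (\<Sum>(c, q)\<leftarrow>L. c * (trig_moment (q + 1) 0 / (real q - 4))) + y * (\<Sum>(c, q)\<leftarrow>L. c * (trig_moment (q + 3) 0 / (real q - 4)))"
  have 2: "(\<lambda>A. s1 / A) \<in> O(\<lambda>A. 1 / A ^ N)"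
  proof (cases "1 < N")
    case False
    then show ?thesis by (intro bigo_inverse_powerI[where C = "\<bar>s1\<bar>" and n = 1]) (auto simp: abs_divide)
  next
    case True
    then have "s1 = 0" by (simp only: s1_def cancel1 mult_zero_right)
    then show ?thesis by simp
  qed
  have 3: "(\<lambda>A. s3 / A ^ 3) \<in> O(\<lambda>A. 1 / A ^ N)"
  proof (cases "3 < N")
    case False
    then show ?thesis by (intro bigo_inverse_powerI[where C = "\<bar>s3\<bar>" and n = 3]) (auto simp: abs_divide)
  next
    case True
    then have "s3 = 0" by (simp only: s3_def cancel3 mult_zero_right add_0)
    then show ?thesis by simp
  qed
  have split: "(\<Sum>(c, q)\<leftarrow>L. c * e q A) = (\<Sum>(c, q)\<leftarrow>L. c / A ^ (q - 1) * I q A) -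
      ((\<Sum>(c, q)\<leftarrow>L. if q = 1 then c else 0) * moment M (emb j) / 2 + s1 / A + s3 / A ^ 3)" for A
    unfolding s1_def s3_def e_def
    by (induction L) (auto simp: algebra_simps add_divide_distrib diff_divide_distrib)
  have 4: "(\<lambda>A. - k * ((\<Sum>(c, q)\<leftarrow>L. c * e q A) + s1 / A + s3 / A ^ 3)) \<in> O(\<lambda>A. 1 / A ^ N)"
    using sum_in_bigo(1)[OF sum_in_bigo(1)[OF 1 2] 3] by (cases "k = 0") simp_all
  have "\<forall>\<^sub>F A in at_top. - k * ((\<Sum>(c, q)\<leftarrow>L. c * e q A) + s1 / A + s3 / A ^ 3) =
      moment M (emb j) - k * integral (ball 0 A) (f A)"
    using eventually_gt_at_top[of 0]
  proof eventually_elim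
    case (elim A)
    have "integral (ball 0 A) (f A) = (\<Sum>(c, q)\<leftarrow>L. c / A ^ (q - 1) * I q A)"
    proof -
      have "f A = (\<lambda>x. \<Sum>(c, q)\<leftarrow>map (\<lambda>(c, q). (c / A ^ (q - 1), q)) L. c * ((x $ j) ^ q * B3 M h x))"
        using f[OF elim] by (simp add: fun_eq_iff comp_def case_prod_unfold)
      then show ?thesis
        unfolding I_def by (simp only: ball_moment_sum_list) (simp add: comp_def case_prod_unfold)
    qed
    moreover have "- k * (X - (P * m / 2 + a + b) + a + b) = m - k * X" if "k * P = 2" for X P m a b :: real
    proof -
      have "- k * (X - (P * m / 2 + a + b) + a + b) = (k * P) * m / 2 - k * X"
        by (simp add: algebra_simps)
      then show ?thesis by (simp add: that)
    qed
    ultimately show ?case unfolding split using lead by (simp only:)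
  qed
  from landau_o.big.in_cong[OF this] 4 show ?thesis by (rule iffD1)
qed

text \<open>A pair (c, q) stands for c (x_j / A)^q. Here the normalisation involves every q, because
  each even moment carries m_3 in its leading term, with factor - trig_moment q 0 / (4 pi (q - 1));
  hence the value - 4 pi.\<close>

lemma even_estimate:
  fixes L :: "(real \<times> nat) list" and j :: 2
  assumes N: "N \<le> 4" and L: "\<And>c q. (c, q) \<in> set L \<Longrightarrow> even q \<and> (q = 0 \<or> N < q)"
    and lead: "k * (\<Sum>(c, q)\<leftarrow>L. c * (trig_moment q 0 / (real q - 1))) = - 4 * pi"
    and cancel2: "2 < N \<Longrightarrow> (\<Sum>(c, q)\<leftarrow>L. c * (trig_moment q 0 / (real q - 3))) = 0"
      "2 < N \<Longrightarrow> (\<Sum>(c, q)\<leftarrow>L. c * (trig_moment (q + 2) 0 / (real q - 3))) = 0"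
    and f: "\<And>A x. A > 0 \<Longrightarrow> f A x = (\<Sum>(c, q)\<leftarrow>L. c / A ^ q * ((x $ j) ^ q * B3 M h x))"
  shows "(\<lambda>A. moment M 3 - k * A * integral (ball 0 A) (f A)) \<in> O(\<lambda>A. 1 / A ^ N)"
proof -
  define I where "I q A = integral (ball 0 A) (\<lambda>x. (x $ j) ^ q * B3 M h x)" for q A
  define \<alpha> x y where "\<alpha> = - moment M 3 / (4 * pi)"
    and "x = (15 / 2 * multipole j 0 2 0 - 3 / 2 * multipole j 0 0 1) / (4 * pi)"
    and "y = (15 / 2 * multipole j 2 0 0 - 15 / 2 * multipole j 0 2 0) / (4 * pi)"
  define e where "e q A = A * I q A / A ^ q -
      (\<alpha> * (trig_moment q 0 / (real q - 1)) +
       (x * (trig_moment q 0 / (real q - 3)) + y * (trig_moment (q + 2) 0 / (real q - 3))) / A ^ 2)" for q A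
  have "e q \<in> O(\<lambda>A. 1 / A ^ N)" if "(c, q) \<in> set L" for c q
    unfolding e_def[abs_def] I_def \<alpha>_def x_def y_def
    by (rule even_moment_asymptotics) (use L[OF that] N in auto)
  then have 1: "(\<lambda>A. \<Sum>(c, q)\<leftarrow>L. c * e q A) \<in> O(\<lambda>A. 1 / A ^ N)"
    unfolding case_prod_unfold by (intro sum_list_in_bigo) (auto simp: landau_o.big.cmult_in_iff)
  define s2 where "s2 = x * (\<Sum>(c, q)\<leftarrow>L. c * (trig_moment q 0 / (real q - 3))) + y * (\<Sum>(c, q)\<leftarrow>L. c * (trig_moment (q + 2) 0 / (real q - 3)))"
  have 2: "(\<lambda>A. s2 / A ^ 2) \<in> O(\<lambda>A. 1 / A ^ N)"
  proof (cases "2 < N")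
    case False
    then show ?thesis by (intro bigo_inverse_powerI[where C = "\<bar>s2\<bar>" and n = 2]) (auto simp: abs_divide)
  next
    case True
    then have "s2 = 0" by (simp only: s2_def cancel2 mult_zero_right add_0)
    then show ?thesis by simp
  qed
  have split: "(\<Sum>(c, q)\<leftarrow>L. c * e q A) = A * (\<Sum>(c, q)\<leftarrow>L. c / A ^ q * I q A) -
      (\<alpha> * (\<Sum>(c, q)\<leftarrow>L. c * (trig_moment q 0 / (real q - 1))) + s2 / A ^ 2)" for A
    unfolding s2_def e_def
    by (induction L) (auto simp: algebra_simps add_divide_distrib diff_divide_distrib)
  have 4: "(\<lambda>A. - k * ((\<Sum>(c, q)\<leftarrow>L. c * e q A) + s2 / A ^ 2)) \<in> O(\<lambda>A. 1 / A ^ N)"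
    using sum_in_bigo(1)[OF 1 2] by (cases "k = 0") simp_all
  have "\<forall>\<^sub>F A in at_top. - k * ((\<Sum>(c, q)\<leftarrow>L. c * e q A) + s2 / A ^ 2) =
      moment M 3 - k * A * integral (ball 0 A) (f A)"
    using eventually_gt_at_top[of 0]
  proof eventually_elim
    case (elim A)
    have "integral (ball 0 A) (f A) = (\<Sum>(c, q)\<leftarrow>L. c / A ^ q * I q A)"
    proof -
      have "f A = (\<lambda>x. \<Sum>(c, q)\<leftarrow>map (\<lambda>(c, q). (c / A ^ q, q)) L. c * ((x $ j) ^ q * B3 M h x))"
        using f[OF elim] by (simp add: fun_eq_iff comp_def case_prod_unfold)
      then show ?thesis
        unfolding I_def by (simp only: ball_moment_sum_list) (simp add: comp_def case_prod_unfold)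
    qed
    moreover have "- k * (A * X - (\<alpha> * P + b) + b) = moment M 3 - k * A * X" if "k * P = - 4 * pi" for X P b :: real
    proof -
      have "- k * (A * X - (\<alpha> * P + b) + b) = \<alpha> * (k * P) - k * A * X"
        by (simp add: algebra_simps)
      then show ?thesis by (simp add: that \<alpha>_def)
    qed
    ultimately show ?case unfolding split using lead by (simp only:)
  qed
  from landau_o.big.in_cong[OF this] 4 show ?thesis by (rule iffD1)
qed

end

section \<open>Verification of the weights of each order\<close>

lemma magnetisation_exists:
  assumes distr: "\<And>i. cdistr (M i)"
    and Q: "Q = dsupp (M 1) \<union> dsupp (M 2) \<union> dsupp (M 3)" "Q \<noteq> {}" "\<forall>t\<in>Q. t $ 3 < h"
  obtains d where "magnetisation M h d"
proof -
  have "compact Q" unfolding Q(1) by (intro compact_Un compact_dsupp distr)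
  moreover have "continuous_on Q (\<lambda>t. t $ 3)" by (intro continuous_intros)
  ultimately obtain s where s: "s \<in> Q" "\<And>t. t \<in> Q \<Longrightarrow> t $ 3 \<le> s $ 3"
    using continuous_attains_sup[of Q "\<lambda>t. t $ 3"] Q(2) by blast
  have "dsupp (M i) \<subseteq> Q" for i using exhaust_3[of i] Q(1) by auto
  \<comment> \<open>At the highest point of the compact support the gap to the plane is positive;
    half of it is strictly smaller than every gap.\<close>
  then have "magnetisation M h ((h - s $ 3) / 2)"
    using s Q(3) distr by unfold_locales (force simp: field_simps)+
  then show ?thesis by (rule that)
qed

theorem theorem1p1:
  fixes M :: "3 \<Rightarrow> (real^3 \<Rightarrow> real) \<Rightarrow> real" and h :: real and Q :: "(real^3) set"
  defines "F \<equiv> inf at_top (principal {A::real. 0 < A \<and> large_enough Q h A})"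
  assumes distr: "\<And>i. cdistr (M i)"
    and Q_def: "Q = dsupp (M 1) \<union> dsupp (M 2) \<union> dsupp (M 3)"
    and Q_ne: "Q \<noteq> {}"
    and h_pos: "h > 0"
    and below: "\<forall>t\<in>Q. t$3 < h"
    and lowest: "(INF t\<in>Q. t$3) = 0"
    and centre1: "(SUP t\<in>Q. t$1) + (INF t\<in>Q. t$1) = 0"
    and centre2: "(SUP t\<in>Q. t$2) + (INF t\<in>Q. t$2) = 0"
  shows "\<forall>j\<in>{1,2::nat}.
    (\<lambda>A. moment M (of_nat j) - 2 * integral (ball 0 A) (\<lambda>x. x$(of_nat j) * B3 M h x))
       \<in> O[F](\<lambda>A. 1 / A) \<and>
    (\<lambda>A. moment M (of_nat j) - 2 * integral (ball 0 A)
        (\<lambda>x. (1 + 4 * (x$(of_nat j))^2 / (3 * A^2)) * x$(of_nat j) * B3 M h x))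
       \<in> O[F](\<lambda>A. 1 / A^2) \<and>
    (\<lambda>A. moment M 3 - 2 * A * integral (ball 0 A) (\<lambda>x. B3 M h x))
       \<in> O[F](\<lambda>A. 1 / A^2) \<and>
    (\<lambda>A. moment M (of_nat j) - 2/5 * integral (ball 0 A)
        (\<lambda>x. (5 + 24 * (x$(of_nat j) / A)^4) * x$(of_nat j) * B3 M h x))
       \<in> O[F](\<lambda>A. 1 / A^3) \<and>
    (\<lambda>A. moment M 3 - A/4 * integral (ball 0 A)
        (\<lambda>x. (5 + 40 * (x$(of_nat j) / A)^4 - 128 * (x$(of_nat j) / A)^6) * B3 M h x))
       \<in> O[F](\<lambda>A. 1 / A^3) \<and>
    (\<lambda>A. moment M (of_nat j) - 2/105 * integral (ball 0 A)
        (\<lambda>x. (105 - 2016 * (x$(of_nat j) / A)^4 + 19200 * (x$(of_nat j) / A)^6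
              - 22400 * (x$(of_nat j) / A)^8) * x$(of_nat j) * B3 M h x))
       \<in> O[F](\<lambda>A. 1 / A^4) \<and>
    (\<lambda>A. moment M 3 - A/24 * integral (ball 0 A)
        (\<lambda>x. (35 + 1792 * (x$(of_nat j) / A)^6 - 3200 * (x$(of_nat j) / A)^8) * B3 M h x))
       \<in> O[F](\<lambda>A. 1 / A^4) \<and>
    (\<lambda>A. moment M (of_nat j) - 2/693 * integral (ball 0 A)
        (\<lambda>x. (693 - 158400 * (x$(of_nat j) / A)^6 + 739200 * (x$(of_nat j) / A)^8
              - 677376 * (x$(of_nat j) / A)^10) * x$(of_nat j) * B3 M h x))
       \<in> O[F](\<lambda>A. 1 / A^5)"
proof (rule ballI, goal_cases)
  case j: (1 j)
  obtain d where "magnetisation M h d"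
    using magnetisation_exists[OF distr Q_def Q_ne below] .
  then interpret magnetisation M h d .
  \<comment> \<open>The condition on A only refines the filter at infinity, so estimates for all
    large A carry over.\<close>
  have F: "F \<le> at_top" by (simp add: F_def)
  have emb: "emb (of_nat j) = of_nat j" using j by (auto simp: emb_def)
  \<comment> \<open>The first value is repeated in successor form, the shape in which simplification
    leaves the exponent 1 + 1.\<close>
  note trig_values = trig_moment_values trig_moment_values(1)[unfolded numeral_2_eq_2]
  note odd = landau_o.big.filter_mono[OF F odd_estimate[of _ _ _ _ "of_nat j", unfolded emb]]
  note even = landau_o.big.filter_mono[OF F even_estimate[of _ _ _ _ "of_nat j"]]
  have 1: "(\<lambda>A. moment M (of_nat j) - 2 * integral (ball 0 A) (\<lambda>x. x$(of_nat j) * B3 M h x))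
       \<in> O[F](\<lambda>A. 1 / A ^ 1)"
    by (rule odd[of 1 "[(1, 1)]"]) simp_all
  have 2: "(\<lambda>A. moment M (of_nat j) - 2 * integral (ball 0 A)
        (\<lambda>x. (1 + 4 * (x$(of_nat j))^2 / (3 * A^2)) * x$(of_nat j) * B3 M h x))
       \<in> O[F](\<lambda>A. 1 / A^2)"
  \<comment> \<open>The stored exponent 3 includes the separate factor x_j. The 1/A term cancels
    since - pi + 4/3 * 3/4 pi = 0.\<close>
  proof (rule odd[of 2 "[(1, 1), (4 / 3, 3)]"], goal_cases)
    case 7 then show ?case by (simp add: field_simps eval_nat_numeral)
  qed (auto simp: trig_values)
  have 3: "(\<lambda>A. moment M 3 - 2 * A * integral (ball 0 A) (\<lambda>x. B3 M h x))
       \<in> O[F](\<lambda>A. 1 / A^2)"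
    by (rule even[of 2 "[(1, 0)]"]) (simp_all add: trig_moment_0)
  have 4: "(\<lambda>A. moment M (of_nat j) - 2/5 * integral (ball 0 A)
        (\<lambda>x. (5 + 24 * (x$(of_nat j) / A)^4) * x$(of_nat j) * B3 M h x))
       \<in> O[F](\<lambda>A. 1 / A^3)"
  proof (rule odd[of 3 "[(5, 1), (24, 5)]"], goal_cases)
    case 7 then show ?case by (simp add: field_simps eval_nat_numeral)
  qed (auto simp: trig_values)
  have 5: "(\<lambda>A. moment M 3 - 1/4 * A * integral (ball 0 A)
        (\<lambda>x. (5 + 40 * (x$(of_nat j) / A)^4 - 128 * (x$(of_nat j) / A)^6) * B3 M h x))
       \<in> O[F](\<lambda>A. 1 / A^3)"
  \<comment> \<open>The normalising sum is - 10 pi + 10 pi - 16 pi, a quarter of which is - 4 pi.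
    The exponent 2 is inadmissible, being at most N = 3.\<close>
  proof (rule even[of 3 "[(5, 0), (40, 4), (- 128, 6)]"], goal_cases)
    case 6 then show ?case by (simp add: field_simps)
  qed (auto simp: trig_values trig_moment_0)
  have 6: "(\<lambda>A. moment M (of_nat j) - 2/105 * integral (ball 0 A)
        (\<lambda>x. (105 - 2016 * (x$(of_nat j) / A)^4 + 19200 * (x$(of_nat j) / A)^6
              - 22400 * (x$(of_nat j) / A)^8) * x$(of_nat j) * B3 M h x))
       \<in> O[F](\<lambda>A. 1 / A^4)"
  \<comment> \<open>This is the first order at which the 1/A^3 term must go too: four conditions for
    four coefficients.\<close>
  proof (rule odd[of 4 "[(105, 1), (- 2016, 5), (19200, 7), (- 22400, 9)]"], goal_cases)
    case 7 then show ?case by (simp add: field_simps eval_nat_numeral)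
  qed (auto simp: trig_values)
  have 7: "(\<lambda>A. moment M 3 - 1/24 * A * integral (ball 0 A)
        (\<lambda>x. (35 + 1792 * (x$(of_nat j) / A)^6 - 3200 * (x$(of_nat j) / A)^8) * B3 M h x))
       \<in> O[F](\<lambda>A. 1 / A^4)"
  proof (rule even[of 4 "[(35, 0), (1792, 6), (- 3200, 8)]"], goal_cases)
    case 6 then show ?case by (simp add: field_simps)
  qed (auto simp: trig_values trig_moment_0)
  have 8: "(\<lambda>A. moment M (of_nat j) - 2/693 * integral (ball 0 A)
        (\<lambda>x. (693 - 158400 * (x$(of_nat j) / A)^6 + 739200 * (x$(of_nat j) / A)^8
              - 677376 * (x$(of_nat j) / A)^10) * x$(of_nat j) * B3 M h x))
       \<in> O[F](\<lambda>A. 1 / A^5)"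
  \<comment> \<open>The conditions are those of fourth order, since no 1/A^4 term occurs for odd q;
    only the exponent 5 ceases to be admissible, so the three higher exponents move up by 2.\<close>
  proof (rule odd[of 5 "[(693, 1), (- 158400, 7), (739200, 9), (- 677376, 11)]"], goal_cases)
    case 7 then show ?case by (simp add: field_simps eval_nat_numeral)
  qed (auto simp: trig_values)
  have mult: "1 / n * A = A / n" for n A :: real by simp
  show ?case
    using 1[unfolded power_one_right] 2 3 4 5[unfolded mult] 6 7[unfolded mult] 8 by (intro conjI)
qed

end
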